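(* Fix a positive integer $r$ and one of the six models. There is a constant $C$ (depending on the model and $r$, not on $N,N_1,N_2$) such that for every $N_1,N_2$ with $N=N_1+N_2$ and $N_1r/K$, $N_2r/K$ integers, $$\mathbb{E}\big[H(\mathbb{G}(N,r))\big]\ge\mathbb{E}\big[H(\mathbb{G}(N_1,r))\big]+\mathbb{E}\big[H(\mathbb{G}(N_2,r))\big]-CN^{5/6}.$$
   Context: Let $K\ge2$, $\chi=\{0,\dots,q-1\}$. For $n$ with $nr/K\in\mathbb{Z}$, $\mathbb{G}(n,r)$ is the configuration-model random $r$-regular hypergraph on $n$ nodes: each node gets $r$ points, a uniformly random partition of the $nr$ points into blocks of size $K$ is chosen, and each block is projected to the hyperedge formed by the owners of its points. For a hypergraph $G$, $H(x)=\sum_iH_i(x_i)+\sum_{e\in E}H_e(x_e)$ and $H(G)=\max_xH(x)$. Models: Independent set ($K=2,q=2$, $H_i(1)=1,H_i(0)=0$, $H_e(1,1)=-\infty$, else $0$); MAX-CUT ($K=2,q=2$, $H_i\equiv0$, $H_e(x,y)=\mathbf 1[x\ne y]$); anti-ferromagnetic Ising ($K=2,q=2$, fixed $\beta>0,B\in\mathbb{R}$, $H_i(0)=-B,H_i(1)=B$, $H_e(x,y)=-\beta$ if $x=y$, $\beta$ otherwise); $q$-Coloring ($K=2$, $H_i\equiv0$, $H_e(x,y)=\mathbf 1[x\ne y]$); K-SAT ($q=2$, $H_i\equiv0$, independent uniform $a_e\in\{0,1\}^K$, $H_e(a_e)=0$, $1$ otherwise); NAE-K-SAT ($H_e(a_e)=H_e(\mathbf1-a_e)=0$,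 $1$ otherwise). *)

theory Defs
  imports "HOL-Probability.Probability"
begin

(* A model: hyperedge size K, alphabet chi = {0..<q}, node potential H_i (real),
   and a distribution of the (i.i.d.) edge potential H_e : chi^K -> ereal
   (deterministic models use return_pmf; K-SAT / NAE-K-SAT draw a random sign vector a_e). *)
record model =
  mK :: nat
  mq :: nat
  hnode :: "nat \<Rightarrow> real"
  hedge :: "(nat list \<Rightarrow> ereal) pmf"

(* Configuration model: node i owns points {i*r ..< (i+1)*r}; owner of point p is p div r. *)
definition block_partitions :: "nat \<Rightarrow> nat \<Rightarrow> nat \<Rightarrow> nat set set set" where
  "block_partitions K n r = {P. partition_on {..<n*r} P \<and> (\<forall>B\<in>P. card B = K)}"

definition block_edge :: "nat \<Rightarrow> nat set \<Rightarrow> nat list" where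
  "block_edge r B = map (\<lambda>p. p div r) (sorted_list_of_set B)"

definition rand_graph :: "model \<Rightarrow> nat \<Rightarrow> nat \<Rightarrow> (nat set set \<times> (nat set \<Rightarrow> nat list \<Rightarrow> ereal)) pmf" where
  "rand_graph M n r =
     do { P \<leftarrow> pmf_of_set (block_partitions (mK M) n r);
          th \<leftarrow> Pi_pmf P (\<lambda>_. 0) (\<lambda>_. hedge M);
          return_pmf (P, th) }"

definition Hx :: "model \<Rightarrow> nat \<Rightarrow> nat \<Rightarrow> nat set set \<Rightarrow> (nat set \<Rightarrow> nat list \<Rightarrow> ereal) \<Rightarrow> (nat \<Rightarrow> nat) \<Rightarrow> ereal" where
  "Hx M n r P th x = ereal (\<Sum>i<n. hnode M (x i)) + (\<Sum>B\<in>P. th B (map x (block_edge r B)))"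

definition HG :: "model \<Rightarrow> nat \<Rightarrow> nat \<Rightarrow> nat set set \<Rightarrow> (nat set \<Rightarrow> nat list \<Rightarrow> ereal) \<Rightarrow> ereal" where
  "HG M n r P th = Max (Hx M n r P th ` ({..<n} \<rightarrow>\<^sub>E {..<mq M}))"

definition EH :: "model \<Rightarrow> nat \<Rightarrow> nat \<Rightarrow> real" where
  "EH M n r = measure_pmf.expectation (rand_graph M n r) (\<lambda>(P, th). real_of_ereal (HG M n r P th))"

definition indep_set :: model where
  "indep_set = \<lparr> mK = 2, mq = 2, hnode = (\<lambda>v. if v = 1 then 1 else 0),
     hedge = return_pmf (\<lambda>y. if y ! 0 = 1 \<and> y ! 1 = 1 then -\<infinity> else 0) \<rparr>"

definition maxcut :: model where
  "maxcut = \<lparr> mK = 2, mq = 2, hnode = (\<lambda>_. 0),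
     hedge = return_pmf (\<lambda>y. if y ! 0 \<noteq> y ! 1 then 1 else 0) \<rparr>"

definition afm_ising :: "real \<Rightarrow> real \<Rightarrow> model" where
  "afm_ising \<beta> Bf = \<lparr> mK = 2, mq = 2, hnode = (\<lambda>v. if v = 0 then - Bf else Bf),
     hedge = return_pmf (\<lambda>y. if y ! 0 = y ! 1 then ereal (- \<beta>) else ereal \<beta>) \<rparr>"

definition coloring :: "nat \<Rightarrow> model" where
  "coloring q = \<lparr> mK = 2, mq = q, hnode = (\<lambda>_. 0),
     hedge = return_pmf (\<lambda>y. if y ! 0 \<noteq> y ! 1 then 1 else 0) \<rparr>"

definition sign_vectors :: "nat \<Rightarrow> nat list set" where
  "sign_vectors K = {a. length a = K \<and> set a \<subseteq> {0, 1}}"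

definition ksat :: "nat \<Rightarrow> model" where
  "ksat K = \<lparr> mK = K, mq = 2, hnode = (\<lambda>_. 0),
     hedge = map_pmf (\<lambda>a y. if y = a then 0 else 1) (pmf_of_set (sign_vectors K)) \<rparr>"

definition naeksat :: "nat \<Rightarrow> model" where
  "naeksat K = \<lparr> mK = K, mq = 2, hnode = (\<lambda>_. 0),
     hedge = map_pmf (\<lambda>a y. if y = a \<or> y = map (\<lambda>t. 1 - t) a then 0 else 1)
               (pmf_of_set (sign_vectors K)) \<rparr>"

definition six_models :: "model \<Rightarrow> bool" where
  "six_models M \<longleftrightarrow>
     M = indep_set \<or> M = maxcut \<or> (\<exists>\<beta> Bf. \<beta> > 0 \<and> M = afm_ising \<beta> Bf) \<or>
     (\<exists>q\<ge>2. M = coloring q) \<or> (\<exists>K\<ge>2. M = ksat K) \<or> (\<exists>K\<ge>2. M = naeksat K)"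

end

theory Submission
  imports Defs
begin

text \<open>
  Write \<open>A\<close> and \<open>B\<close> for the points of the first \<open>N1\<close> and the last \<open>N2\<close> nodes, and call the number of
  \<open>A\<close>-points of a block its type. Given the multiset of types, the partition is uniform, so the
  expected optimum becomes a function \<open>f\<close> of multisets of types, and \<open>f\<close> is Lipschitz because one
  block changes the optimum by a bounded amount. The types \<open>K\<close> and \<open>0\<close> alone describe two separate graphs.

  The loss caused by a new block is a positive combination of indicators that all nodes of the block
  are tied together, by a partial equivalence relation, in every near-optimal assignment. Summing over the classes,
  with \<open>a\<close> and \<open>b\<close> the fractions of the free \<open>A\<close>- and \<open>B\<close>-points in a class, the inequality
  \<open>a^k b^(K-k) \<le> (k/K) a^K + (1-k/K) b^K\<close> shows that replacing a block of type \<open>k\<close> by one of type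
  \<open>K\<close> with probability \<open>k/K\<close>, and of type \<open>0\<close> otherwise, does not increase \<open>f\<close>, up to the error
  \<open>O(1/x + 1/y)\<close> of sampling without replacement from \<open>x\<close> and \<open>y\<close> free points.

  Dropping \<open>O(n^(5/6))\<close> blocks leaves enough free points. The replacement preserves the mean number of
  used \<open>A\<close>-points, so its deviation \<open>d\<close> is controlled by an induction carrying the potential
  \<open>d^2 / n^(2/3)\<close>, which also absorbs the states where the free points run out.
\<close>

section \<open>Averages over blocks of a given type\<close>

text \<open>A full partition leaves no free points, while one replacement costs about the reciprocal
  of the number of free points. So \<open>f\<close> has to make sense for partial configurations
  too, and free points are bought by dropping blocks. With n points, s free points cost O(s), at
  most n replacements cost O(n/s), and a final deviation d costs O(|d|) when the pure multiset that
  was reached is exchanged for the balanced one. No concentration inequality is used: |d| <= d^2/R +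
  R turns the last cost into a quadratic function, which one replacement raises by at most K^2/R on
  average, so the expected cost is O(n/R + R). Where |d| > s, the term s^2/R has to outweigh the
  Lipschitz bound O(n). The loss allowed is n^(5/6), so s is taken of that order; the last demand
  then permits R up to the order n^(2/3). The errors n/R, R and n/s are all of smaller order than
  s.\<close>

definition avg :: "'a set \<Rightarrow> ('a \<Rightarrow> real) \<Rightarrow> real" where
  "avg S g = (\<Sum>s\<in>S. g s) / real (card S)"

lemma avg_mono: "(\<And>s. s \<in> S \<Longrightarrow> g s \<le> h s) \<Longrightarrow> avg S g \<le> avg S h"
  unfolding avg_def by (intro divide_right_mono sum_mono) auto

lemma avg_add: "avg S (\<lambda>s. g s + h s) = avg S g + avg S h"
  by (simp add: avg_def sum.distrib add_divide_distrib)

lemma avg_diff: "avg S (\<lambda>s. g s - h s) = avg S g - avg S h"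
  by (simp add: avg_def sum_subtractf diff_divide_distrib)

lemma avg_cmult: "avg S (\<lambda>s. c * g s) = c * avg S g"
  by (simp add: avg_def sum_distrib_left[symmetric])

lemma avg_const: "finite S \<Longrightarrow> S \<noteq> {} \<Longrightarrow> avg S (\<lambda>_. c) = c"
  by (simp add: avg_def)

lemma avg_sum: "avg S (\<lambda>s. \<Sum>i\<in>I. g i s) = (\<Sum>i\<in>I. avg S (g i))"
  unfolding avg_def by (subst sum.swap) (simp add: sum_divide_distrib)

lemma avg_cong: "(\<And>s. s \<in> S \<Longrightarrow> g s = h s) \<Longrightarrow> avg S g = avg S h"
  by (simp add: avg_def cong: sum.cong)

section \<open>Counting blocks of one type\<close>

definition blocks :: "nat \<Rightarrow> nat \<Rightarrow> nat set \<Rightarrow> nat \<Rightarrow> nat set set" where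
  "blocks K X U k = {e. e \<subseteq> U \<and> card e = K \<and> card (e \<inter> {..<X}) = k}"

lemma finite_blocks: "finite U \<Longrightarrow> finite (blocks K X U k)"
  unfolding blocks_def by (rule finite_subset[of _ "Pow U"]) auto

lemma card_blocks:
  assumes "finite U" "k \<le> K"
  shows "card (blocks K X U k) = (card (U \<inter> {..<X}) choose k) * (card (U - {..<X}) choose (K - k))"
proof -
  have "bij_betw (\<lambda>e. (e \<inter> {..<X}, e - {..<X})) (blocks K X U k)
     ({B. B \<subseteq> U \<inter> {..<X} \<and> card B = k} \<times> {B. B \<subseteq> U - {..<X} \<and> card B = K - k})"
  proof (rule bij_betw_byWitness[where f' = "\<lambda>(a, b). a \<union> b"])
    show "(\<lambda>e. (e \<inter> {..<X}, e - {..<X})) ` blocks K X U k \<subseteq>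
        {B. B \<subseteq> U \<inter> {..<X} \<and> card B = k} \<times> {B. B \<subseteq> U - {..<X} \<and> card B = K - k}"
    proof (clarsimp simp: blocks_def, intro conjI)
      fix e assume e: "e \<subseteq> U" "K = card e" "k = card (e \<inter> {..<X})"
      then have "finite e" using assms(1) finite_subset by blast
      then show "card (e - {..<X}) = card e - card (e \<inter> {..<X})" by (simp add: card_Diff_subset_Int)
    qed auto
    show "(\<lambda>(a, b). a \<union> b) ` ({B. B \<subseteq> U \<inter> {..<X} \<and> card B = k} \<times> {B. B \<subseteq> U - {..<X} \<and> card B = K - k})
        \<subseteq> blocks K X U k"
    proof (clarsimp simp: blocks_def)
      fix a b assume ab: "a \<subseteq> U" "a \<subseteq> {..<X}" "k = card a" "b \<subseteq> U - {..<X}" "card b = K - card a"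
      have "finite a" "finite b" using ab assms(1) by (auto intro: finite_subset)
      moreover have "a \<inter> b = {}" using ab by auto
      ultimately have "card (a \<union> b) = K" using ab assms(2) by (simp add: card_Un_disjoint)
      moreover have "(a \<union> b) \<inter> {..<X} = a" using ab by auto
      ultimately show "b \<subseteq> U \<and> card (a \<union> b) = K \<and> card ((a \<union> b) \<inter> {..<X}) = card a" using ab by auto
    qed
  qed auto
  then have "card (blocks K X U k) = card ({B. B \<subseteq> U \<inter> {..<X} \<and> card B = k} \<times> {B. B \<subseteq> U - {..<X} \<and> card B = K - k})"
    by (rule bij_betw_same_card)
  then show ?thesis 
    using assms(1) n_subsets[of "U \<inter> {..<X}" k] n_subsets[of "U - {..<X}" "K - k"]
    by (simp add: card_cartesian_product)
qed

section \<open>Binomial ratios against powers, and weighted AM-GM\<close>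

lemma binomial_ratio_le_power:
  assumes "a \<le> x"
  shows "real (a choose k) / real (x choose k) \<le> (real a / real x) ^ k"
proof (cases "k \<le> a")
  case False
  then show ?thesis by (simp add: binomial_eq_0)
next
  case True
  have "real (a choose k) = (\<Prod>i = 0..<k. real (a - i) / real (k - i))"
    using True by (simp add: binomial_altdef_of_nat)
  also have "\<dots> \<le> (\<Prod>i = 0..<k. (real a / real x) * (real (x - i) / real (k - i)))"
  proof (intro prod_mono conjI)
    fix i assume i: "i \<in> {0..<k}"
    \<comment> \<open>Subtracting i from both parts of a ratio that is at most one lowers it: (a -
      i)/(x - i) <= a/x.\<close>
    have "real (a - i) * real x \<le> real a * real (x - i)"
      using True assms i mult_left_mono[of "real a" "real x" "real i"] by (simp add: of_nat_diff algebra_simps)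
    then have "real (a - i) \<le> real a * real (x - i) / real x" using True assms i by (simp add: field_simps)
    then have "real (a - i) / real (k - i) \<le> real a * real (x - i) / real x / real (k - i)"
      by (rule divide_right_mono) simp
    then show "real (a - i) / real (k - i) \<le> (real a / real x) * (real (x - i) / real (k - i))" by simp
  qed simp
  also have "\<dots> = (real a / real x) ^ k * (\<Prod>i = 0..<k. real (x - i) / real (k - i))"
    by (simp only: prod.distrib) simp
  also have "(\<Prod>i = 0..<k. real (x - i) / real (k - i)) = real (x choose k)"
    using True assms by (simp add: binomial_altdef_of_nat)
  finally show ?thesis using True assms by (simp add: divide_le_eq)
qed

text \<open>The shape of the error is what counts: its factor a/x lets the errors of arbitrarily
  many classes add up to at most K^2/x, because the class sizes sum to at most x. An error K^2/x for
  each class would be useless.\<close>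

lemma binomial_ratio_ge_power:
  assumes "a \<le> x" "2 \<le> K" "K \<le> x"
  shows "(real a / real x) ^ K - (real K)\<^sup>2 / real x * (real a / real x) \<le> real (a choose K) / real (x choose K)"
proof -
  have x0: "real x > 0" using assms by simp
  have K1: "K = Suc (K - 1)" using assms by simp
  \<comment> \<open>After multiplication by K! this bounds a falling factorial: each factor is at
    least a - K, and Bernoulli gives (1 - K/a)^K >= 1 - K^2/a. For a < K the left side is at most 0,
    since then a <= K^2.\<close>
  have l: "real a ^ K - (real K)\<^sup>2 * real a ^ (K - 1) \<le> real ((a choose K) * fact K)"
  proof (cases "K \<le> a")
    case False
    have "real a ^ K = real a ^ (K - 1) * real a" using K1 by (metis power_Suc2)
    then have "real a ^ K - (real K)\<^sup>2 * real a ^ (K - 1) = real a ^ (K - 1) * (real a - (real K)\<^sup>2)"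
      by (simp add: algebra_simps)
    also have "\<dots> \<le> 0"
    proof -
      have "a * 1 \<le> K * K" using False assms by (intro mult_le_mono) auto
      then have "real a \<le> real K * real K" by (metis mult.right_neutral of_nat_le_iff of_nat_mult)
      then show ?thesis by (intro mult_nonneg_nonpos) (auto simp: power2_eq_square)
    qed
    finally show ?thesis by (smt (verit) of_nat_0_le_iff)
  next
    case True
    have a0: "real a > 0" using True assms by simp
    have "1 + real K * (- (real K / real a)) \<le> (1 + (- (real K / real a))) ^ K"
      using True a0 by (intro Bernoulli_inequality) (simp add: field_simps)
    then have "real a ^ K * (1 + real K * (- (real K / real a))) \<le> real a ^ K * (1 + (- (real K / real a))) ^ K"
      by (intro mult_left_mono) auto
    also have "\<dots> = (real a - real K) ^ K" using a0 by (simp add: power_mult_distrib[symmetric] field_simps)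
    also have "\<dots> = (\<Prod>i = 0..<K. (real a - real K))" by simp
    also have "\<dots> \<le> (\<Prod>i = 0..<K. real (a - i))" using True by (intro prod_mono) auto
    also have "\<dots> = real ((a choose K) * fact K)"
    proof -
      have "(\<Prod>i = 0..<K. real (a - i)) = (\<Prod>i = 0..<K. real (a - i) / real (K - i)) * (\<Prod>i = 0..<K. real (K - i))"
        by (simp add: prod.distrib[symmetric])
      also have "(\<Prod>i = 0..<K. real (K - i)) = fact K" by (simp add: fact_prod_rev)
      finally show ?thesis using True by (simp add: binomial_altdef_of_nat)
    qed
    finally have "real a ^ K * (1 + real K * (- (real K / real a))) \<le> real ((a choose K) * fact K)" .
    moreover have "real a ^ K / real a = real a ^ (K - 1)" using a0 assms by (simp add: power_diff)
    then have "real a ^ K * (1 + real K * (- (real K / real a))) = real a ^ K - (real K)\<^sup>2 * real a ^ (K - 1)"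
      by (simp add: algebra_simps power2_eq_square) (metis mult.assoc mult.commute times_divide_eq_right)
    ultimately show ?thesis by simp
  qed
  have u: "real ((x choose K) * fact K) \<le> real x ^ K"
    using binomial_fact_pow[of x K] by (metis of_nat_le_iff of_nat_power)
  have xc: "real ((x choose K) * fact K) > 0" using assms by simp
  \<comment> \<open>Of the K - 1 factors a/x one is kept and the others are bounded by one, which
    needs K >= 2.\<close>
  have "real a ^ (K - 1) / real x ^ K \<le> 1 / real x * (real a / real x)"
  proof -
    have "real x ^ K = real x ^ (K - 1) * real x" using K1 by (metis power_Suc2)
    then have "real a ^ (K - 1) / real x ^ K = 1 / real x * (real a / real x) ^ (K - 1)"
      by (simp add: power_divide)
    also have "(real a / real x) ^ (K - 1) \<le> (real a / real x) ^ 1"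
      using assms x0 by (intro power_decreasing) auto
    finally show ?thesis using x0 by (simp add: divide_right_mono)
  qed
  then have "(real K)\<^sup>2 * (real a ^ (K - 1) / real x ^ K) \<le> (real K)\<^sup>2 * (1 / real x * (real a / real x))"
    by (intro mult_left_mono) auto
  then have "(real a / real x) ^ K - (real K)\<^sup>2 / real x * (real a / real x) \<le> (real a ^ K - (real K)\<^sup>2 * real a ^ (K - 1)) / real x ^ K"
    by (simp add: diff_divide_distrib power_divide)
  also have "\<dots> \<le> real ((a choose K) * fact K) / real x ^ K"
    using l by (intro divide_right_mono) auto
  also have "\<dots> \<le> real ((a choose K) * fact K) / real ((x choose K) * fact K)"
    using u xc x0 by (intro divide_left_mono mult_pos_pos) auto
  also have "\<dots> = real (a choose K) / real (x choose K)" by simp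
  finally show ?thesis .
qed

text \<open>Young's inequality for a^K and b^K with exponents k/K and 1 - k/K. Real powers call for
  positive bases, so zero bases and the two end values of k are treated apart.\<close>

lemma weighted_amgm_power:
  fixes a b :: real
  assumes "0 \<le> a" "0 \<le> b" "k \<le> K" "K > 0"
  shows "a ^ k * b ^ (K - k) \<le> real k / real K * a ^ K + (1 - real k / real K) * b ^ K"
proof -
  consider "k = 0" | "k = K" | "0 < k" "k < K" "a = 0 \<or> b = 0" | "0 < k" "k < K" "a > 0" "b > 0"
    using assms by force
  then show ?thesis
  proof cases
    case 3
    then have "a ^ k * b ^ (K - k) = 0" by (auto simp: power_0_left)
    moreover have "0 \<le> real k / real K * a ^ K + (1 - real k / real K) * b ^ K"
      using assms by (intro add_nonneg_nonneg mult_nonneg_nonneg) auto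
    ultimately show ?thesis by linarith
  next
    case 4
    have e: "(a ^ K) powr (real k / real K) = a ^ k" "(b ^ K) powr (1 - real k / real K) = b ^ (K - k)"
      using 4 assms by (auto simp: powr_realpow[symmetric] powr_powr of_nat_diff right_diff_distrib)
    have "(a ^ K) powr (real k / real K) * (b ^ K) powr (1 - real k / real K)
        \<le> real k / real K * a ^ K + (1 - real k / real K) * b ^ K"
      using 4 by (intro Youngs_inequality_0) auto
    then show ?thesis by (simp only: e)
  qed (use assms in auto)
qed

text \<open>Sampling without replacement is compared with sampling with replacement: the mixed term
  is bounded above by powers, AM-GM is applied class by class, and the two pure terms are bounded
  below by powers. Only the last exchange produces an error.\<close>

lemma sum_binomial_ratio_convex:
  fixes a b :: "'i \<Rightarrow> nat"
  assumes I: "finite I" and a: "sum a I \<le> x" and b: "sum b I \<le> y" and K: "2 \<le> K" "K \<le> x" "K \<le> y" "k \<le> K"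
  shows "(\<Sum>i\<in>I. real ((a i choose k) * (b i choose (K - k)))) / real ((x choose k) * (y choose (K - k)))
     \<le> real k / real K * ((\<Sum>i\<in>I. real (a i choose K)) / real (x choose K))
       + (1 - real k / real K) * ((\<Sum>i\<in>I. real (b i choose K)) / real (y choose K))
       + (real K)\<^sup>2 * (1 / real x + 1 / real y)"
proof -
  have ai: "a i \<le> x" "b i \<le> y" if "i \<in> I" for i
    using a b member_le_sum[of i I a] member_le_sum[of i I b] I that by auto
  define \<alpha> where "\<alpha> i = real (a i) / real x" for i
  define \<beta> where "\<beta> i = real (b i) / real y" for i
  define p where "p = real k / real K"
  have p: "0 \<le> p" "p \<le> 1" using K by (auto simp: p_def)
  \<comment> \<open>The hypothesis \<open>sum c I \<le> z\<close> makes the error independent of the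
    number of classes.\<close>
  have lower: "(\<Sum>i\<in>I. (real (c i) / real z) ^ K) - (real K)\<^sup>2 / real z \<le> (\<Sum>i\<in>I. real (c i choose K)) / real (z choose K)"
    if "sum c I \<le> z" "\<And>i. i \<in> I \<Longrightarrow> c i \<le> z" "K \<le> z" for c :: "'i \<Rightarrow> nat" and z
  proof -
    have z0: "real z > 0" using that K by simp
    have "(\<Sum>i\<in>I. real (c i) / real z) \<le> 1"
      using that z0 by (simp add: sum_divide_distrib[symmetric] flip: of_nat_sum)
    then have "(real K)\<^sup>2 / real z * (\<Sum>i\<in>I. real (c i) / real z) \<le> (real K)\<^sup>2 / real z * 1"
      by (intro mult_left_mono) auto
    then have "(\<Sum>i\<in>I. (real (c i) / real z) ^ K) - (real K)\<^sup>2 / real z \<le>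
        (\<Sum>i\<in>I. (real (c i) / real z) ^ K - (real K)\<^sup>2 / real z * (real (c i) / real z))"
      by (simp add: sum_subtractf sum_distrib_left)
    also have "\<dots> \<le> (\<Sum>i\<in>I. real (c i choose K) / real (z choose K))"
      using that K by (intro sum_mono binomial_ratio_ge_power) auto
    finally show ?thesis by (simp add: sum_divide_distrib)
  qed
  have "(\<Sum>i\<in>I. real ((a i choose k) * (b i choose (K - k)))) / real ((x choose k) * (y choose (K - k)))
     = (\<Sum>i\<in>I. (real (a i choose k) / real (x choose k)) * (real (b i choose (K - k)) / real (y choose (K - k))))"
    by (simp add: sum_divide_distrib)
  also have "\<dots> \<le> (\<Sum>i\<in>I. \<alpha> i ^ k * \<beta> i ^ (K - k))"
    unfolding \<alpha>_def \<beta>_def using ai by (intro sum_mono mult_mono binomial_ratio_le_power) auto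
  also have "\<dots> \<le> (\<Sum>i\<in>I. p * \<alpha> i ^ K + (1 - p) * \<beta> i ^ K)"
    unfolding p_def using K by (intro sum_mono weighted_amgm_power) (auto simp: \<alpha>_def \<beta>_def)
  also have "\<dots> = p * (\<Sum>i\<in>I. \<alpha> i ^ K) + (1 - p) * (\<Sum>i\<in>I. \<beta> i ^ K)"
    by (simp add: sum.distrib sum_distrib_left)
  also have "\<dots> \<le> p * ((\<Sum>i\<in>I. real (a i choose K)) / real (x choose K) + (real K)\<^sup>2 / real x)
       + (1 - p) * ((\<Sum>i\<in>I. real (b i choose K)) / real (y choose K) + (real K)\<^sup>2 / real y)"
    using lower[of a x] lower[of b y] a b ai K p unfolding \<alpha>_def \<beta>_def
    by (intro add_mono mult_left_mono) (auto simp: algebra_simps)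
  also have "\<dots> \<le> p * ((\<Sum>i\<in>I. real (a i choose K)) / real (x choose K))
       + (1 - p) * ((\<Sum>i\<in>I. real (b i choose K)) / real (y choose K)) + (real K)\<^sup>2 * (1 / real x + 1 / real y)"
  proof -
    have "p * ((real K)\<^sup>2 / real x) \<le> 1 * ((real K)\<^sup>2 / real x)" "(1 - p) * ((real K)\<^sup>2 / real y) \<le> 1 * ((real K)\<^sup>2 / real y)"
      using p by (intro mult_right_mono; simp)+
    then show ?thesis by (simp add: algebra_simps)
  qed
  finally show ?thesis unfolding p_def .
qed

text \<open>\<open>R\<close> need not be reflexive. As p = q is allowed in \<open>mc\<close>, a
  block counts only if its points are related to themselves, and then it lies inside exactly one
  class; counting such blocks is therefore counting subsets of disjoint classes.\<close>

lemma avg_monochromatic_blocks: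
  fixes R :: "nat \<Rightarrow> nat \<Rightarrow> bool"
  assumes R: "symp R" "transp R" and U: "finite U" and K: "2 \<le> K" "k \<le> K"
    and x: "K \<le> card (U \<inter> {..<X})" and y: "K \<le> card (U - {..<X})"
  defines "mc \<equiv> \<lambda>e. of_bool (\<forall>p\<in>e. \<forall>q\<in>e. R p q) :: real"
  shows "avg (blocks K X U k) mc \<le> real k / real K * avg (blocks K X U K) mc
      + (1 - real k / real K) * avg (blocks K X U 0) mc
      + (real K)\<^sup>2 * (1 / real (card (U \<inter> {..<X})) + 1 / real (card (U - {..<X})))"
proof -
  define \<C> where "\<C> = (\<lambda>p. {q\<in>U. R p q}) ` {p\<in>U. R p p}"
  have fC: "finite \<C>" using U by (simp add: \<C>_def)
  have CU: "C \<subseteq> U" if "C \<in> \<C>" for C using that by (auto simp: \<C>_def)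
  have R': "R p q \<Longrightarrow> R q p" "R p q \<Longrightarrow> R q s \<Longrightarrow> R p s" for p q s
    using R by (auto dest: sympD transpD)
  have disj: "C = D" if CD: "C \<in> \<C>" "D \<in> \<C>" and z: "z \<in> C" "z \<in> D" for C D z
  proof -
    obtain p p' where "C = {q\<in>U. R p q}" "D = {q\<in>U. R p' q}" using CD unfolding \<C>_def by blast
    moreover from this have "R p q \<longleftrightarrow> R p' q" for q using z R' by blast
    ultimately show ?thesis by simp
  qed
  have count: "(\<Sum>e\<in>blocks K X U j. mc e) = (\<Sum>C\<in>\<C>. real ((card (C \<inter> {..<X}) choose j) * (card (C - {..<X}) choose (K - j))))"
    if j: "j \<le> K" for j
  proof -
    have eq: "{e \<in> blocks K X U j. \<forall>p\<in>e. \<forall>q\<in>e. R p q} = (\<Union>C\<in>\<C>. blocks K X C j)"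
    proof (intro equalityI subsetI)
      fix e assume e: "e \<in> {e \<in> blocks K X U j. \<forall>p\<in>e. \<forall>q\<in>e. R p q}"
      then have "e \<noteq> {}" using K by (auto simp: blocks_def)
      then obtain p where p: "p \<in> e" by blast
      then have "{q\<in>U. R p q} \<in> \<C>" "e \<subseteq> {q\<in>U. R p q}" using e by (auto simp: \<C>_def blocks_def)
      then show "e \<in> (\<Union>C\<in>\<C>. blocks K X C j)" using e by (auto simp: blocks_def)
    next
      fix e assume "e \<in> (\<Union>C\<in>\<C>. blocks K X C j)"
      then obtain p where p: "e \<in> blocks K X {q\<in>U. R p q} j" by (auto simp: \<C>_def)
      then have "R q q'" if "q \<in> e" "q' \<in> e" for q q' using that R' unfolding blocks_def by blast
      then show "e \<in> {e \<in> blocks K X U j. \<forall>p\<in>e. \<forall>q\<in>e. R p q}" using p unfolding blocks_def by blast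
    qed
    have "(\<Sum>e\<in>blocks K X U j. mc e) = real (card {e \<in> blocks K X U j. \<forall>p\<in>e. \<forall>q\<in>e. R p q})"
      unfolding mc_def using finite_blocks[OF U] by (simp add: of_bool_def sum.If_cases Int_def)
    also have "\<dots> = real (\<Sum>C\<in>\<C>. card (blocks K X C j))"
      unfolding eq
    proof (subst card_UN_disjoint[OF fC])
      show "\<forall>i\<in>\<C>. finite (blocks K X i j)" using CU U finite_subset by (blast intro: finite_blocks)
      show "\<forall>C\<in>\<C>. \<forall>D\<in>\<C>. C \<noteq> D \<longrightarrow> blocks K X C j \<inter> blocks K X D j = {}"
      proof (intro ballI impI equals0I)
        fix C D e assume CD: "C \<in> \<C>" "D \<in> \<C>" "C \<noteq> D" "e \<in> blocks K X C j \<inter> blocks K X D j"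
        then have "e \<noteq> {}" using K by (auto simp: blocks_def)
        then obtain z where "z \<in> e" by blast
        then show False using CD disj[of C D z] by (auto simp: blocks_def)
      qed
    qed simp
    also have "\<dots> = (\<Sum>C\<in>\<C>. real ((card (C \<inter> {..<X}) choose j) * (card (C - {..<X}) choose (K - j))))"
      unfolding of_nat_sum using CU U j by (intro sum.cong refl arg_cong[where f=real] card_blocks) (auto intro: finite_subset)
    finally show ?thesis .
  qed
  have sumcard: "(\<Sum>C\<in>\<C>. card (C \<inter> Z)) \<le> card (U \<inter> Z)" for Z
  proof -
    have "(\<Sum>C\<in>\<C>. card (C \<inter> Z)) = card (\<Union>C\<in>\<C>. C \<inter> Z)"
    proof (rule card_UN_disjoint[OF fC, symmetric])
      show "\<forall>C\<in>\<C>. finite (C \<inter> Z)" using CU U by (blast intro: finite_subset)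
      show "\<forall>C\<in>\<C>. \<forall>D\<in>\<C>. C \<noteq> D \<longrightarrow> C \<inter> Z \<inter> (D \<inter> Z) = {}" using disj by blast
    qed
    also have "\<dots> \<le> card (U \<inter> Z)" using CU U by (intro card_mono) auto
    finally show ?thesis .
  qed
  have "(\<Sum>C\<in>\<C>. card (C - {..<X})) \<le> card (U - {..<X})" using sumcard[of "-{..<X}"] by (simp add: Diff_eq)
  from sum_binomial_ratio_convex[OF fC sumcard this K(1) x y K(2)]
  show ?thesis using K U unfolding avg_def by (simp add: count card_blocks)
qed

section \<open>Partial configurations and adding one uniform block\<close>

definition confs :: "nat \<Rightarrow> nat \<Rightarrow> nat set \<Rightarrow> nat multiset \<Rightarrow> nat set set set" where
  "confs K X V Mu = {P. P \<subseteq> Pow V \<and> disjoint P \<and> (\<forall>e\<in>P. card e = K) \<and>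
      image_mset (\<lambda>e. card (e \<inter> {..<X})) (mset_set P) = Mu}"

lemma finite_confs: "finite V \<Longrightarrow> finite (confs K X V Mu)"
  unfolding confs_def by (rule finite_subset[of _ "Pow (Pow V)"]) auto

lemma confs_finite: "finite V \<Longrightarrow> P \<in> confs K X V Mu \<Longrightarrow> finite P"
  unfolding confs_def by (auto intro: finite_subset[of _ "Pow V"])

lemma confs_cards:
  assumes "finite V" "P \<in> confs K X V Mu"
  shows "card (\<Union>P) = K * size Mu" "card (\<Union>P \<inter> {..<X}) = sum_mset Mu" "\<Union>P \<subseteq> V"
proof -
  have P: "finite P" "P \<subseteq> Pow V" "disjoint P" "\<forall>e\<in>P. card e = K"
    and Mu: "Mu = image_mset (\<lambda>e. card (e \<inter> {..<X})) (mset_set P)"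
    using assms(2) confs_finite[OF assms] unfolding confs_def mem_Collect_eq by (blast, blast, blast, blast, metis)
  show sub: "\<Union>P \<subseteq> V" using P by auto
  have fe: "finite e" if "e \<in> P" for e using that P assms(1) finite_subset by blast
  have dj: "e \<inter> e' = {}" if "e \<in> P" "e' \<in> P" "e \<noteq> e'" for e e'
    using that P(3) by (simp add: disjointD)
  have "card (\<Union>P) = (\<Sum>e\<in>P. card e)" using fe dj by (intro card_Union_disjoint) (auto simp: pairwise_def disjnt_def)
  also have "\<dots> = K * card P" using P by simp
  finally show "card (\<Union>P) = K * size Mu" using P(1) by (simp add: Mu)
  have "card (\<Union>P \<inter> {..<X}) = card (\<Union>e\<in>P. e \<inter> {..<X})" by (rule arg_cong[where f=card]) auto
  also have "\<dots> = (\<Sum>e\<in>P. card (e \<inter> {..<X}))"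
    using P(1) fe dj by (intro card_UN_disjoint) auto
  finally show "card (\<Union>P \<inter> {..<X}) = sum_mset Mu" by (simp add: Mu sum_unfold_sum_mset)
qed

lemma insert_block_confs:
  assumes "finite V" "K > 0" "P \<in> confs K X V Mu" "e \<in> blocks K X (V - \<Union>P) k"
  shows "insert e P \<in> confs K X V (add_mset k Mu)" "e \<notin> P"
proof -
  have e: "e \<subseteq> V" "e \<inter> \<Union>P = {}" "card e = K" "card (e \<inter> {..<X}) = k" using assms(4) by (auto simp: blocks_def)
  have "e \<noteq> {}" using e assms(2) by auto
  then show "e \<notin> P" using e by blast
  then show "insert e P \<in> confs K X V (add_mset k Mu)"
  proof -
    have P: "finite P" "P \<subseteq> Pow V" "disjoint P" "\<forall>e\<in>P. card e = K"
        "image_mset (\<lambda>e. card (e \<inter> {..<X})) (mset_set P) = Mu"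
      using assms(3) confs_finite[OF assms(1,3)] unfolding confs_def mem_Collect_eq by blast+
    have "e \<inter> e' = {}" if "e' \<in> P" for e' using that e(2) by auto
    then have "disjoint (insert e P)" using P(3) by (simp add: disjoint_def Int_commute)
    then show ?thesis using P e \<open>e \<notin> P\<close> by (simp add: confs_def)
  qed
qed

lemma remove_block_confs:
  assumes "finite V" "K > 0" "P \<in> confs K X V (add_mset k Mu)" "e \<in> P" "card (e \<inter> {..<X}) = k"
  shows "P - {e} \<in> confs K X V Mu" "e \<in> blocks K X (V - \<Union>(P - {e})) k"
proof -
  have P: "finite P" "P \<subseteq> Pow V" "disjoint P" "\<forall>e\<in>P. card e = K"
    and Mu: "add_mset k Mu = image_mset (\<lambda>e. card (e \<inter> {..<X})) (mset_set P)"
    using assms(3) confs_finite[OF assms(1,3)] unfolding confs_def mem_Collect_eq by (blast, blast, blast, blast, metis)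
  have "mset_set P = add_mset e (mset_set (P - {e}))" using assms(4) P(1)
    by (metis finite_Diff insert_Diff mset_set.insert Diff_iff insertI1)
  then have "image_mset (\<lambda>e. card (e \<inter> {..<X})) (mset_set (P - {e})) = Mu" using Mu assms(5) by simp
  moreover have "disjoint (P - {e})" using P(3) by (simp add: disjoint_def)
  ultimately show "P - {e} \<in> confs K X V Mu" using P by (auto simp: confs_def)
  show "e \<in> blocks K X (V - \<Union>(P - {e})) k"
  proof -
    have "e \<inter> e' = {}" if "e' \<in> P - {e}" for e' using that assms(4) P(3) by (auto simp: disjoint_def)
    then have "e \<inter> \<Union>(P - {e}) = {}" by auto
    moreover have "e \<subseteq> V" "card e = K" using P(2,4) assms(4) by auto
    ultimately show ?thesis using assms(5) unfolding blocks_def by auto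
  qed
qed

text \<open>Double counting of pairs of a configuration and a distinguished block of type
  \<open>k\<close>: a configuration with types \<open>add_mset k Mu\<close> has
  \<open>Suc (count Mu k)\<close> such blocks, and deleting the distinguished one is inverse to
  inserting a free block.\<close>

lemma sum_confs_add_mset:
  fixes g :: "nat set set \<Rightarrow> real"
  assumes V: "finite V" and K: "K > 0"
  shows "real (Suc (count Mu k)) * (\<Sum>P\<in>confs K X V (add_mset k Mu). g P)
       = (\<Sum>P\<in>confs K X V Mu. \<Sum>e\<in>blocks K X (V - \<Union>P) k. g (insert e P))"
proof -
  have cnt: "card {e\<in>P. card (e \<inter> {..<X}) = k} = Suc (count Mu k)" if "P \<in> confs K X V (add_mset k Mu)" for P
  proof -
    have P: "finite P" "image_mset (\<lambda>e. card (e \<inter> {..<X})) (mset_set P) = add_mset k Mu"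
      using that confs_finite[OF V] unfolding confs_def mem_Collect_eq by blast+
    have "Suc (count Mu k) = count (image_mset (\<lambda>e. card (e \<inter> {..<X})) (mset_set P)) k" using P by simp
    also have "\<dots> = card {e\<in>P. card (e \<inter> {..<X}) = k}"
      using P(1) by (simp add: count_image_mset sum.If_cases vimage_def Int_def conj_commute)
    finally show ?thesis by simp
  qed
  have "real (Suc (count Mu k)) * (\<Sum>P\<in>confs K X V (add_mset k Mu). g P)
     = (\<Sum>P\<in>confs K X V (add_mset k Mu). \<Sum>e\<in>{e\<in>P. card (e \<inter> {..<X}) = k}. g P)"
    by (simp add: sum_distrib_left cnt del: of_nat_Suc)
  also have "\<dots> = (\<Sum>(P, e)\<in>(SIGMA P:confs K X V (add_mset k Mu). {e\<in>P. card (e \<inter> {..<X}) = k}). g P)"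
    using finite_confs[OF V] confs_finite[OF V] by (intro sum.Sigma) auto
  also have "\<dots> = (\<Sum>(P, e)\<in>(SIGMA P:confs K X V Mu. blocks K X (V - \<Union>P) k). g (insert e P))"
  proof (rule sum.reindex_bij_witness[where i = "\<lambda>(P, e). (insert e P, e)" and j = "\<lambda>(P, e). (P - {e}, e)"], goal_cases)
    case (1 a)
    then show ?case by auto
  next
    case (2 a)
    then show ?case using remove_block_confs[OF V K] by auto
  next
    case (3 a)
    then show ?case using insert_block_confs[OF V K] by auto
  next
    case (4 a)
    then show ?case using insert_block_confs[OF V K] by (auto simp: blocks_def)
  next
    case (5 a)
    then show ?case by (auto simp: insert_absorb)
  qed
  also have "\<dots> = (\<Sum>P\<in>confs K X V Mu. \<Sum>e\<in>blocks K X (V - \<Union>P) k. g (insert e P))"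
    using finite_confs[OF V] finite_blocks V by (intro sum.Sigma[symmetric]) auto
  finally show ?thesis .
qed

text \<open>The counts depend on \<open>P\<close> only through \<open>Mu\<close>. This is why
  extending a uniform configuration by a uniform free block gives a uniform configuration again. The
  last two claims show that the natural subtractions do not truncate.\<close>

lemma card_free_blocks:
  assumes "P \<in> confs K X {..<X + Y} Mu" "k \<le> K"
  defines "U \<equiv> {..<X + Y} - \<Union>P"
  shows "card (U \<inter> {..<X}) = X - sum_mset Mu" "card (U - {..<X}) = Y + sum_mset Mu - K * size Mu"
    and "card (blocks K X U k) = ((X - sum_mset Mu) choose k) * ((Y + sum_mset Mu - K * size Mu) choose (K - k))"
    and "sum_mset Mu \<le> X" "K * size Mu \<le> Y + sum_mset Mu"
proof -
  note c = confs_cards[OF finite_lessThan assms(1)]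
  have fin: "finite (\<Union>P)" using c(3) finite_subset by blast
  have "card (\<Union>P \<inter> {..<X}) \<le> card {..<X}" by (intro card_mono) auto
  then show s: "sum_mset Mu \<le> X" using c(2) by simp
  have "U \<inter> {..<X} = {..<X} - (\<Union>P \<inter> {..<X})" by (auto simp: U_def)
  then show 1: "card (U \<inter> {..<X}) = X - sum_mset Mu"
    using c(2) fin by (simp add: card_Diff_subset)
  have cd: "card (\<Union>P - {..<X}) = K * size Mu - sum_mset Mu" using c fin by (simp add: card_Diff_subset_Int)
  have "card (\<Union>P \<inter> {..<X}) \<le> card (\<Union>P)" using fin by (intro card_mono) auto
  then have le: "sum_mset Mu \<le> K * size Mu" using c by simp
  have "card (\<Union>P - {..<X}) \<le> card ({..<X + Y} - {..<X})" using c(3) by (intro card_mono) auto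
  then have "K * size Mu - sum_mset Mu \<le> Y" using cd by (simp add: card_Diff_subset)
  then show 2: "K * size Mu \<le> Y + sum_mset Mu" by simp
  have "U - {..<X} = ({..<X + Y} - {..<X}) - (\<Union>P - {..<X})" by (auto simp: U_def)
  then have "card (U - {..<X}) = card ({..<X + Y} - {..<X}) - card (\<Union>P - {..<X})"
    using c(3) fin by (simp only:) (intro card_Diff_subset, auto)
  then show 3: "card (U - {..<X}) = Y + sum_mset Mu - K * size Mu"
    using cd 2 le by (simp add: card_Diff_subset)
  show "card (blocks K X U k) = ((X - sum_mset Mu) choose k) * ((Y + sum_mset Mu - K * size Mu) choose (K - k))"
    using 1 3 card_blocks[of U k K X] assms(2) by (simp add: U_def)
qed

text \<open>In the double count both multiplicities are constant, \<open>Suc (count Mu k)\<close> on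
  one side and \<open>m\<close> on the other. They cancel once the same identity is applied to the
  constant 1, which gives the ratio of the numbers of configurations. The hypotheses say that a
  block of type \<open>k\<close> still fits, so \<open>m\<close> is positive.\<close>

lemma avg_confs_add_mset:
  fixes g :: "nat set set \<Rightarrow> real"
  assumes K: "K > 0" and k: "k \<le> K"
    and x: "sum_mset Mu + k \<le> X" and y: "K * size Mu + K \<le> Y + sum_mset Mu + k"
  defines "V \<equiv> {..<X + Y}"
  shows "avg (confs K X V (add_mset k Mu)) g = avg (confs K X V Mu) (\<lambda>P. avg (blocks K X (V - \<Union>P) k) (\<lambda>e. g (insert e P)))"
proof -
  define m where "m = ((X - sum_mset Mu) choose k) * ((Y + sum_mset Mu - K * size Mu) choose (K - k))"
  have m: "m > 0" using x y k by (auto simp: m_def)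
  have mP: "card (blocks K X (V - \<Union>P) k) = m" if "P \<in> confs K X V Mu" for P
    using card_free_blocks(3)[of P K X Y Mu k] that k unfolding V_def m_def by simp
  have V: "finite V" by (simp add: V_def)
  have S: "real (Suc (count Mu k)) * (\<Sum>P\<in>confs K X V (add_mset k Mu). h P)
       = (\<Sum>P\<in>confs K X V Mu. \<Sum>e\<in>blocks K X (V - \<Union>P) k. h (insert e P))" for h
    by (rule sum_confs_add_mset[OF V K])
  have C: "real (Suc (count Mu k)) * real (card (confs K X V (add_mset k Mu))) = real (card (confs K X V Mu)) * real m"
    using S[of "\<lambda>_. 1"] mP by simp
  have "avg (confs K X V (add_mset k Mu)) g
     = (real (Suc (count Mu k)) * (\<Sum>P\<in>confs K X V (add_mset k Mu). g P)) / (real (Suc (count Mu k)) * real (card (confs K X V (add_mset k Mu))))"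
    unfolding avg_def by (subst mult_divide_mult_cancel_left) auto
  also have "\<dots> = (\<Sum>P\<in>confs K X V Mu. \<Sum>e\<in>blocks K X (V - \<Union>P) k. g (insert e P)) / (real (card (confs K X V Mu)) * real m)"
    by (simp only: S C)
  also have "\<dots> = avg (confs K X V Mu) (\<lambda>P. avg (blocks K X (V - \<Union>P) k) (\<lambda>e. g (insert e P)))"
    unfolding avg_def using mP by (simp add: sum_divide_distrib mult.commute cong: sum.cong)
  finally show ?thesis .
qed

text \<open>Greedy: the bounds for the whole multiset leave room for the next block at every stage.
  Nonemptiness is what lets \<open>avg\<close> reproduce constants.\<close>

lemma confs_nonempty:
  assumes "K > 0" "\<forall>k\<in>#Mu. k \<le> K" "sum_mset Mu \<le> X" "K * size Mu \<le> Y + sum_mset Mu"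
  shows "confs K X {..<X + Y} Mu \<noteq> {}"
  using assms(2-)
proof (induction Mu)
  case empty
  have "{} \<in> confs K X {..<X + Y} {#}" by (simp add: confs_def)
  then show ?case by blast
next
  case (add k Mu)
  then have "confs K X {..<X + Y} Mu \<noteq> {}" by auto
  then obtain P where P: "P \<in> confs K X {..<X + Y} Mu" by blast
  have "card (blocks K X ({..<X + Y} - \<Union>P) k) > 0"
    using card_free_blocks(3)[OF P, of k] add.prems by auto
  then obtain e where "e \<in> blocks K X ({..<X + Y} - \<Union>P) k" by (metis all_not_in_conv card.empty less_irrefl)
  then show ?case using insert_block_confs(1)[OF _ assms(1) P] by blast
qed

section \<open>Interpolation between multisets of types\<close>

text \<open>
  \<open>feas\<close> says that disjoint blocks with these types fit into \<open>X + Y\<close> points. A state deviating by more than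
  \<open>s\<close> may have no free points left, but there the quadratic term already exceeds the crude bound.
\<close>

lemma quadratic_potential_interpolation:
  fixes f :: "nat multiset \<Rightarrow> real" and K X Y X0 sz :: nat and L c s R F B :: real
  defines "feas \<equiv> \<lambda>Mu. (\<forall>k\<in>#Mu. k \<le> K) \<and> sum_mset Mu \<le> X \<and> K * size Mu \<le> Y + sum_mset Mu"
  defines "dev \<equiv> \<lambda>Mu. real (sum_mset Mu) - real X0"
  assumes K: "K \<ge> 2" and s: "s \<ge> real K" and R: "R > 0" and L: "L \<ge> 0" and c: "c \<ge> 0" and B: "B \<ge> 0"
    and step: "\<And>Mu k. feas Mu \<Longrightarrow> k \<le> K \<Longrightarrow> sum_mset Mu + K \<le> X \<Longrightarrow> K * size Mu + K \<le> Y + sum_mset Mu \<Longrightarrow>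
        f (add_mset k Mu) \<ge> real k / real K * f (add_mset K Mu) + (1 - real k / real K) * f (add_mset 0 Mu)
          - c * (1 / (real X - real (sum_mset Mu)) + 1 / (real Y + real (sum_mset Mu) - real K * real (size Mu)))"
    and slackA: "real X - real X0 \<ge> 2 * s" and slackB: "real Y + real X0 - real K * real sz \<ge> 2 * s"
    and pure: "\<And>Mu. feas Mu \<Longrightarrow> size Mu = sz \<Longrightarrow> (\<forall>k\<in>#Mu. k = 0 \<or> k = K) \<Longrightarrow> f Mu \<ge> F - B - 2 * L * \<bar>dev Mu\<bar>"
    and crude: "\<And>Mu. feas Mu \<Longrightarrow> size Mu = sz \<Longrightarrow> f Mu \<ge> F - 2 * L * s\<^sup>2 / R"
    and M: "feas Mu" "size Mu = sz"
  shows "f Mu \<ge> F - B - 2 * L * (((dev Mu)\<^sup>2 + (real K)\<^sup>2 * real (size {#k \<in># Mu. 0 < k \<and> k < K#})) / R + R)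
                - real (size {#k \<in># Mu. 0 < k \<and> k < K#}) * (2 * c / s)"
  using M
\<comment> \<open>A replacement removes one mixed type in either branch, so the number of mixed
  types drops by one; \<open>Mu\<close> is arbitrary because the branches have different
  deviations.\<close>
proof (induction "size {#k \<in># Mu. 0 < k \<and> k < K#}" arbitrary: Mu)
  case 0
  then have "set_mset {#k \<in># Mu. 0 < k \<and> k < K#} = {}" by simp
  then have "\<forall>k\<in>#Mu. k = 0 \<or> k = K" using 0 unfolding feas_def set_mset_filter by force
  then have "f Mu \<ge> F - B - 2 * L * \<bar>dev Mu\<bar>" using pure 0 by blast
  moreover have "\<bar>dev Mu\<bar> \<le> (dev Mu)\<^sup>2 / R + R"
  proof -
    have "0 \<le> (\<bar>dev Mu\<bar> - R)\<^sup>2" by simp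
    then have "\<bar>dev Mu\<bar> * R + \<bar>dev Mu\<bar> * R \<le> (dev Mu)\<^sup>2 + R * R" by (simp add: power2_eq_square algebra_simps)
    moreover have "0 \<le> \<bar>dev Mu\<bar> * R" using R by simp
    ultimately have "\<bar>dev Mu\<bar> * R \<le> (dev Mu)\<^sup>2 + R * R" by linarith
    then show ?thesis using R by (simp add: field_simps)
  qed
  then have "2 * L * \<bar>dev Mu\<bar> \<le> 2 * L * ((dev Mu)\<^sup>2 / R + R)"
    using L by (intro mult_left_mono) auto
  moreover have "size {#k \<in># Mu. 0 < k \<and> k < K#} = 0" using 0(1) by (rule sym)
  ultimately show ?case by (simp only:) simp
next
  case (Suc m)
  have sK: "s > 0" using s K by linarith
  show ?case
  proof (cases "\<bar>dev Mu\<bar> \<le> s")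
    case False
    have "s\<^sup>2 \<le> (dev Mu)\<^sup>2" using False sK by (intro abs_le_square_iff[THEN iffD1]) auto
    then have "s\<^sup>2 \<le> (dev Mu)\<^sup>2 + (real K)\<^sup>2 * real (Suc m)" by (simp add: add_increasing2)
    then have "s\<^sup>2 / R \<le> ((dev Mu)\<^sup>2 + (real K)\<^sup>2 * real (Suc m)) / R + R"
      using R divide_right_mono[of "s\<^sup>2" "(dev Mu)\<^sup>2 + (real K)\<^sup>2 * real (Suc m)" R] by linarith
    then have "2 * L * (s\<^sup>2 / R) \<le> 2 * L * (((dev Mu)\<^sup>2 + (real K)\<^sup>2 * real (Suc m)) / R + R)"
      using L by (intro mult_left_mono) auto
    moreover have "0 \<le> real (Suc m) * (2 * c / s)" using c sK by simp
    moreover have "f Mu \<ge> F - 2 * L * (s\<^sup>2 / R)" using crude[OF Suc.prems] by simp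
    ultimately have "f Mu \<ge> F - B - 2 * L * (((dev Mu)\<^sup>2 + (real K)\<^sup>2 * real (Suc m)) / R + R) - real (Suc m) * (2 * c / s)"
      using B by linarith
    then show ?thesis unfolding Suc.hyps(2)[symmetric] .
  next
    case True
    have "{#k \<in># Mu. 0 < k \<and> k < K#} \<noteq> {#}"
    proof
      assume "{#k \<in># Mu. 0 < k \<and> k < K#} = {#}"
      then have "Suc m = size ({#} :: nat multiset)" using Suc.hyps(2) by (simp only:)
      then show False by simp
    qed
    then obtain k where "k \<in># {#k \<in># Mu. 0 < k \<and> k < K#}" by (metis multiset_nonemptyE)
    then have k: "k \<in># Mu" "0 < k" "k < K" by auto
    then obtain M1 where M1: "Mu = add_mset k M1" by (metis multi_member_split)
    \<comment> \<open>With this weight the mean of \<open>dev A\<close> and \<open>dev Bt\<close> is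
      \<open>dev Mu\<close>, since p(K - k) - (1 - p)k = 0.\<close>
    define p where "p = real k / real K"
    have p: "0 \<le> p" "p \<le> 1" using k K by (auto simp: p_def)
    define A where "A = add_mset K M1"
    define Bt where "Bt = add_mset 0 M1"
    have f1: "feas M1" using Suc.prems k unfolding M1 feas_def by auto
    have sz1: "Suc (size M1) = sz" using Suc.prems M1 by simp
    \<comment> \<open>The slack 2s at the reference value \<open>X0\<close>, less a deviation of at
      most s, leaves at least s free points on either side.\<close>
    have "real (sum_mset M1) \<le> real X0 + s" using True unfolding dev_def M1 by simp
    then have xA: "real X - real (sum_mset M1) \<ge> s" using slackA by linarith
    have "real (sum_mset M1) + real k \<ge> real X0 - s" using True unfolding dev_def M1 by simp
    moreover have "real K * real sz = real K * real (size M1) + real K" by (simp add: sz1[symmetric] algebra_simps)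
    ultimately have yB: "real Y + real (sum_mset M1) - real K * real (size M1) \<ge> s"
      using slackB k by linarith
    have i1: "sum_mset M1 + K \<le> X" using xA s by linarith
    have i2: "K * size M1 + K \<le> Y + sum_mset M1"
    proof -
      have "real K * real (size M1) + real K \<le> real Y + real (sum_mset M1)" using yB s by linarith
      then have "real (K * size M1 + K) \<le> real (Y + sum_mset M1)" by simp
      then show ?thesis by linarith
    qed
    have fA: "feas A" and fB: "feas Bt" using f1 i1 i2 unfolding A_def Bt_def feas_def by auto
    have mix: "m = size {#k \<in># A. 0 < k \<and> k < K#}" "m = size {#k \<in># Bt. 0 < k \<and> k < K#}"
      using Suc.hyps(2) k unfolding M1 A_def Bt_def by auto
    have szs: "size A = sz" "size Bt = sz" using sz1 by (auto simp: A_def Bt_def)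
    \<comment> \<open>\<open>W\<close> is affine and nonincreasing in the squared deviation. So
      averaging the two induction bounds only needs the average of the squares, which is the square
      of \<open>dev Mu\<close> plus the variance k(K - k) <= K^2.\<close>
    define W where "W = (\<lambda>D. F - B - 2 * L * ((D + (real K)\<^sup>2 * real m) / R + R) - real m * (2 * c / s))"
    have IA: "f A \<ge> W ((dev A)\<^sup>2)" using Suc.hyps(1)[OF mix(1) fA szs(1)] mix(1) by (simp add: W_def)
    have IB: "f Bt \<ge> W ((dev Bt)\<^sup>2)" using Suc.hyps(1)[OF mix(2) fB szs(2)] mix(2) by (simp add: W_def)
    have dA: "dev A = dev Mu + (real K - real k)" and dB: "dev Bt = dev Mu - real k"
      by (auto simp: dev_def A_def Bt_def M1)
    have "p * (dev A)\<^sup>2 + (1 - p) * (dev Bt)\<^sup>2 = (dev Mu)\<^sup>2 + real k * (real K - real k)"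
    proof -
      have "p * real K = real k" using K by (simp add: p_def)
      moreover have "p * (dev A)\<^sup>2 + (1 - p) * (dev Bt)\<^sup>2 = (dev Mu - real k)\<^sup>2 + (p * real K) * (2 * (dev Mu - real k) + real K)"
        unfolding dA dB by (simp add: power2_eq_square algebra_simps)
      ultimately show ?thesis by (simp add: power2_eq_square algebra_simps)
    qed
    also have "real k * (real K - real k) \<le> real K * real K" using k by (intro mult_mono) auto
    finally have var: "p * (dev A)\<^sup>2 + (1 - p) * (dev Bt)\<^sup>2 \<le> (dev Mu)\<^sup>2 + (real K)\<^sup>2" by (simp add: power2_eq_square)
    have W: "W D = W 0 - 2 * L / R * D" for D by (simp add: W_def add_divide_distrib algebra_simps)
    have affine_comb: "p * (u - v * a) + (1 - p) * (u - v * b) = u - v * (p * a + (1 - p) * b)" for u v a b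
      by (simp add: algebra_simps)
    have "p * f A + (1 - p) * f Bt \<ge> p * W ((dev A)\<^sup>2) + (1 - p) * W ((dev Bt)\<^sup>2)"
      using IA IB p by (intro add_mono mult_left_mono) auto
    moreover have "p * W ((dev A)\<^sup>2) + (1 - p) * W ((dev Bt)\<^sup>2) = W (p * (dev A)\<^sup>2 + (1 - p) * (dev Bt)\<^sup>2)"
      by (subst (1 2 3) W) (rule affine_comb)
    moreover have "W (p * (dev A)\<^sup>2 + (1 - p) * (dev Bt)\<^sup>2) \<ge> W ((dev Mu)\<^sup>2 + (real K)\<^sup>2)"
    proof -
      have "2 * L / R * (p * (dev A)\<^sup>2 + (1 - p) * (dev Bt)\<^sup>2) \<le> 2 * L / R * ((dev Mu)\<^sup>2 + (real K)\<^sup>2)"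
        using var L R by (intro mult_left_mono) auto
      then show ?thesis by (subst (1 2) W) linarith
    qed
    moreover have "c * (1 / (real X - real (sum_mset M1)) + 1 / (real Y + real (sum_mset M1) - real K * real (size M1))) \<le> c * (1/s + 1/s)"
      using xA yB sK c by (intro mult_left_mono add_mono divide_left_mono mult_pos_pos) auto
    moreover have "f Mu \<ge> p * f A + (1 - p) * f Bt
          - c * (1 / (real X - real (sum_mset M1)) + 1 / (real Y + real (sum_mset M1) - real K * real (size M1)))"
      using step[OF f1 _ i1 i2, of k] k unfolding M1 A_def Bt_def p_def by simp
    ultimately have "f Mu \<ge> W ((dev Mu)\<^sup>2 + (real K)\<^sup>2) - c * (1/s + 1/s)" by linarith
    also have "W ((dev Mu)\<^sup>2 + (real K)\<^sup>2) - c * (1/s + 1/s) =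
       F - B - 2 * L * (((dev Mu)\<^sup>2 + (real K)\<^sup>2 * real (Suc m)) / R + R) - real (Suc m) * (2 * c / s)"
      unfolding W_def by (simp add: algebra_simps add_divide_distrib)
    finally show ?thesis using Suc.hyps(2) by simp
  qed
qed

text \<open>Elements of positive weight are moved into \<open>D\<close> greedily; each contributes
  at least one, so s of them suffice unless only weight zero remains. Weight k will measure freed
  A-points, weight K - k freed B-points.\<close>

lemma exists_slack_submultiset:
  fixes w :: "'a \<Rightarrow> nat"
  shows "\<exists>D. D \<subseteq># M \<and> size D \<le> s \<and> (s \<le> (\<Sum>k\<in>#D. w k) \<or> (\<forall>k\<in>#M - D. w k = 0))"
proof (induction s)
  case 0
  show ?case by (intro exI[of _ "{#}"]) auto
next
  case (Suc s)
  then obtain D where D: "D \<subseteq># M" "size D \<le> s" "s \<le> (\<Sum>k\<in>#D. w k) \<or> (\<forall>k\<in>#M - D. w k = 0)" by blast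
  show ?case
  proof (cases "\<forall>k\<in>#M - D. w k = 0")
    case True
    then show ?thesis using D by (intro exI[of _ D]) auto
  next
    case False
    then obtain k where k: "k \<in># M - D" "w k > 0" by auto
    have "add_mset k D \<subseteq># M" using k(1) D(1)
      by (simp add: subseteq_mset_def in_diff_count)
    then show ?thesis using D k False by (intro exI[of _ "add_mset k D"]) auto
  qed
qed

lemma pure_multiset_eq:
  assumes "\<forall>k\<in>#M. k = 0 \<or> k = (K::nat)" "K > 0"
  shows "M = replicate_mset (count M K) K + replicate_mset (count M 0) 0"
  using assms by (intro multiset_eqI) (auto simp: not_in_iff[symmetric] count_eq_zero_iff)

text \<open>Feasibility passes to submultisets: dropping a type k <= K lowers
  \<open>K * size\<close> by K but the sum only by k. So the one-step bound can be iterated without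
  leaving the domain.\<close>

lemma feasible_lipschitz:
  fixes f :: "nat multiset \<Rightarrow> real" and K X Y :: nat and L :: real
  defines "feas \<equiv> \<lambda>Mu. (\<forall>k\<in>#Mu. k \<le> K) \<and> sum_mset Mu \<le> X \<and> K * size Mu \<le> Y + sum_mset Mu"
  assumes lip: "\<And>Mu k. feas (add_mset k Mu) \<Longrightarrow> \<bar>f (add_mset k Mu) - f Mu\<bar> \<le> L"
    and "feas (M + D)"
  shows "\<bar>f (M + D) - f M\<bar> \<le> L * real (size D) \<and> feas M"
  using assms(3)
proof (induction D)
  case empty
  then show ?case by simp
next
  case (add k D)
  have fs: "feas (add_mset k (M + D))" using add.prems by simp
  then have "feas (M + D)" unfolding feas_def by auto
  then have "\<bar>f (M + D) - f M\<bar> \<le> L * real (size D) \<and> feas M" using add.IH by blast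
  moreover have "\<bar>f (add_mset k (M + D)) - f (M + D)\<bar> \<le> L" using lip[OF fs] .
  ultimately have "\<bar>f (add_mset k (M + D)) - f M\<bar> \<le> L * real (size D) + L \<and> feas M" by linarith
  then show ?case by (simp add: algebra_simps)
qed

text \<open>A few blocks are dropped to make room, the rest is interpolated, and the Lipschitz price
  is paid for returning to the balanced multiset. All scales are powers of the sixth root \<nu> of
  the number of points: the slack is K \<nu>^5 and the scale of the potential is \<nu>^4.\<close>

lemma interpolation_bound:
  fixes f :: "nat multiset \<Rightarrow> real" and K X' Y' :: nat and L c :: real
  defines "X \<equiv> K * X'" and "Y \<equiv> K * Y'"
  defines "feas \<equiv> \<lambda>Mu. (\<forall>k\<in>#Mu. k \<le> K) \<and> sum_mset Mu \<le> X \<and> K * size Mu \<le> Y + sum_mset Mu"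
  assumes K: "K \<ge> 2" and L: "L \<ge> 0" and c: "c \<ge> 0"
    and lip: "\<And>Mu k. feas (add_mset k Mu) \<Longrightarrow> \<bar>f (add_mset k Mu) - f Mu\<bar> \<le> L"
    and step: "\<And>Mu k. feas Mu \<Longrightarrow> k \<le> K \<Longrightarrow> sum_mset Mu + K \<le> X \<Longrightarrow> K * size Mu + K \<le> Y + sum_mset Mu \<Longrightarrow>
        f (add_mset k Mu) \<ge> real k / real K * f (add_mset K Mu) + (1 - real k / real K) * f (add_mset 0 Mu)
          - c * (1 / (real X - real (sum_mset Mu)) + 1 / (real Y + real (sum_mset Mu) - real K * real (size Mu)))"
    and M: "feas M" "sum_mset M = X" "size M = X' + Y'"
  shows "f M \<ge> f (replicate_mset X' K + replicate_mset Y' 0)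
           - (24 * L * K + 2 * L * ((real K)\<^sup>2 + 1) + 2 * c) * real (X + Y) powr (5/6)"
proof (cases "X + Y = 0")
  case True
  then have "X' = 0" "Y' = 0" using K by (auto simp: X_def Y_def)
  then show ?thesis using M True by auto
next
  case False
  define n where "n = real (X + Y)"
  have n1: "n \<ge> 1" using False unfolding n_def by linarith
  define \<nu> where "\<nu> = n powr (1/6)"
  have \<nu>1: "\<nu> \<ge> 1" using n1 by (simp add: \<nu>_def ge_one_powr_ge_zero)
  have \<nu>pow: "\<nu> ^ j = n powr (real j / 6)" for j
    using n1 by (simp add: \<nu>_def powr_power)
  have \<nu>6: "\<nu> ^ 6 = n" using n1 by (simp add: \<nu>pow)
  have \<nu>5: "\<nu> ^ 5 = n powr (5/6)" by (simp add: \<nu>pow)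
  define s where "s = real K * \<nu> ^ 5"
  define R where "R = \<nu> ^ 4"
  have R0: "R > 0" using \<nu>1 by (simp add: R_def)
  have sK: "s \<ge> real K" unfolding s_def using one_le_power[OF \<nu>1, of 5] by (simp add: mult_le_cancel_left1)
  have s1: "s \<ge> 1" using sK K by linarith
  define F where "F = f (replicate_mset X' K + replicate_mset Y' 0)"
  define T where "T = X' + Y'"
  have Tn: "real T \<le> n"
  proof -
    have "T \<le> X + Y" using K by (auto simp: T_def X_def Y_def intro!: add_mono)
    then show ?thesis by (simp add: n_def)
  qed
  have lip2: "\<bar>f (M1 + D) - f M1\<bar> \<le> L * real (size D) \<and> feas M1" if "feas (M1 + D)" for M1 D
    using feasible_lipschitz[where f=f and K=K and X=X and Y=Y and L=L] lip that unfolding feas_def by blast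
  have feasF: "feas (replicate_mset X' K + replicate_mset Y' 0)"
    unfolding feas_def X_def Y_def by (auto simp: sum_mset_replicate_mset algebra_simps split: if_splits)
  \<comment> \<open>The slack 2s wanted on each side, rounded up; t <= 3s because s >= 1, so at most
    6s blocks are dropped.\<close>
  define t where "t = nat \<lceil>2 * s\<rceil>"
  have t: "real t \<ge> 2 * s" "real t \<le> 3 * s" unfolding t_def using s1 by linarith+
  \<comment> \<open>\<open>D1\<close> frees A-points and \<open>D2\<close> frees B-points. If one of
    them cannot reach t, the remaining types are all 0 or all \<open>K\<close>, and nothing is left
    to interpolate.\<close>
  obtain D1 where D1: "D1 \<subseteq># M" "size D1 \<le> t" "t \<le> (\<Sum>k\<in>#D1. k) \<or> (\<forall>k\<in>#M - D1. k = 0)"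
    using exists_slack_submultiset[of M t "\<lambda>k. k"] by blast
  obtain D2 where D2: "D2 \<subseteq># M - D1" "size D2 \<le> t" "t \<le> (\<Sum>k\<in>#D2. K - k) \<or> (\<forall>k\<in>#M - D1 - D2. K - k = 0)"
    using exists_slack_submultiset[of "M - D1" t "\<lambda>k. K - k"] by blast
  define D where "D = D1 + D2"
  define M' where "M' = M - D"
  have "D \<subseteq># M" unfolding D_def subseteq_mset_def
  proof
    fix a
    show "count (D1 + D2) a \<le> count M a"
      using mset_subset_eq_count[OF D1(1), of a] mset_subset_eq_count[OF D2(1), of a] by simp
  qed
  then have MD: "M = M' + D" unfolding M'_def by simp
  have sD: "real (size D) \<le> 6 * s" using D1(2) D2(2) t by (simp add: D_def)
  have fM': "feas M'" "f M \<ge> f M' - L * real (size D)" using lip2[of M' D] M(1) MD by auto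
  define X0 where "X0 = sum_mset M'"
  define sz where "sz = size M'"
  have szT: "sz + size D = T" using M(3) MD by (simp add: sz_def T_def)
  have XX0: "X = X0 + sum_mset D" using M(2) MD by (simp add: X0_def)
  have Dk: "\<forall>k\<in>#D. k \<le> K" using M(1) MD by (auto simp: feas_def)
  have compl: "(\<Sum>k\<in>#Q. K - k) + sum_mset Q = K * size Q" if "\<forall>k\<in>#Q. k \<le> K" for Q
    using that by (induction Q) auto
  have sDK: "sum_mset D \<le> K * size D" using compl[OF Dk] by linarith
  \<comment> \<open>A pure multiset differs from the target only in its two multiplicities, so both
    are compared with their common part \<open>Mm\<close>. The multiplicity of \<open>K\<close> is
    off by at most the deviation plus \<open>size D\<close>; as the total falls short of
    \<open>T\<close> by \<open>size D\<close>, that of 0 is off by at most one more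
    \<open>size D\<close>. This gives the coefficients 2 and 3.\<close>
  have pure: "f Mu \<ge> F - 3 * L * real (size D) - 2 * L * \<bar>real (sum_mset Mu) - real X0\<bar>"
    if Mu: "feas Mu" "size Mu = sz" "\<forall>k\<in>#Mu. k = 0 \<or> k = K" for Mu
  proof -
    define a where "a = count Mu K"
    define b where "b = count Mu 0"
    have Mue: "Mu = replicate_mset a K + replicate_mset b 0" using pure_multiset_eq[OF Mu(3)] K by (simp add: a_def b_def)
    define Mm where "Mm = replicate_mset (min a X') K + replicate_mset (min b Y') 0"
    have rep: "replicate_mset i v = replicate_mset (min i j) v + replicate_mset (i - j) v" for i j and v :: nat
      by (intro multiset_eqI) auto
    have "Mu = Mm + (replicate_mset (a - X') K + replicate_mset (b - Y') 0)"
      unfolding Mue Mm_def by (subst rep[of a K X'], subst rep[of b 0 Y']) simp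
    then have e1: "\<bar>f Mu - f Mm\<bar> \<le> L * (real (a - X') + real (b - Y'))"
      using lip2 Mu(1) by (metis (no_types) of_nat_add size_replicate_mset size_union)
    have "replicate_mset X' K + replicate_mset Y' 0 = Mm + (replicate_mset (X' - a) K + replicate_mset (Y' - b) 0)"
      unfolding Mm_def by (subst rep[of X' K a], subst rep[of Y' 0 b]) (simp add: min.commute)
    then have e2: "\<bar>F - f Mm\<bar> \<le> L * (real (X' - a) + real (Y' - b))"
      using lip2 feasF unfolding F_def by (metis (no_types) of_nat_add size_replicate_mset size_union)
    have "\<bar>f Mu - F\<bar> \<le> L * (real (a - X') + real (b - Y')) + L * (real (X' - a) + real (Y' - b))" using e1 e2 by linarith
    also have "\<dots> = L * (\<bar>real a - real X'\<bar> + \<bar>real b - real Y'\<bar>)"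
    proof -
      have "real (a - X') + real (X' - a) = \<bar>real a - real X'\<bar>" "real (b - Y') + real (Y' - b) = \<bar>real b - real Y'\<bar>" by linarith+
      moreover have "L * (p + q) + L * (p' + q') = L * ((p + p') + (q + q'))" for p q p' q' by (simp add: algebra_simps)
      ultimately show ?thesis by (simp only:)
    qed
    finally have 1: "\<bar>f Mu - F\<bar> \<le> L * (\<bar>real a - real X'\<bar> + \<bar>real b - real Y'\<bar>)" .
    define dd where "dd = \<bar>real (sum_mset Mu) - real X0\<bar>"
    have "sum_mset Mu = K * a" unfolding Mue by (simp add: sum_mset_replicate_mset mult.commute)
    then have "real K * (real a - real X') = real (sum_mset Mu) - real X" by (simp add: X_def algebra_simps)
    then have "real K * \<bar>real a - real X'\<bar> = \<bar>real (sum_mset Mu) - real X\<bar>"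
      by (metis abs_mult abs_of_nat)
    also have "\<dots> \<le> dd + real (K * size D)" using sDK XX0 unfolding dd_def by linarith
    also have "\<dots> \<le> real K * (dd + real (size D))"
      using K mult_right_mono[of 1 "real K" dd] by (simp add: distrib_left dd_def)
    finally have a1: "\<bar>real a - real X'\<bar> \<le> dd + real (size D)" using K by simp
    have "a + b = sz" using Mu(2) unfolding Mue by simp
    then have "\<bar>real b - real Y'\<bar> \<le> dd + 2 * real (size D)" using a1 szT T_def by linarith
    then have "L * (\<bar>real a - real X'\<bar> + \<bar>real b - real Y'\<bar>) \<le> L * (2 * dd + 3 * real (size D))"
      using a1 L by (intro mult_left_mono) auto
    then show ?thesis using 1 unfolding dd_def by (simp add: algebra_simps)
  qed
  define m where "m = size {#k \<in># M'. 0 < k \<and> k < K#}"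
  have mT: "real m \<le> n" 
  proof -
    have "m \<le> sz" unfolding m_def sz_def by (simp add: size_filter_mset_lesseq)
    then show ?thesis using szT Tn by linarith
  qed
  have goal': "f M' \<ge> F - 3 * L * real (size D) - 2 * L * ((real K)\<^sup>2 * real m / R + R) - real m * (2 * c / s)"
  proof (cases "\<forall>k\<in>#M'. k = 0 \<or> k = K")
    case True
    have "f M' \<ge> F - 3 * L * real (size D)" using pure[OF fM'(1) _ True] by (simp add: sz_def X0_def)
    moreover have "0 \<le> 2 * L * ((real K)\<^sup>2 * real m / R + R)" "0 \<le> real m * (2 * c / s)" using L R0 c s1 by auto
    ultimately show ?thesis by linarith
  next
    case False
    have "\<not> (\<forall>k\<in>#M - D1. k = 0)" 
    proof
      assume "\<forall>k\<in>#M - D1. k = 0"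
      then have "\<forall>k\<in>#M'. k = 0" unfolding M'_def D_def by (metis diff_diff_add_mset in_diffD)
      then show False using False by blast
    qed
    then have s1': "t \<le> sum_mset D1" using D1(3) by (simp only: image_mset.identity id_apply) blast
    have "\<not> (\<forall>k\<in>#M - D1 - D2. K - k = 0)"
    proof
      assume "\<forall>k\<in>#M - D1 - D2. K - k = 0"
      then have "\<forall>k\<in>#M'. k = K" using fM'(1) unfolding M'_def D_def feas_def by (auto simp: le_antisym)
      then show False using False by blast
    qed
    then have s2': "t \<le> (\<Sum>k\<in>#D2. K - k)" using D2(3) by blast
    have "X0 + t \<le> X" using XX0 s1' unfolding D_def by simp
    then have slA: "real X - real X0 \<ge> 2 * s" using t by linarith
    \<comment> \<open>\<open>M\<close> uses all points, so the free B-points are exactly the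
      B-points of the dropped blocks.\<close>
    have "Y + X0 = K * sz + (\<Sum>k\<in>#D. K - k)"
    proof -
      have "K * T = X + Y" by (simp add: X_def Y_def T_def algebra_simps)
      then have "K * sz + K * size D = X + Y" using szT by (metis distrib_left)
      then show ?thesis using compl[OF Dk] XX0 by linarith
    qed
    then have slB': "K * sz + t \<le> Y + X0" using s2' by (simp add: D_def)
    have "real (K * sz + t) \<le> real (Y + X0)" using slB' by linarith
    then have slB: "real Y + real X0 - real K * real sz \<ge> 2 * s" using t by simp
    have crude: "f Mu \<ge> F - 2 * L * s\<^sup>2 / R" if "feas Mu" "size Mu = sz" for Mu
    proof -
      have "\<bar>f Mu - f {#}\<bar> \<le> L * real sz" using lip2[of "{#}" Mu] that by simp
      moreover have "\<bar>F - f {#}\<bar> \<le> L * real T" using lip2[of "{#}" "replicate_mset X' K + replicate_mset Y' 0"] feasF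
        by (simp add: F_def T_def)
      moreover have "L * real sz \<le> L * n" "L * real T \<le> L * n" using L szT Tn by (auto intro!: mult_left_mono)
      moreover have "L * n \<le> L * (s\<^sup>2 / R)"
      proof -
        \<comment> \<open>Here the exponents meet: \<nu>^10 / \<nu>^4 = \<nu>^6 = n, the order of
          the trivial Lipschitz bound.\<close>
        have "s\<^sup>2 / R = (real K)\<^sup>2 * \<nu> ^ 6"
        proof -
          have "\<nu> ^ 10 = \<nu> ^ 6 * \<nu> ^ 4" using power_add[of \<nu> 6 4] by simp
          then have "s\<^sup>2 = (real K)\<^sup>2 * \<nu> ^ 6 * R" unfolding s_def R_def by (simp add: power_mult_distrib power_mult[symmetric])
          then show ?thesis using R0 by simp
        qed
        moreover have "(real K)\<^sup>2 \<ge> 1" using K by (intro one_le_power) simp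
        ultimately have "n \<le> s\<^sup>2 / R" using n1 \<nu>6 by (simp add: mult_le_cancel_right1)
        then show ?thesis using L by (rule mult_left_mono)
      qed
      ultimately have "f Mu \<ge> F - 2 * (L * (s\<^sup>2 / R))" by linarith
      then show ?thesis by (simp add: mult.assoc)
    qed
    have "f M' \<ge> F - 3 * L * real (size D) - 2 * L * (((real (sum_mset M') - real X0)\<^sup>2 + (real K)\<^sup>2 * real (size {#k \<in># M'. 0 < k \<and> k < K#})) / R + R)
                - real (size {#k \<in># M'. 0 < k \<and> k < K#}) * (2 * c / s)"
      by (rule quadratic_potential_interpolation[where X=X and Y=Y and sz=sz and f=f and F=F, OF K sK R0 L c _ _ slA slB])
        (use L step pure crude fM'(1) in \<open>auto simp: sz_def feas_def\<close>)
    then show ?thesis by (simp add: X0_def m_def)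
  qed
  have "L * real (size D) \<le> L * (6 * s)" using sD L by (rule mult_left_mono)
  moreover have "2 * L * ((real K)\<^sup>2 * real m / R + R) \<le> 2 * L * ((real K)\<^sup>2 * \<nu>^5 + \<nu>^5)"
  proof -
    have "real m / R \<le> \<nu> ^ 6 / R" using mT \<nu>6 R0 by (intro divide_right_mono) auto
    also have "\<nu> ^ 6 = \<nu> ^ 2 * R" using power_add[of \<nu> 2 4] by (simp add: R_def)
    also have "\<nu> ^ 2 * R / R = \<nu> ^ 2" using R0 by simp
    also have "\<dots> \<le> \<nu> ^ 5" using \<nu>1 by (intro power_increasing) auto
    finally have "(real K)\<^sup>2 * (real m / R) \<le> (real K)\<^sup>2 * \<nu> ^ 5" by (intro mult_left_mono) auto
    moreover have "R \<le> \<nu> ^ 5" using \<nu>1 unfolding R_def by (intro power_increasing) auto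
    ultimately show ?thesis using L by (intro mult_left_mono add_mono) auto
  qed
  moreover have "real m * (2 * c / s) \<le> 2 * c * \<nu> ^ 5"
  proof -
    have "real m / s \<le> n / \<nu> ^ 5" 
      using mT sK \<nu>1 K n1 unfolding s_def by (intro frac_le) (auto simp: mult_le_cancel_right1)
    also have "n = \<nu> ^ 1 * \<nu> ^ 5" using power_add[of \<nu> 1 5] \<nu>6 by simp
    also have "\<nu> ^ 1 * \<nu> ^ 5 / \<nu> ^ 5 = \<nu> ^ 1" using \<nu>1 by simp
    also have "\<dots> \<le> \<nu> ^ 5" using \<nu>1 by (intro power_increasing) auto
    finally have "2 * c * (real m / s) \<le> 2 * c * \<nu> ^ 5" using c by (intro mult_left_mono) auto
    then show ?thesis by (simp add: algebra_simps)
  qed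
  \<comment> \<open>One \<open>L * size D\<close> for dropping \<open>D\<close> and three from
    \<open>pure\<close>, with \<open>size D\<close> at most 6s and s = K \<nu>^5, make up the
    constant 24.\<close>
  ultimately have "f M \<ge> F - 4 * (L * (6 * s)) - 2 * L * ((real K)\<^sup>2 * \<nu>^5 + \<nu>^5) - 2 * c * \<nu> ^ 5"
    using fM'(2) goal' by linarith
  then show ?thesis unfolding F_def[symmetric] n_def[symmetric] \<nu>5[symmetric] s_def by (simp add: algebra_simps)
qed

section \<open>Models with a two-valued edge potential\<close>

text \<open>\<open>gap v\<close> is the distance from v to its predecessor in
  \<open>insert 0 S\<close>, so the gaps up to t telescope to t. The total of the gaps is the
  maximum of \<open>S\<close>; the last claim bounds it in a form that also covers the empty
  set.\<close>

lemma finite_layer_cake: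
  fixes S :: "real set"
  assumes "finite S" "\<forall>v\<in>S. 0 < v"
  shows "\<exists>gap. (\<forall>v\<in>S. 0 \<le> gap v) \<and> (\<forall>t\<in>insert 0 S. t = (\<Sum>v\<in>S. gap v * of_bool (v \<le> t)))
     \<and> (\<forall>b\<ge>0. (\<forall>v\<in>S. v \<le> b) \<longrightarrow> sum gap S \<le> b)"
  using assms
proof (induction S rule: finite_linorder_max_induct)
  case empty
  then show ?case by simp
next
  case (insert b S)
  then obtain gap where gap: "\<forall>v\<in>S. 0 \<le> gap v" "\<forall>t\<in>insert 0 S. t = (\<Sum>v\<in>S. gap v * of_bool (v \<le> t))"
      "\<forall>b\<ge>0. (\<forall>v\<in>S. v \<le> b) \<longrightarrow> sum gap S \<le> b"
    by auto
  have b: "b \<notin> S" "0 < b" "\<forall>v\<in>S. v < b" using insert.hyps insert.prems by auto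
  define gap' where "gap' = gap(b := b - sum gap S)"
  have le: "sum gap S \<le> b" using gap(3) b by (auto simp: less_imp_le)
  have sum_eq: "(\<Sum>v\<in>S. gap' v * h v) = (\<Sum>v\<in>S. gap v * h v)" for h :: "real \<Rightarrow> real"
    using b by (intro sum.cong) (auto simp: gap'_def)
  have tot: "sum gap' (insert b S) = b"
    using sum_eq[of "\<lambda>_. 1"] b insert.hyps by (simp add: gap'_def)
  show ?case
  proof (intro exI[of _ gap'] conjI)
    show "\<forall>v\<in>insert b S. 0 \<le> gap' v" using gap(1) le by (auto simp: gap'_def)
    show "\<forall>t\<in>insert 0 (insert b S). t = (\<Sum>v\<in>insert b S. gap' v * of_bool (v \<le> t))"
    proof
      fix t assume t: "t \<in> insert 0 (insert b S)"
      show "t = (\<Sum>v\<in>insert b S. gap' v * of_bool (v \<le> t))"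
      proof (cases "t = b")
        case True
        have "(\<Sum>v\<in>insert b S. gap' v * of_bool (v \<le> t)) = sum gap' (insert b S)"
          using b True by (intro sum.cong) (auto simp: less_imp_le)
        then show ?thesis using tot True by simp
      next
        case False
        then have tS: "t \<in> insert 0 S" "\<not> b \<le> t" using t b by auto
        have "(\<Sum>v\<in>insert b S. gap' v * of_bool (v \<le> t)) = gap' b * of_bool (b \<le> t) + (\<Sum>v\<in>S. gap' v * of_bool (v \<le> t))"
          using b insert.hyps by (intro sum.insert) auto
        also have "\<dots> = (\<Sum>v\<in>S. gap v * of_bool (v \<le> t))"
          using tS(2) by (simp only: sum_eq) simp
        finally have "(\<Sum>v\<in>insert b S. gap' v * of_bool (v \<le> t)) = (\<Sum>v\<in>S. gap v * of_bool (v \<le> t))" .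
        then show ?thesis using gap(2) tS by metis
      qed
    qed
    show "\<forall>c\<ge>0. (\<forall>v\<in>insert b S. v \<le> c) \<longrightarrow> sum gap' (insert b S) \<le> c" using tot by auto
  qed
qed

lemma expectation_finite_support:
  "finite (set_pmf p) \<Longrightarrow> measure_pmf.expectation p (f :: 'a \<Rightarrow> real) = (\<Sum>a\<in>set_pmf p. pmf p a * f a)"
  by (subst integral_measure_pmf_real[where A = "set_pmf p"]) (auto simp: mult.commute)

text \<open>
  The label \<open>a\<close> of an edge forbids the local assignments in \<open>Fb a\<close>; they cost \<open>hi - lo\<close>, which is
  infinite for independent sets, whereas the optimum drops by at most \<open>cap\<close> relative to \<open>hi\<close> (\<open>exchange\<close>).
  The set \<open>Os\<close> in \<open>frozen_relation\<close> stands for a set of near-optimal assignments.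
\<close>

locale interaction_model =
  fixes M :: model and hi cap :: real and lo :: ereal
    and Sg :: "nat list set" and Fb :: "nat list \<Rightarrow> nat list set"
  assumes K2: "2 \<le> mK M" and q0: "0 < mq M"
    and Sg: "finite Sg" "Sg \<noteq> {}"
    and hedge_eq: "hedge M = map_pmf (\<lambda>a y. if y \<in> Fb a then lo else ereal hi) (pmf_of_set Sg)"
    and cap: "0 \<le> cap" and lo: "lo \<le> ereal (hi - cap)"
    and ground: "\<exists>z<mq M. \<forall>a\<in>Sg. lo \<noteq> -\<infinity> \<or> replicate (mK M) z \<notin> Fb a"
    and exchange: "\<And>(n::nat) r P th x a es. finite P \<Longrightarrow> \<forall>B\<in>P. card B = mK M \<Longrightarrow> \<forall>B\<in>P. th B \<in> set_pmf (hedge M) \<Longrightarrow>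
        x \<in> {..<n} \<rightarrow>\<^sub>E {..<mq M} \<Longrightarrow> a \<in> Sg \<Longrightarrow> length es = mK M \<Longrightarrow> set es \<subseteq> {..<n} \<Longrightarrow>
        \<exists>x'\<in>{..<n} \<rightarrow>\<^sub>E {..<mq M}. Hx M n r P th x + ereal (hi - cap)
            \<le> Hx M n r P th x' + (if map x' es \<in> Fb a then lo else ereal hi)"
    and frozen_relation: "\<And>(n::nat) Os. Os \<subseteq> {..<n} \<rightarrow>\<^sub>E {..<mq M} \<Longrightarrow> Os \<noteq> {} \<Longrightarrow>
        \<exists>R c. symp R \<and> transp R \<and> 0 \<le> c \<and> c \<le> 1 \<and>
          (\<forall>es. length es = mK M \<longrightarrow> set es \<subseteq> {..<n} \<longrightarrow>
             avg Sg (\<lambda>a. of_bool (\<forall>x\<in>Os. map x es \<in> Fb a)) = c * of_bool (\<forall>u\<in>set es. \<forall>v\<in>set es. R u v))"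
begin

section \<open>The real-valued optimum and the loss caused by one new block\<close>

definition pot :: "nat list \<Rightarrow> nat list \<Rightarrow> ereal" where
  "pot a y = (if y \<in> Fb a then lo else ereal hi)"

abbreviation asg :: "nat \<Rightarrow> (nat \<Rightarrow> nat) set" where
  "asg n \<equiv> {..<n} \<rightarrow>\<^sub>E {..<mq M}"

definition valid :: "nat \<Rightarrow> nat \<Rightarrow> nat set set \<Rightarrow> bool" where
  "valid n r P \<longleftrightarrow> P \<subseteq> Pow {..<n * r} \<and> (\<forall>B\<in>P. card B = mK M)"

definition potentials :: "nat set set \<Rightarrow> (nat set \<Rightarrow> nat list \<Rightarrow> ereal) set" where
  "potentials P = {th. \<forall>B\<in>P. th B \<in> set_pmf (hedge M)}"

abbreviation rand_pot :: "nat set set \<Rightarrow> (nat set \<Rightarrow> nat list \<Rightarrow> ereal) pmf" where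
  "rand_pot P \<equiv> Pi_pmf P (\<lambda>_. 0) (\<lambda>_. hedge M)"

definition hr :: "nat \<Rightarrow> nat \<Rightarrow> nat set set \<Rightarrow> (nat set \<Rightarrow> nat list \<Rightarrow> ereal) \<Rightarrow> real" where
  "hr n r P th = real_of_ereal (HG M n r P th)"

definition hbar :: "nat \<Rightarrow> nat \<Rightarrow> nat set set \<Rightarrow> real" where
  "hbar n r P = measure_pmf.expectation (rand_pot P) (hr n r P)"

lemma hedge_pot: "hedge M = map_pmf pot (pmf_of_set Sg)"
  unfolding hedge_eq pot_def[abs_def] ..

lemma set_hedge: "set_pmf (hedge M) = pot ` Sg"
  using Sg by (simp add: hedge_pot)

lemma valid_finite: "valid n r P \<Longrightarrow> finite P"
  unfolding valid_def by (auto intro: finite_subset[of _ "Pow {..<n * r}"])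

lemma finite_asg: "finite (asg n)"
  by (intro finite_PiE) auto

lemma asg_nonempty: "asg n \<noteq> {}"
  using q0 by (auto simp: PiE_eq_empty_iff)

lemma finite_rand_pot: "finite P \<Longrightarrow> finite (set_pmf (rand_pot P))"
  using Sg by (auto simp: set_Pi_pmf set_hedge)

lemma rand_pot_potentials: "finite P \<Longrightarrow> th \<in> set_pmf (rand_pot P) \<Longrightarrow> th \<in> potentials P"
  by (auto simp: set_Pi_pmf potentials_def PiE_dflt_def)

lemma block_edge_props:
  assumes "e \<subseteq> {..<n * r}" "card e = mK M"
  shows "length (block_edge r e) = mK M" "set (block_edge r e) = (\<lambda>p. p div r) ` e" "set (block_edge r e) \<subseteq> {..<n}"
proof -
  have "finite e" using assms(1) finite_subset by blast
  then show "length (block_edge r e) = mK M" and 1: "set (block_edge r e) = (\<lambda>p. p div r) ` e"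
    using assms(2) by (auto simp: block_edge_def)
  show "set (block_edge r e) \<subseteq> {..<n}" unfolding 1 using assms(1) by (auto simp: less_mult_imp_div_less)
qed

lemma pot_le: "pot a y \<le> ereal hi"
proof -
  have "ereal (hi - cap) \<le> ereal hi" using cap by simp
  then have "lo \<le> ereal hi" using lo by (rule order_trans[rotated])
  then show ?thesis by (simp add: pot_def)
qed

lemma Hx_not_PInf:
  assumes "valid n r P" "th \<in> potentials P"
  shows "Hx M n r P th x \<noteq> \<infinity>"
proof -
  have "th B y \<noteq> \<infinity>" if B: "B \<in> P" for B y
  proof -
    obtain a where "th B = pot a" using B assms(2) by (auto simp: potentials_def set_hedge)
    then show ?thesis using pot_le[of a y] by auto
  qed
  then have "(\<Sum>B\<in>P. th B (map x (block_edge r B))) \<noteq> \<infinity>" by (auto simp: sum_Pinfty)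
  then show ?thesis unfolding Hx_def by simp
qed

text \<open>The constant assignment given by \<open>ground\<close> avoids every edge value
  -\<infinity> (for independent sets it is the empty set). Hence the maximum is finite and
  \<open>hr\<close> loses nothing by passing to reals.\<close>

lemma ex_Hx_finite:
  assumes "valid n r P" "th \<in> potentials P"
  shows "\<exists>x\<in>asg n. Hx M n r P th x \<noteq> -\<infinity>"
proof -
  obtain z where z: "z < mq M" "\<forall>a\<in>Sg. lo \<noteq> -\<infinity> \<or> replicate (mK M) z \<notin> Fb a" using ground by blast
  define x where "x = (\<lambda>i\<in>{..<n}. z)"
  have "x \<in> asg n" using z by (auto simp: x_def)
  moreover have "Hx M n r P th x \<noteq> -\<infinity>"
  proof -
    have "\<bar>th B (map x (block_edge r B))\<bar> \<noteq> \<infinity>" if B: "B \<in> P" for B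
    proof -
      obtain a where a: "th B = pot a" "a \<in> Sg" using B assms(2) by (auto simp: potentials_def set_hedge)
      have "B \<subseteq> {..<n * r}" "card B = mK M" using B assms(1) by (auto simp: valid_def)
      note pr = block_edge_props(1,3)[OF this]
      then have "map x (block_edge r B) = map (\<lambda>_. z) (block_edge r B)" unfolding x_def by (intro map_cong) auto
      also have "\<dots> = replicate (mK M) z" using pr by (simp add: map_replicate_const)
      finally have "th B (map x (block_edge r B)) \<noteq> -\<infinity>" using a z(2) by (auto simp: pot_def)
      moreover have "th B (map x (block_edge r B)) \<noteq> \<infinity>" using pot_le[of a "map x (block_edge r B)"] a by auto
      ultimately show ?thesis by auto
    qed
    then have "(\<Sum>B\<in>P. th B (map x (block_edge r B))) = (\<Sum>B\<in>P. ereal (real_of_ereal (th B (map x (block_edge r B)))))"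
      by (intro sum.cong) (auto simp: ereal_real)
    then show ?thesis unfolding Hx_def by simp
  qed
  ultimately show ?thesis by blast
qed

lemma HG_le_iff: "HG M n r P th \<le> c \<longleftrightarrow> (\<forall>x\<in>asg n. Hx M n r P th x \<le> c)"
  unfolding HG_def using finite_asg asg_nonempty by (subst Max_le_iff) auto

lemma HG_attained: "\<exists>x\<in>asg n. HG M n r P th = Hx M n r P th x"
proof -
  have "HG M n r P th \<in> Hx M n r P th ` asg n" unfolding HG_def using finite_asg asg_nonempty by (intro Max_in) auto
  then show ?thesis by auto
qed

lemma ereal_hr:
  assumes "valid n r P" "th \<in> potentials P"
  shows "HG M n r P th = ereal (hr n r P th)"
proof -
  obtain x where "HG M n r P th = Hx M n r P th x" using HG_attained by blast
  then have "HG M n r P th \<noteq> \<infinity>" using Hx_not_PInf[OF assms] by simp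
  moreover obtain y where "y \<in> asg n" "Hx M n r P th y \<noteq> -\<infinity>" using ex_Hx_finite[OF assms] by blast
  then have "HG M n r P th \<noteq> -\<infinity>" using HG_le_iff[of n r P th "-\<infinity>"] by auto
  ultimately show ?thesis unfolding hr_def by (auto simp: ereal_real)
qed

lemma Hx_insert:
  assumes "finite P" "e \<notin> P"
  shows "Hx M n r (insert e P) (th(e := \<theta>)) x = Hx M n r P th x + \<theta> (map x (block_edge r e))"
proof -
  have "(\<Sum>B\<in>P. (th(e := \<theta>)) B (map x (block_edge r B))) = (\<Sum>B\<in>P. th B (map x (block_edge r B)))"
    using assms by (intro sum.cong) auto
  then show ?thesis unfolding Hx_def using assms by (simp add: ac_simps)
qed

text \<open>The loss is measured against \<open>hi\<close>, the most a block can contribute, which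
  makes it nonnegative.\<close>

definition deficit :: "nat \<Rightarrow> nat \<Rightarrow> nat set set \<Rightarrow> (nat set \<Rightarrow> nat list \<Rightarrow> ereal) \<Rightarrow> nat set \<Rightarrow> nat list \<Rightarrow> real" where
  "deficit n r P th e a = hr n r P th + hi - hr n r (insert e P) (th(e := pot a))"

context
  fixes n r P th e a
  assumes vP: "valid n r P" and th: "th \<in> potentials P" and e: "e \<subseteq> {..<n * r}" "card e = mK M" "e \<notin> P"
    and a: "a \<in> Sg"
begin

lemma insert_valid: "valid n r (insert e P)" "th(e := pot a) \<in> potentials (insert e P)"
  using vP th e a by (auto simp: valid_def potentials_def set_hedge)

lemma hr_insert_le_iff:
  "hr n r (insert e P) (th(e := pot a)) \<le> c \<longleftrightarrow>
   (\<forall>x\<in>asg n. Hx M n r P th x + pot a (map x (block_edge r e)) \<le> ereal c)"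
proof -
  have "hr n r (insert e P) (th(e := pot a)) \<le> c \<longleftrightarrow> HG M n r (insert e P) (th(e := pot a)) \<le> ereal c"
    using ereal_hr[OF insert_valid] by simp
  then show ?thesis unfolding HG_le_iff using Hx_insert[OF valid_finite[OF vP] e(3)] by simp
qed

lemma Hx_le_hr: "x \<in> asg n \<Longrightarrow> Hx M n r P th x \<le> ereal (hr n r P th)"
  using HG_le_iff[of n r P th "HG M n r P th"] ereal_hr[OF vP th] by simp

lemma deficit_nonneg: "0 \<le> deficit n r P th e a"
proof -
  have "Hx M n r P th x + pot a (map x (block_edge r e)) \<le> ereal (hr n r P th + hi)" if "x \<in> asg n" for x
    using add_mono[OF Hx_le_hr[OF that] pot_le] by simp
  then show ?thesis unfolding deficit_def using hr_insert_le_iff[of "hr n r P th + hi"] by simp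
qed

text \<open>\<open>exchange\<close> turns an optimal assignment into one that accommodates the new
  block at a total loss of at most \<open>cap\<close>, even if \<open>lo\<close> is
  -\<infinity>.\<close>

lemma deficit_le_cap: "deficit n r P th e a \<le> cap"
proof -
  obtain x where x: "x \<in> asg n" "HG M n r P th = Hx M n r P th x" using HG_attained by blast
  obtain x' where x': "x' \<in> asg n" "Hx M n r P th x + ereal (hi - cap) \<le> Hx M n r P th x' + pot a (map x' (block_edge r e))"
    using exchange[of P th x n a "block_edge r e" r] valid_finite[OF vP] vP th x(1) a block_edge_props[OF e(1,2)]
    unfolding pot_def valid_def potentials_def by auto
  have "Hx M n r P th x' + pot a (map x' (block_edge r e)) \<le> ereal (hr n r (insert e P) (th(e := pot a)))"
    using hr_insert_le_iff x'(1) by blast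
  then have "ereal (hr n r P th) + ereal (hi - cap) \<le> ereal (hr n r (insert e P) (th(e := pot a)))"
    using x'(2) x(2) ereal_hr[OF vP th] by simp
  then show ?thesis unfolding deficit_def by simp
qed

text \<open>An assignment within less than v of the optimum that satisfies the new block would keep
  the loss below v. Conversely, a violated block costs at least \<open>cap\<close>, hence at least
  v, so assignments violating it never beat the threshold. The loss thus becomes a statement about
  near-optimal assignments of the old graph alone.\<close>

lemma deficit_ge_iff:
  assumes v: "0 < v" "v \<le> cap"
  shows "v \<le> deficit n r P th e a \<longleftrightarrow>
     (\<forall>x\<in>{x\<in>asg n. ereal (hr n r P th - v) < Hx M n r P th x}. map x (block_edge r e) \<in> Fb a)"
proof -
  have "v \<le> deficit n r P th e a \<longleftrightarrow> hr n r (insert e P) (th(e := pot a)) \<le> hr n r P th + hi - v"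
    unfolding deficit_def by auto
  also have "\<dots> \<longleftrightarrow> (\<forall>x\<in>asg n. Hx M n r P th x + pot a (map x (block_edge r e)) \<le> ereal (hr n r P th + hi - v))"
    by (rule hr_insert_le_iff)
  also have "\<dots> \<longleftrightarrow> (\<forall>x\<in>asg n. ereal (hr n r P th - v) < Hx M n r P th x \<longrightarrow> map x (block_edge r e) \<in> Fb a)"
  proof (intro ball_cong refl)
    fix x assume x: "x \<in> asg n"
    show "(Hx M n r P th x + pot a (map x (block_edge r e)) \<le> ereal (hr n r P th + hi - v)) =
        (ereal (hr n r P th - v) < Hx M n r P th x \<longrightarrow> map x (block_edge r e) \<in> Fb a)"
    proof (cases "map x (block_edge r e) \<in> Fb a")
      case True
      have "Hx M n r P th x + lo \<le> ereal (hr n r P th) + ereal (hi - cap)"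
        using add_mono[OF Hx_le_hr[OF x] lo] .
      also have "\<dots> \<le> ereal (hr n r P th + hi - v)" using v by simp
      finally show ?thesis using True by (simp add: pot_def)
    next
      case False
      then show ?thesis using Hx_not_PInf[OF vP th, of x]
        by (cases "Hx M n r P th x") (auto simp: pot_def)
    qed
  qed
  finally show ?thesis by auto
qed

end

end

lemma weighted_sum_affine:
  fixes w a b :: "'t \<Rightarrow> real"
  shows "(\<Sum>t\<in>T. w t * (p * a t + q * b t + d)) = p * (\<Sum>t\<in>T. w t * a t) + q * (\<Sum>t\<in>T. w t * b t) + sum w T * d"
  by (simp add: sum.distrib sum_distrib_left sum_distrib_right algebra_simps)

context interaction_model
begin

section \<open>The mean loss as a positive combination of indicators\<close>

definition mean_deficit :: "nat \<Rightarrow> nat \<Rightarrow> nat set set \<Rightarrow> (nat set \<Rightarrow> nat list \<Rightarrow> ereal) \<Rightarrow> nat set \<Rightarrow> real" where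
  "mean_deficit n r P th e = avg Sg (deficit n r P th e)"

text \<open>Layer cake for the deficit: the event that it is at least v says that all near-optimal
  assignments are forbidden on the block, and averaging over labels turns this, by
  \<open>frozen_relation\<close>, into a multiple of an indicator. The relation depends on v and on
  the old graph but not on \<open>e\<close>, which is what allows averaging over \<open>e\<close>
  later.\<close>

lemma mean_deficit_layers:
  assumes vP: "valid n r P" and th: "th \<in> potentials P"
  shows "\<exists>S (w :: real \<Rightarrow> real) R. finite S \<and> (\<forall>v\<in>S. 0 \<le> w v \<and> symp (R v) \<and> transp (R v)) \<and> sum w S \<le> cap \<and>
     (\<forall>e. e \<subseteq> {..<n * r} \<longrightarrow> card e = mK M \<longrightarrow> e \<notin> P \<longrightarrow>
        mean_deficit n r P th e = (\<Sum>v\<in>S. w v * of_bool (\<forall>p\<in>e. \<forall>q\<in>e. R v (p div r) (q div r))))"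
proof -
  define E where "E = {e. e \<subseteq> {..<n * r} \<and> card e = mK M \<and> e \<notin> P}"
  \<comment> \<open>The positive deficits of all blocks and labels together: a finite set of
    thresholds that does not depend on \<open>e\<close>.\<close>
  define S where "S = (\<Union>e\<in>E. deficit n r P th e ` Sg) - {0}"
  have fE: "finite E" unfolding E_def by (rule finite_subset[of _ "Pow {..<n * r}"]) auto
  have fS: "finite S" using fE Sg by (auto simp: S_def)
  have S: "0 < v \<and> v \<le> cap" if "v \<in> S" for v
  proof -
    obtain e a where e: "e \<in> E" "a \<in> Sg" and v: "v = deficit n r P th e a" "v \<noteq> 0" using \<open>v \<in> S\<close> unfolding S_def by blast
    have "0 \<le> v" "v \<le> cap" using e deficit_nonneg[OF vP th] deficit_le_cap[OF vP th] unfolding v(1) E_def by simp_all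
    then show ?thesis using v(2) by simp
  qed
  then have S0: "\<forall>v\<in>S. 0 < v" by blast
  obtain gap where gap: "\<forall>v\<in>S. 0 \<le> gap v" "\<forall>t\<in>insert 0 S. t = (\<Sum>v\<in>S. gap v * of_bool (v \<le> t))"
     "\<forall>b\<ge>0. (\<forall>v\<in>S. v \<le> b) \<longrightarrow> sum gap S \<le> b"
    using finite_layer_cake[OF fS S0] by (elim exE conjE) (rule that)
  \<comment> \<open>The strict inequality matches the threshold \<open>v \<le> deficit\<close>, and
    v > 0 keeps the optimal assignments in \<open>Os v\<close>.\<close>
  define Os where "Os v = {x\<in>asg n. ereal (hr n r P th - v) < Hx M n r P th x}" for v
  define Q where "Q v R c \<longleftrightarrow> symp R \<and> transp R \<and> 0 \<le> c \<and> c \<le> 1 \<and>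
          (\<forall>es. length es = mK M \<longrightarrow> set es \<subseteq> {..<n} \<longrightarrow>
             avg Sg (\<lambda>a. of_bool (\<forall>x\<in>Os v. map x es \<in> Fb a)) = c * of_bool (\<forall>u\<in>set es. \<forall>w\<in>set es. R u w))" for v R and c :: real
  have "\<exists>R c. Q v R c"
    if v: "v \<in> S" for v
    unfolding Q_def
  proof (rule frozen_relation)
    show "Os v \<subseteq> asg n" by (auto simp: Os_def)
    obtain x where "x \<in> asg n" "HG M n r P th = Hx M n r P th x" using HG_attained by blast
    moreover from this have "Hx M n r P th x = ereal (hr n r P th)" using ereal_hr[OF vP th] by metis
    ultimately have "x \<in> Os v" using S[OF v] by (simp add: Os_def)
    then show "Os v \<noteq> {}" by blast
  qed
  then obtain R c where "\<forall>v\<in>S. Q v (R v) (c v)" by metis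
  then have Rc: "symp (R v) \<and> transp (R v) \<and> 0 \<le> c v \<and> c v \<le> 1"
    and Rc': "length es = mK M \<Longrightarrow> set es \<subseteq> {..<n} \<Longrightarrow>
      avg Sg (\<lambda>a. of_bool (\<forall>x\<in>Os v. map x es \<in> Fb a)) = c v * of_bool (\<forall>u\<in>set es. \<forall>w\<in>set es. R v u w)"
    if "v \<in> S" for v es using that unfolding Q_def by blast+
  define w where "w v = gap v * c v" for v
  have "sum w S \<le> sum gap S" unfolding w_def using Rc gap(1) by (intro sum_mono) (auto intro: mult_left_le)
  also have "\<dots> \<le> cap" using gap(3) cap S by auto
  finally have w: "sum w S \<le> cap" .
  have "mean_deficit n r P th e = (\<Sum>v\<in>S. w v * of_bool (\<forall>p\<in>e. \<forall>q\<in>e. R v (p div r) (q div r)))"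
    if e: "e \<subseteq> {..<n * r}" "card e = mK M" "e \<notin> P" for e
  proof -
    note be = block_edge_props[OF e(1,2)]
    have "mean_deficit n r P th e = avg Sg (\<lambda>a. \<Sum>v\<in>S. gap v * of_bool (\<forall>x\<in>Os v. map x (block_edge r e) \<in> Fb a))"
      unfolding mean_deficit_def
    proof (rule avg_cong)
      fix a assume a: "a \<in> Sg"
      have "e \<in> E" using e by (simp add: E_def)
      then have "deficit n r P th e a \<in> insert 0 S" using a unfolding S_def by blast
      then have "deficit n r P th e a = (\<Sum>v\<in>S. gap v * of_bool (v \<le> deficit n r P th e a))" using gap(2) by blast
      also have "\<dots> = (\<Sum>v\<in>S. gap v * of_bool (\<forall>x\<in>Os v. map x (block_edge r e) \<in> Fb a))"
        using deficit_ge_iff[OF vP th e a] S by (intro sum.cong refl) (simp add: Os_def)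
      finally show "deficit n r P th e a = \<dots>" .
    qed
    also have "\<dots> = (\<Sum>v\<in>S. gap v * avg Sg (\<lambda>a. of_bool (\<forall>x\<in>Os v. map x (block_edge r e) \<in> Fb a)))"
      by (simp only: avg_sum avg_cmult)
    also have "\<dots> = (\<Sum>v\<in>S. w v * of_bool (\<forall>p\<in>e. \<forall>q\<in>e. R v (p div r) (q div r)))"
    proof (rule sum.cong[OF refl])
      fix v assume "v \<in> S"
      then have "avg Sg (\<lambda>a. of_bool (\<forall>x\<in>Os v. map x (block_edge r e) \<in> Fb a)) =
          c v * of_bool (\<forall>u\<in>set (block_edge r e). \<forall>w\<in>set (block_edge r e). R v u w)"
        by (intro Rc' be(1,3))
      then show "gap v * avg Sg (\<lambda>a. of_bool (\<forall>x\<in>Os v. map x (block_edge r e) \<in> Fb a)) =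
          w v * of_bool (\<forall>p\<in>e. \<forall>q\<in>e. R v (p div r) (q div r))"
        unfolding be(2) w_def by simp
    qed
    finally show ?thesis .
  qed
  moreover have "\<forall>v\<in>S. 0 \<le> w v \<and> symp (R v) \<and> transp (R v)" using Rc gap(1) by (simp add: w_def)
  ultimately show ?thesis using fS w by (intro exI[of _ S] exI[of _ w] exI[of _ R] conjI) simp_all
qed

text \<open>The relation on nodes is pulled back to points along \<open>p div r\<close>, where it
  stays symmetric and transitive. The layers have total weight at most \<open>cap\<close>, so their
  errors add up to at most \<open>cap\<close> times the error of one indicator.\<close>

lemma avg_mean_deficit_convex:
  assumes vP: "valid n r P" and th: "th \<in> potentials P" and k: "k \<le> mK M"
  defines "U \<equiv> {..<n * r} - \<Union>P"
  assumes x: "mK M \<le> card (U \<inter> {..<X})" and y: "mK M \<le> card (U - {..<X})"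
  shows "avg (blocks (mK M) X U k) (mean_deficit n r P th) \<le>
     real k / real (mK M) * avg (blocks (mK M) X U (mK M)) (mean_deficit n r P th)
     + (1 - real k / real (mK M)) * avg (blocks (mK M) X U 0) (mean_deficit n r P th)
     + cap * (real (mK M))\<^sup>2 * (1 / real (card (U \<inter> {..<X})) + 1 / real (card (U - {..<X})))"
proof -
  define p where "p = real k / real (mK M)"
  define \<epsilon> where "\<epsilon> = (real (mK M))\<^sup>2 * (1 / real (card (U \<inter> {..<X})) + 1 / real (card (U - {..<X})))"
  have \<epsilon>: "0 \<le> \<epsilon>" by (simp add: \<epsilon>_def)
  obtain S and w :: "real \<Rightarrow> real" and R where S: "finite S" "\<forall>v\<in>S. 0 \<le> w v \<and> symp (R v) \<and> transp (R v)" "sum w S \<le> cap"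
     and md: "\<And>e. e \<subseteq> {..<n * r} \<Longrightarrow> card e = mK M \<Longrightarrow> e \<notin> P \<Longrightarrow>
        mean_deficit n r P th e = (\<Sum>v\<in>S. w v * of_bool (\<forall>p\<in>e. \<forall>q\<in>e. R v (p div r) (q div r)))"
    using mean_deficit_layers[OF vP th] by blast
  define G where "G v = (\<lambda>e. of_bool (\<forall>p\<in>e. \<forall>q\<in>e. R v (p div r) (q div r)) :: real)" for v
  have av: "avg (blocks (mK M) X U j) (mean_deficit n r P th) = (\<Sum>v\<in>S. w v * avg (blocks (mK M) X U j) (G v))" for j
  proof -
    have "avg (blocks (mK M) X U j) (mean_deficit n r P th) = avg (blocks (mK M) X U j) (\<lambda>e. \<Sum>v\<in>S. w v * G v e)"
    proof (rule avg_cong)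
      fix e assume e: "e \<in> blocks (mK M) X U j"
      then have ee: "e \<subseteq> U" "card e = mK M" by (auto simp: blocks_def)
      then have "e \<noteq> {}" using K2 by auto
      then have "e \<notin> P" using ee by (auto simp: U_def)
      then show "mean_deficit n r P th e = (\<Sum>v\<in>S. w v * G v e)" using ee md[of e] by (auto simp: U_def G_def)
    qed
    then show ?thesis by (simp only: avg_sum avg_cmult)
  qed
  have "(\<Sum>v\<in>S. w v * avg (blocks (mK M) X U k) (G v)) \<le>
      (\<Sum>v\<in>S. w v * (p * avg (blocks (mK M) X U (mK M)) (G v) + (1 - p) * avg (blocks (mK M) X U 0) (G v) + \<epsilon>))"
  proof (intro sum_mono mult_left_mono)
    fix v assume v: "v \<in> S"
    have "symp (\<lambda>p q. R v (p div r) (q div r))" "transp (\<lambda>p q. R v (p div r) (q div r))"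
    proof -
      have s: "symp (R v)" and t: "transp (R v)" using S(2) v by auto
      show "symp (\<lambda>p q. R v (p div r) (q div r))" using sympD[OF s] by (intro sympI)
      show "transp (\<lambda>p q. R v (p div r) (q div r))" using transpD[OF t] by (intro transpI)
    qed
    from avg_monochromatic_blocks[OF this _ K2 k x y]
    show "avg (blocks (mK M) X U k) (G v) \<le> p * avg (blocks (mK M) X U (mK M)) (G v) + (1 - p) * avg (blocks (mK M) X U 0) (G v) + \<epsilon>"
      unfolding G_def p_def \<epsilon>_def by (simp add: U_def)
  qed (use S in auto)
  also have "\<dots> = p * (\<Sum>v\<in>S. w v * avg (blocks (mK M) X U (mK M)) (G v))
      + (1 - p) * (\<Sum>v\<in>S. w v * avg (blocks (mK M) X U 0) (G v)) + sum w S * \<epsilon>"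
    by (rule weighted_sum_affine)
  also have "sum w S * \<epsilon> \<le> cap * \<epsilon>" using S(3) \<epsilon> by (rule mult_right_mono)
  finally show ?thesis unfolding av p_def \<epsilon>_def by (simp add: mult.assoc)
qed

section \<open>The expected optimum over random potentials\<close>

lemma hbar_eq_sum:
  assumes "finite P"
  shows "hbar n r P = (\<Sum>th\<in>set_pmf (rand_pot P). pmf (rand_pot P) th * hr n r P th)"
  unfolding hbar_def using finite_rand_pot[OF assms] by (rule expectation_finite_support)

text \<open>The label of the new block is independent of the old potentials; conditioning on the
  latter replaces the deficit by its average over labels.\<close>

lemma hbar_insert:
  assumes vP: "valid n r P" and e: "e \<subseteq> {..<n * r}" "card e = mK M" "e \<notin> P"
  shows "hbar n r (insert e P) = hbar n r P + hi
     - (\<Sum>th\<in>set_pmf (rand_pot P). pmf (rand_pot P) th * mean_deficit n r P th e)"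
proof -
  let ?Q = "rand_pot P"
  have fP: "finite P" by (rule valid_finite[OF vP])
  note fQ = finite_rand_pot[OF fP]
  have "rand_pot (insert e P) = pmf_of_set Sg \<bind> (\<lambda>a. map_pmf (\<lambda>th. th(e := pot a)) ?Q)"
    using fP e(3) by (subst Pi_pmf_insert') (auto simp: hedge_pot map_pmf_def bind_assoc_pmf bind_return_pmf)
  then have "hbar n r (insert e P) =
      (\<Sum>a\<in>Sg. measure_pmf.expectation (map_pmf (\<lambda>th. th(e := pot a)) ?Q) (hr n r (insert e P)) /\<^sub>R real (card Sg))"
    unfolding hbar_def using Sg fQ by (simp only:) (rule pmf_expectation_bind_pmf_of_set, auto)
  also have "\<dots> = avg Sg (\<lambda>a. \<Sum>th\<in>set_pmf ?Q. pmf ?Q th * hr n r (insert e P) (th(e := pot a)))"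
    unfolding avg_def integral_map_pmf expectation_finite_support[OF fQ]
    by (simp add: divide_inverse_commute sum_distrib_left)
  also have "\<dots> = (\<Sum>th\<in>set_pmf ?Q. pmf ?Q th * avg Sg (\<lambda>a. hr n r (insert e P) (th(e := pot a))))"
    by (simp only: avg_sum avg_cmult)
  also have "\<dots> = (\<Sum>th\<in>set_pmf ?Q. pmf ?Q th * (hr n r P th + hi - mean_deficit n r P th e))"
  proof (rule sum.cong[OF refl])
    fix th
    have "avg Sg (\<lambda>a. hr n r (insert e P) (th(e := pot a))) = avg Sg (\<lambda>a. (hr n r P th + hi) - deficit n r P th e a)"
      by (simp add: deficit_def)
    also have "\<dots> = hr n r P th + hi - mean_deficit n r P th e"
      by (simp only: avg_diff avg_const[OF Sg] mean_deficit_def)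
    finally show "pmf ?Q th * avg Sg (\<lambda>a. hr n r (insert e P) (th(e := pot a))) = pmf ?Q th * (hr n r P th + hi - mean_deficit n r P th e)"
      by simp
  qed
  also have "\<dots> = (\<Sum>th\<in>set_pmf ?Q. pmf ?Q th * hr n r P th) + (\<Sum>th\<in>set_pmf ?Q. pmf ?Q th) * hi
      - (\<Sum>th\<in>set_pmf ?Q. pmf ?Q th * mean_deficit n r P th e)"
    by (simp add: algebra_simps sum.distrib sum_subtractf sum_distrib_left)
  also have "(\<Sum>th\<in>set_pmf ?Q. pmf ?Q th) = 1" using fQ by (rule sum_pmf_eq_1) simp
  finally show ?thesis by (simp add: hbar_eq_sum[OF fP])
qed

lemma mean_deficit_bounds:
  assumes "valid n r P" "th \<in> potentials P" "e \<subseteq> {..<n * r}" "card e = mK M" "e \<notin> P"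
  shows "0 \<le> mean_deficit n r P th e" "mean_deficit n r P th e \<le> cap"
proof -
  have "avg Sg (\<lambda>_. 0) \<le> mean_deficit n r P th e"
    unfolding mean_deficit_def using deficit_nonneg[OF assms] by (rule avg_mono)
  then show "0 \<le> mean_deficit n r P th e" by (simp add: avg_const[OF Sg])
  have "mean_deficit n r P th e \<le> avg Sg (\<lambda>_. cap)"
    unfolding mean_deficit_def using deficit_le_cap[OF assms] by (rule avg_mono)
  then show "mean_deficit n r P th e \<le> cap" by (simp add: avg_const[OF Sg])
qed

lemma hbar_lipschitz:
  assumes vP: "valid n r P" and e: "e \<subseteq> {..<n * r}" "card e = mK M" "e \<notin> P"
  shows "\<bar>hbar n r (insert e P) - hbar n r P\<bar> \<le> \<bar>hi\<bar> + cap"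
proof -
  let ?Q = "rand_pot P"
  have fP: "finite P" by (rule valid_finite[OF vP])
  note fQ = finite_rand_pot[OF fP]
  have b: "0 \<le> mean_deficit n r P th e" "mean_deficit n r P th e \<le> cap" if "th \<in> set_pmf ?Q" for th
    using mean_deficit_bounds[OF vP rand_pot_potentials[OF fP that] e] by auto
  have "0 \<le> (\<Sum>th\<in>set_pmf ?Q. pmf ?Q th * mean_deficit n r P th e)"
    using b by (intro sum_nonneg mult_nonneg_nonneg) auto
  moreover have "(\<Sum>th\<in>set_pmf ?Q. pmf ?Q th * mean_deficit n r P th e) \<le> (\<Sum>th\<in>set_pmf ?Q. pmf ?Q th * cap)"
    using b by (intro sum_mono mult_left_mono) auto
  moreover have "(\<Sum>th\<in>set_pmf ?Q. pmf ?Q th * cap) = cap"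
    using sum_pmf_eq_1[OF fQ] by (simp add: sum_distrib_right[symmetric])
  ultimately show ?thesis using hbar_insert[OF assms] by linarith
qed

text \<open>The term \<open>hbar n r P + hi\<close> is common to all types, and the two weights sum
  to one. Only the averaged deficit varies with the type; it enters with a minus sign, which turns
  its upper bound into a lower bound.\<close>

lemma avg_hbar_convex:
  assumes vP: "valid n r P" and k: "k \<le> mK M"
  defines "U \<equiv> {..<n * r} - \<Union>P"
  assumes x: "mK M \<le> card (U \<inter> {..<X})" and y: "mK M \<le> card (U - {..<X})"
  shows "avg (blocks (mK M) X U k) (\<lambda>e. hbar n r (insert e P)) \<ge>
     real k / real (mK M) * avg (blocks (mK M) X U (mK M)) (\<lambda>e. hbar n r (insert e P))
     + (1 - real k / real (mK M)) * avg (blocks (mK M) X U 0) (\<lambda>e. hbar n r (insert e P))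
     - cap * (real (mK M))\<^sup>2 * (1 / real (card (U \<inter> {..<X})) + 1 / real (card (U - {..<X})))"
proof -
  let ?Q = "rand_pot P"
  let ?B = "blocks (mK M) X U"
  have fP: "finite P" by (rule valid_finite[OF vP])
  note fQ = finite_rand_pot[OF fP]
  define p where "p = real k / real (mK M)"
  define \<epsilon> where "\<epsilon> = cap * (real (mK M))\<^sup>2 * (1 / real (card (U \<inter> {..<X})) + 1 / real (card (U - {..<X})))"
  have fU: "finite U" by (simp add: U_def)
  define D where "D j = (\<Sum>th\<in>set_pmf ?Q. pmf ?Q th * avg (?B j) (mean_deficit n r P th))" for j
  have av: "avg (?B j) (\<lambda>e. hbar n r (insert e P)) = hbar n r P + hi - D j" if j: "j \<le> mK M" for j
  proof -
    have "card (?B j) > 0" using card_blocks[OF fU j, of X] x y j by simp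
    then have ne: "?B j \<noteq> {}" by auto
    have "avg (?B j) (\<lambda>e. hbar n r (insert e P)) =
        avg (?B j) (\<lambda>e. (hbar n r P + hi) - (\<Sum>th\<in>set_pmf ?Q. pmf ?Q th * mean_deficit n r P th e))"
    proof (rule avg_cong)
      fix e assume e: "e \<in> ?B j"
      then have ee: "e \<subseteq> U" "card e = mK M" by (auto simp: blocks_def)
      then have "e \<noteq> {}" using K2 by auto
      then have "e \<notin> P" using ee by (auto simp: U_def)
      moreover have "e \<subseteq> {..<n * r}" using ee by (auto simp: U_def)
      ultimately show "hbar n r (insert e P) = (hbar n r P + hi) - (\<Sum>th\<in>set_pmf ?Q. pmf ?Q th * mean_deficit n r P th e)"
        using hbar_insert[OF vP] ee by simp
    qed
    also have "\<dots> = hbar n r P + hi - D j"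
      unfolding D_def by (simp only: avg_diff avg_const[OF finite_blocks[OF fU] ne] avg_sum avg_cmult)
    finally show ?thesis .
  qed
  have "D k \<le> (\<Sum>th\<in>set_pmf ?Q. pmf ?Q th * (p * avg (?B (mK M)) (mean_deficit n r P th) + (1 - p) * avg (?B 0) (mean_deficit n r P th) + \<epsilon>))"
    unfolding D_def p_def \<epsilon>_def
  proof (intro sum_mono mult_left_mono)
    fix th assume "th \<in> set_pmf ?Q"
    then have "th \<in> potentials P" by (rule rand_pot_potentials[OF fP])
    then show "avg (?B k) (mean_deficit n r P th) \<le> real k / real (mK M) * avg (?B (mK M)) (mean_deficit n r P th)
        + (1 - real k / real (mK M)) * avg (?B 0) (mean_deficit n r P th)
        + cap * (real (mK M))\<^sup>2 * (1 / real (card (U \<inter> {..<X})) + 1 / real (card (U - {..<X})))"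
      using avg_mean_deficit_convex[OF vP _ k] x y unfolding U_def by blast
  qed simp
  also have "\<dots> = p * D (mK M) + (1 - p) * D 0 + (\<Sum>th\<in>set_pmf ?Q. pmf ?Q th) * \<epsilon>"
    unfolding D_def by (rule weighted_sum_affine)
  also have "(\<Sum>th\<in>set_pmf ?Q. pmf ?Q th) = 1" using fQ by (rule sum_pmf_eq_1) simp
  finally have "D k \<le> p * D (mK M) + (1 - p) * D 0 + \<epsilon>" by simp
  then show ?thesis using k unfolding p_def[symmetric] \<epsilon>_def[symmetric]
    by (simp add: av algebra_simps)
qed

section \<open>The interpolation applied to typed configurations\<close>

definition typed_mean :: "nat \<Rightarrow> nat \<Rightarrow> nat \<Rightarrow> nat multiset \<Rightarrow> real" where
  "typed_mean N1 N2 r Mu = avg (confs (mK M) (N1 * r) {..<N1 * r + N2 * r} Mu) (hbar (N1 + N2) r)"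

text \<open>Both hypotheses of \<open>interpolation_bound\<close>, Lipschitz and replacement, are
  checked for one fixed configuration and then averaged: a configuration with one more type is a
  configuration followed by a uniform free block.\<close>

theorem typed_mean_interpolation:
  assumes d: "mK M dvd N1 * r" "mK M dvd N2 * r"
    and Mu: "\<forall>k\<in>#Mu. k \<le> mK M" "sum_mset Mu = N1 * r" "mK M * size Mu = N1 * r + N2 * r"
  shows "typed_mean N1 N2 r Mu \<ge> typed_mean N1 N2 r (replicate_mset (N1 * r div mK M) (mK M) + replicate_mset (N2 * r div mK M) 0)
       - (24 * (\<bar>hi\<bar> + cap) * mK M + 2 * (\<bar>hi\<bar> + cap) * ((real (mK M))\<^sup>2 + 1) + 2 * (cap * (real (mK M))\<^sup>2)) * real (N1 * r + N2 * r) powr (5/6)"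
proof -
  define K where "K = mK M"
  define X' where "X' = N1 * r div K"
  define Y' where "Y' = N2 * r div K"
  have X: "N1 * r = K * X'" and Y: "N2 * r = K * Y'" using d by (auto simp: X'_def Y'_def K_def)
  have K0: "K > 0" using K2 by (simp add: K_def)
  have nr: "(N1 + N2) * r = K * X' + K * Y'" using X Y by (simp add: algebra_simps)
  define f where "f Mu = avg (confs K (K * X') {..<K * X' + K * Y'} Mu) (hbar (N1 + N2) r)" for Mu
  have val: "valid (N1 + N2) r P" if "P \<in> confs K (K * X') {..<K * X' + K * Y'} Mu" for P Mu
    using that unfolding valid_def nr confs_def K_def by blast
  have rec: "f (add_mset k Mu) = avg (confs K (K * X') {..<K * X' + K * Y'} Mu) (\<lambda>P. avg (blocks K (K * X') ({..<K * X' + K * Y'} - \<Union>P) k) (\<lambda>e. hbar (N1 + N2) r (insert e P)))"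
    if "k \<le> K" "sum_mset Mu + k \<le> K * X'" "K * size Mu + K \<le> K * Y' + sum_mset Mu + k" for k Mu
    unfolding f_def using that by (intro avg_confs_add_mset K0) auto
  have "f Mu \<ge> f (replicate_mset X' K + replicate_mset Y' 0)
           - (24 * (\<bar>hi\<bar> + cap) * K + 2 * (\<bar>hi\<bar> + cap) * ((real K)\<^sup>2 + 1) + 2 * (cap * (real K)\<^sup>2)) * real (K * X' + K * Y') powr (5/6)"
  proof (rule interpolation_bound)
    show "2 \<le> K" using K2 by (simp add: K_def)
    show "0 \<le> \<bar>hi\<bar> + cap" "0 \<le> cap * (real K)\<^sup>2" using cap by auto
    show "(\<forall>k\<in>#Mu. k \<le> K) \<and> sum_mset Mu \<le> K * X' \<and> K * size Mu \<le> K * Y' + sum_mset Mu"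
      using Mu X Y by (simp add: K_def)
    show "sum_mset Mu = K * X'" using Mu X by simp
    have "K * size Mu = K * (X' + Y')" using Mu(3) X Y by (simp add: K_def algebra_simps)
    then show "size Mu = X' + Y'" using K0 by simp
  next
    fix Mu k
    assume a: "(\<forall>k\<in>#add_mset k Mu. k \<le> K) \<and> sum_mset (add_mset k Mu) \<le> K * X' \<and> K * size (add_mset k Mu) \<le> K * Y' + sum_mset (add_mset k Mu)"
    let ?C = "confs K (K * X') {..<K * X' + K * Y'} Mu"
    have C: "finite ?C" "?C \<noteq> {}" using a finite_confs confs_nonempty[OF K0, of Mu "K * X'" "K * Y'"] by auto
    have inner: "\<bar>avg (blocks K (K * X') ({..<K * X' + K * Y'} - \<Union>P) k) (\<lambda>e. hbar (N1 + N2) r (insert e P)) - hbar (N1 + N2) r P\<bar> \<le> \<bar>hi\<bar> + cap"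
      if P: "P \<in> ?C" for P
    proof -
      let ?B = "blocks K (K * X') ({..<K * X' + K * Y'} - \<Union>P) k"
      have fB: "finite ?B" by (intro finite_blocks) auto
      have "card ?B > 0" using card_free_blocks(3)[OF P, of k] a by auto
      then have neB: "?B \<noteq> {}" by auto
      have l: "\<bar>hbar (N1 + N2) r (insert e P) - hbar (N1 + N2) r P\<bar> \<le> \<bar>hi\<bar> + cap" if e: "e \<in> ?B" for e
      proof -
        have "e \<notin> P" using insert_block_confs(2)[OF _ K0 P e] by simp
        moreover have "e \<subseteq> {..<(N1 + N2) * r}" "card e = mK M" using e unfolding nr by (auto simp: blocks_def K_def)
        ultimately show ?thesis using hbar_lipschitz[OF val[OF P]] by blast
      qed
      have "avg ?B (\<lambda>e. hbar (N1 + N2) r (insert e P)) \<le> avg ?B (\<lambda>e. hbar (N1 + N2) r P + (\<bar>hi\<bar> + cap))"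
        by (rule avg_mono, drule l, linarith)
      moreover have "avg ?B (\<lambda>e. hbar (N1 + N2) r P - (\<bar>hi\<bar> + cap)) \<le> avg ?B (\<lambda>e. hbar (N1 + N2) r (insert e P))"
        by (rule avg_mono, drule l, linarith)
      ultimately show ?thesis by (simp add: avg_const[OF fB neB])
    qed
    have r1: "f (add_mset k Mu) = avg ?C (\<lambda>P. avg (blocks K (K * X') ({..<K * X' + K * Y'} - \<Union>P) k) (\<lambda>e. hbar (N1 + N2) r (insert e P)))"
      using a by (intro rec) auto
    have "f (add_mset k Mu) \<le> avg ?C (\<lambda>P. hbar (N1 + N2) r P + (\<bar>hi\<bar> + cap))"
      unfolding r1 by (rule avg_mono, drule inner, linarith)
    moreover have "avg ?C (\<lambda>P. hbar (N1 + N2) r P - (\<bar>hi\<bar> + cap)) \<le> f (add_mset k Mu)"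
      unfolding r1 by (rule avg_mono, drule inner, linarith)
    ultimately show "\<bar>f (add_mset k Mu) - f Mu\<bar> \<le> \<bar>hi\<bar> + cap"
      unfolding avg_add avg_diff avg_const[OF C] f_def by linarith
  next
    fix Mu k
    assume a: "(\<forall>k\<in>#Mu. k \<le> K) \<and> sum_mset Mu \<le> K * X' \<and> K * size Mu \<le> K * Y' + sum_mset Mu"
      and k: "k \<le> K" and i1: "sum_mset Mu + K \<le> K * X'" and i2: "K * size Mu + K \<le> K * Y' + sum_mset Mu"
    let ?C = "confs K (K * X') {..<K * X' + K * Y'} Mu"
    let ?A = "\<lambda>j P. avg (blocks K (K * X') ({..<K * X' + K * Y'} - \<Union>P) j) (\<lambda>e. hbar (N1 + N2) r (insert e P))"
    have C: "finite ?C" "?C \<noteq> {}" using a finite_confs confs_nonempty[OF K0, of Mu "K * X'" "K * Y'"] by auto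
    define p where "p = real k / real K"
    define \<epsilon> where "\<epsilon> = cap * (real K)\<^sup>2 * (1 / (real (K * X') - real (sum_mset Mu)) + 1 / (real (K * Y') + real (sum_mset Mu) - real K * real (size Mu)))"
    have "avg ?C (?A k) \<ge> avg ?C (\<lambda>P. p * ?A K P + (1 - p) * ?A 0 P - \<epsilon>)"
    proof (rule avg_mono)
      fix P assume P: "P \<in> ?C"
      let ?U = "{..<(N1 + N2) * r} - \<Union>P"
      have cx: "card (?U \<inter> {..<K * X'}) = K * X' - sum_mset Mu" and cy: "card (?U - {..<K * X'}) = K * Y' + sum_mset Mu - K * size Mu"
        unfolding nr using card_free_blocks(1,2)[OF P k] by auto
      have rx: "real (K * X' - sum_mset Mu) = real (K * X') - real (sum_mset Mu)" using i1 by (intro of_nat_diff) simp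
      have ry: "real (K * Y' + sum_mset Mu - K * size Mu) = real (K * Y') + real (sum_mset Mu) - real K * real (size Mu)"
        using i2 by (subst of_nat_diff) (simp, simp only: of_nat_add of_nat_mult)
      have "K \<le> card (?U \<inter> {..<K * X'})" "K \<le> card (?U - {..<K * X'})" unfolding cx cy using i1 i2 by auto
      from avg_hbar_convex[OF val[OF P] k[unfolded K_def] this[unfolded K_def]]
      show "p * ?A K P + (1 - p) * ?A 0 P - \<epsilon> \<le> ?A k P"
        unfolding K_def[symmetric] cx cy rx ry p_def \<epsilon>_def unfolding nr by simp
    qed
    moreover have "f (add_mset j Mu) = avg ?C (?A j)" if "j \<le> K" for j using that i1 i2 by (intro rec) auto
    moreover have "avg ?C (\<lambda>P. p * ?A K P + (1 - p) * ?A 0 P - \<epsilon>) = p * avg ?C (?A K) + (1 - p) * avg ?C (?A 0) - \<epsilon>"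
      by (simp only: avg_add avg_diff avg_cmult avg_const[OF C])
    ultimately show "real k / real K * f (add_mset K Mu) + (1 - real k / real K) * f (add_mset 0 Mu)
         - cap * (real K)\<^sup>2 * (1 / (real (K * X') - real (sum_mset Mu)) + 1 / (real (K * Y') + real (sum_mset Mu) - real K * real (size Mu)))
        \<le> f (add_mset k Mu)"
      using k unfolding p_def[symmetric] \<epsilon>_def[symmetric] by simp
  qed
  then show ?thesis unfolding typed_mean_def f_def K_def[symmetric] X Y using K0 by simp
qed

end

section \<open>From typed configurations to the random hypergraph\<close>

definition shift_block :: "nat \<Rightarrow> nat set \<Rightarrow> nat set" where
  "shift_block c B = (\<lambda>p. p + c) ` B"

lemma inj_shift_block: "inj (shift_block c)"
  unfolding shift_block_def inj_def by (metis inj_image_eq_iff inj_def add_right_cancel)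

lemma card_shift_block [simp]: "card (shift_block c B) = card B"
  unfolding shift_block_def by (intro card_image) auto

text \<open>Translation keeps the order of the points, so the potential of a shifted block reads the
  owners in the same order.\<close>

lemma sorted_list_of_set_shift:
  assumes "finite B"
  shows "sorted_list_of_set (shift_block c B) = map (\<lambda>p. p + c) (sorted_list_of_set B)"
  unfolding shift_block_def
  by (rule sorted_distinct_set_unique)
    (use assms in \<open>auto simp: sorted_map distinct_map intro: sorted_wrt_mono_rel[of _ "(\<le>)"]\<close>)

lemma block_edge_shift:
  assumes "finite B" "r > 0"
  shows "block_edge r (shift_block (c * r) B) = map (\<lambda>u. u + c) (block_edge r B)"
  using assms by (simp add: block_edge_def sorted_list_of_set_shift)

lemma avg_product:
  assumes "finite A" "A \<noteq> {}" "finite B" "B \<noteq> {}"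
  shows "avg (A \<times> B) (\<lambda>(a, b). g a + h b) = avg A g + avg B h"
proof -
  have "(\<Sum>(a, b)\<in>A \<times> B. g a + h b) = (\<Sum>a\<in>A. \<Sum>b\<in>B. g a + h b)" by (simp add: sum.cartesian_product)
  also have "\<dots> = real (card B) * sum g A + real (card A) * sum h B"
    by (simp add: sum.distrib sum_distrib_left)
  finally show ?thesis using assms unfolding avg_def
    by (simp add: card_cartesian_product add_divide_distrib)
qed

lemma confs_partition_on:
  assumes "finite V" "K > 0" "P \<in> confs K X V Mu" "K * size Mu = card V"
  shows "partition_on V P"
proof -
  have "\<Union>P = V" using confs_cards[OF assms(1,3)] assms(1,4) by (intro card_subset_eq) auto
  moreover have "disjoint P" "{} \<notin> P" using assms(2,3) unfolding confs_def by auto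
  ultimately show ?thesis by (simp add: partition_on_def)
qed

lemma finite_block_partitions: "finite (block_partitions K n r)"
  unfolding block_partitions_def partition_on_def by (rule finite_subset[of _ "Pow (Pow {..<n * r})"]) auto

lemma block_partitions_nonempty:
  assumes "K > 0" "K dvd n * r"
  shows "block_partitions K n r \<noteq> {}"
proof -
  define m where "m = n * r div K"
  have m: "n * r = K * m" using assms by (simp add: m_def)
  have "confs K (n * r) {..<n * r + 0} (replicate_mset m K) \<noteq> {}"
    using assms m by (intro confs_nonempty) (auto simp: sum_mset_replicate_mset split: if_splits)
  then obtain P where P: "P \<in> confs K (n * r) {..<n * r} (replicate_mset m K)" by auto
  have "partition_on {..<n * r} P" using m by (intro confs_partition_on[OF _ assms(1) P]) auto
  then have "P \<in> block_partitions K n r" using P unfolding block_partitions_def confs_def by blast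
  then show ?thesis by blast
qed

lemma block_partitions_card:
  assumes "K > 0" "P \<in> block_partitions K n r"
  shows "finite P" "K * card P = n * r"
proof -
  have P: "\<Union>P = {..<n * r}" "disjoint P" "\<forall>B\<in>P. card B = K"
    using assms(2) by (auto simp: block_partitions_def partition_on_def)
  show fP: "finite P" using P(1) by (metis finite_UnionD finite_lessThan)
  have "K * card P = card (\<Union>P)"
    using P fP by (intro card_partition) (auto simp: disjoint_def)
  then show "K * card P = n * r" using P(1) by simp
qed

text \<open>With the types \<open>K\<close> and 0 only, a block lies inside the first part or misses
  it, so a configuration is a pair of partitions, the second one shifted. As a bijection this
  carries the product of the uniform laws to the uniform law.\<close>

lemma split_confs_bij:
  assumes K: "K > 0" and X: "N1 * r = K * X'" and Y: "N2 * r = K * Y'"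
  shows "bij_betw (\<lambda>(P1, P2). P1 \<union> shift_block (N1 * r) ` P2)
     (block_partitions K N1 r \<times> block_partitions K N2 r)
     (confs K (N1 * r) {..<N1 * r + N2 * r} (replicate_mset X' K + replicate_mset Y' 0))"
proof -
  define A where "A = {..<N1 * r}"
  define V where "V = {..<N1 * r + N2 * r}"
  define sh where "sh = shift_block (N1 * r)"
  \<comment> \<open>Natural subtraction sends every point of \<open>A\<close> to 0, so
    \<open>sh\<close> undoes \<open>un\<close> only on blocks disjoint from
    \<open>A\<close>.\<close>
  define un where "un = (\<lambda>e. (\<lambda>p. p - N1 * r) ` e)"
  have un_sh: "un (sh e) = e" for e unfolding un_def sh_def shift_block_def by (auto simp: image_image)
  have sh_un: "sh (un e) = e" if "e \<inter> A = {}" for e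
  proof -
    have "sh (un e) = (\<lambda>p. p) ` e" unfolding un_def sh_def shift_block_def image_image
      using that by (intro image_cong) (auto simp: A_def not_less)
    then show ?thesis by simp
  qed
  have shA: "sh e \<inter> A = {}" for e by (auto simp: sh_def shift_block_def A_def)
  have shV: "sh e \<subseteq> V" if "e \<subseteq> {..<N2 * r}" for e using that by (auto simp: sh_def shift_block_def V_def)
  have bp: "\<Union>P = {..<n * r}" "disjoint P" "\<forall>B\<in>P. card B = K" "{} \<notin> P" if "P \<in> block_partitions K n r" for P n
    using that by (auto simp: block_partitions_def partition_on_def)
  show ?thesis
    unfolding sh_def[symmetric] V_def[symmetric]
  proof (rule bij_betw_byWitness[where f' = "\<lambda>P. ({e\<in>P. e \<subseteq> A}, un ` {e\<in>P. e \<inter> A = {}})"])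
    show "\<forall>a\<in>block_partitions K N1 r \<times> block_partitions K N2 r.
       (\<lambda>P. ({e\<in>P. e \<subseteq> A}, un ` {e\<in>P. e \<inter> A = {}})) ((\<lambda>(P1, P2). P1 \<union> sh ` P2) a) = a"
    proof
      fix a assume "a \<in> block_partitions K N1 r \<times> block_partitions K N2 r"
      then obtain P1 P2 where a: "a = (P1, P2)" and P: "P1 \<in> block_partitions K N1 r" "P2 \<in> block_partitions K N2 r" by blast
      have 1: "e \<subseteq> A" "e \<noteq> {}" if "e \<in> P1" for e using bp[OF P(1)] that by (auto simp: A_def)
      have 2: "sh e \<noteq> {}" if "e \<in> P2" for e using bp(4)[OF P(2)] that by (auto simp: sh_def shift_block_def)
      have "{e \<in> P1 \<union> sh ` P2. e \<subseteq> A} = P1" using 1 2 shA by blast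
      moreover have "{e \<in> P1 \<union> sh ` P2. e \<inter> A = {}} = sh ` P2" using 1 shA by blast
      moreover have "un ` sh ` P2 = P2" by (simp add: image_image un_sh)
      ultimately show "(\<lambda>P. ({e\<in>P. e \<subseteq> A}, un ` {e\<in>P. e \<inter> A = {}})) ((\<lambda>(P1, P2). P1 \<union> sh ` P2) a) = a"
        unfolding a by simp
    qed
  next
    have dich: "e \<subseteq> A \<or> e \<inter> A = {}"
      if P: "P \<in> confs K (N1 * r) V (replicate_mset X' K + replicate_mset Y' 0)" and e: "e \<in> P" for P e
    proof -
      have fP: "finite P" using P by (intro confs_finite) (auto simp: V_def)
      have im: "image_mset (\<lambda>e. card (e \<inter> A)) (mset_set P) = replicate_mset X' K + replicate_mset Y' 0" and ce: "card e = K" and eV: "e \<subseteq> V"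
        using P e unfolding confs_def A_def by auto
      have fe: "finite e" using eV finite_subset by (auto simp: V_def)
      have "card (e \<inter> A) \<in># image_mset (\<lambda>e. card (e \<inter> A)) (mset_set P)" using e fP by simp
      then have "card (e \<inter> A) = K \<or> card (e \<inter> A) = 0" unfolding im by (auto split: if_splits)
      then show ?thesis
      proof
        assume "card (e \<inter> A) = K"
        then have "e \<inter> A = e" using ce fe by (intro card_subset_eq) auto
        then show ?thesis by blast
      qed (use fe in simp)
    qed
    show "\<forall>P\<in>confs K (N1 * r) V (replicate_mset X' K + replicate_mset Y' 0).
       (\<lambda>(P1, P2). P1 \<union> sh ` P2) ({e\<in>P. e \<subseteq> A}, un ` {e\<in>P. e \<inter> A = {}}) = P"
    proof
      fix P assume P: "P \<in> confs K (N1 * r) V (replicate_mset X' K + replicate_mset Y' 0)"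
      have "sh ` un ` {e\<in>P. e \<inter> A = {}} = (\<lambda>e. e) ` {e\<in>P. e \<inter> A = {}}"
        unfolding image_image using sh_un by (intro image_cong) auto
      then show "(\<lambda>(P1, P2). P1 \<union> sh ` P2) ({e\<in>P. e \<subseteq> A}, un ` {e\<in>P. e \<inter> A = {}}) = P"
      proof -
        have "{e\<in>P. e \<subseteq> A} \<union> {e\<in>P. e \<inter> A = {}} = P" using dich[OF P] by blast
        then show ?thesis using \<open>sh ` un ` {e\<in>P. e \<inter> A = {}} = (\<lambda>e. e) ` {e\<in>P. e \<inter> A = {}}\<close> by simp
      qed
    qed
    show "(\<lambda>P. ({e\<in>P. e \<subseteq> A}, un ` {e\<in>P. e \<inter> A = {}})) ` confs K (N1 * r) V (replicate_mset X' K + replicate_mset Y' 0)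
       \<subseteq> block_partitions K N1 r \<times> block_partitions K N2 r"
    proof (rule image_subsetI)
      fix P assume P: "P \<in> confs K (N1 * r) V (replicate_mset X' K + replicate_mset Y' 0)"
      have "partition_on V P" using P K X Y by (intro confs_partition_on[OF _ K P]) (auto simp: V_def algebra_simps)
      then have part: "\<Union>P = V" "disjoint P" "{} \<notin> P" by (auto simp: partition_on_def)
      have cK: "\<forall>e\<in>P. card e = K" using P by (simp add: confs_def)
      have AV: "A \<subseteq> V" by (auto simp: A_def V_def)
      have U1: "\<Union>{e\<in>P. e \<subseteq> A} = A"
      proof (intro equalityI subsetI)
        fix p assume p: "p \<in> A"
        then obtain e where "e \<in> P" "p \<in> e" using part(1) AV by blast
        then show "p \<in> \<Union>{e\<in>P. e \<subseteq> A}" using dich[OF P] p by blast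
      qed blast
      have U2: "\<Union>(un ` {e\<in>P. e \<inter> A = {}}) = {..<N2 * r}"
      proof (intro equalityI subsetI)
        fix p assume "p \<in> \<Union>(un ` {e\<in>P. e \<inter> A = {}})"
        then obtain e q where e: "e \<in> P" "e \<inter> A = {}" "q \<in> e" "p = q - N1 * r" by (auto simp: un_def)
        then have "q \<in> V" "q \<notin> A" using part(1) by auto
        then show "p \<in> {..<N2 * r}" using e(4) by (auto simp: V_def A_def)
      next
        fix p assume p: "p \<in> {..<N2 * r}"
        then have "p + N1 * r \<in> V" "p + N1 * r \<notin> A" by (auto simp: V_def A_def)
        then obtain e where e: "e \<in> P" "p + N1 * r \<in> e" using part(1) by blast
        then have "e \<inter> A = {}" using dich[OF P] \<open>p + N1 * r \<notin> A\<close> by blast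
        moreover have "p \<in> un e" unfolding un_def using e(2) by force
        ultimately show "p \<in> \<Union>(un ` {e\<in>P. e \<inter> A = {}})" using e(1) by blast
      qed
      have D1: "disjoint {e\<in>P. e \<subseteq> A}" using part(2) by (simp add: disjoint_def)
      have D2: "disjoint (un ` {e\<in>P. e \<inter> A = {}})"
      proof (rule disjointI)
        fix a b assume "a \<in> un ` {e\<in>P. e \<inter> A = {}}" "b \<in> un ` {e\<in>P. e \<inter> A = {}}" "a \<noteq> b"
        then obtain e e' where ee: "e \<in> P" "e \<inter> A = {}" "a = un e" "e' \<in> P" "e' \<inter> A = {}" "b = un e'" by blast
        have "e \<noteq> e'" using ee \<open>a \<noteq> b\<close> by blast
        then have "e \<inter> e' = {}" using ee(1,4) part(2) by (simp add: disjoint_def)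
        then have "sh a \<inter> sh b = {}" using ee sh_un by simp
        then show "a \<inter> b = {}" by (auto simp: sh_def shift_block_def)
      qed
      have c2: "card (un e) = K" if "e \<in> P" "e \<inter> A = {}" for e
        using cK that sh_un[of e] card_shift_block[of "N1 * r" "un e"] unfolding sh_def by simp
      have "{} \<notin> un ` {e\<in>P. e \<inter> A = {}}" using part(3) by (auto simp: un_def)
      then have "un ` {e\<in>P. e \<inter> A = {}} \<in> block_partitions K N2 r"
        using U2 D2 c2 by (auto simp: block_partitions_def partition_on_def)
      moreover have "{e\<in>P. e \<subseteq> A} \<in> block_partitions K N1 r"
        using U1 D1 cK part(3) unfolding block_partitions_def partition_on_def A_def by blast
      ultimately show "({e\<in>P. e \<subseteq> A}, un ` {e\<in>P. e \<inter> A = {}}) \<in> block_partitions K N1 r \<times> block_partitions K N2 r" by blast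
    qed
    show "(\<lambda>(P1, P2). P1 \<union> sh ` P2) ` (block_partitions K N1 r \<times> block_partitions K N2 r)
       \<subseteq> confs K (N1 * r) V (replicate_mset X' K + replicate_mset Y' 0)"
    proof (rule image_subsetI)
      fix a assume "a \<in> block_partitions K N1 r \<times> block_partitions K N2 r"
      then obtain P1 P2 where a: "a = (P1, P2)" and P: "P1 \<in> block_partitions K N1 r" "P2 \<in> block_partitions K N2 r" by blast
      have c1: "finite P1" "card P1 = X'" using block_partitions_card[OF K P(1)] X K by auto
      have c2: "finite P2" "card P2 = Y'" using block_partitions_card[OF K P(2)] Y K by auto
      have P1A: "e \<subseteq> A" if "e \<in> P1" for e using bp(1)[OF P(1)] that by (auto simp: A_def)
      have P2V: "e \<subseteq> {..<N2 * r}" if "e \<in> P2" for e using bp(1)[OF P(2)] that by auto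
      have AV: "A \<subseteq> V" by (auto simp: A_def V_def)
      have sub: "P1 \<union> sh ` P2 \<subseteq> Pow V" using P1A AV shV P2V by blast
      have shne: "sh e \<noteq> {}" if "e \<in> P2" for e using bp(4)[OF P(2)] that by (auto simp: sh_def shift_block_def)
      have disj12: "P1 \<inter> sh ` P2 = {}" using P1A shA shne by blast
      have dis: "disjoint (P1 \<union> sh ` P2)"
      proof (rule disjointI)
        fix a b assume ab: "a \<in> P1 \<union> sh ` P2" "b \<in> P1 \<union> sh ` P2" "a \<noteq> b"
        consider "a \<in> P1" "b \<in> P1" | "a \<in> P1" "b \<in> sh ` P2" | "a \<in> sh ` P2" "b \<in> P1" | "a \<in> sh ` P2" "b \<in> sh ` P2"
          using ab by blast
        then show "a \<inter> b = {}"
        proof cases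
          case 1
          then show ?thesis using bp(2)[OF P(1)] ab(3) by (simp add: disjoint_def)
        next
          case 2
          then show ?thesis using P1A[of a] shA by blast
        next
          case 3
          then show ?thesis using P1A[of b] shA by blast
        next
          case 4
          then obtain e e' where ee: "e \<in> P2" "e' \<in> P2" "a = sh e" "b = sh e'" by blast
          then have "e \<noteq> e'" using ab(3) by blast
          then have "e \<inter> e' = {}" using ee(1,2) bp(2)[OF P(2)] by (simp add: disjoint_def)
          then show ?thesis using ee by (auto simp: sh_def shift_block_def)
        qed
      qed
      have crd: "\<forall>e\<in>P1 \<union> sh ` P2. card e = K" using bp(3)[OF P(1)] bp(3)[OF P(2)] by (auto simp: sh_def)
      have "card (sh ` P2) = Y'" using c2 inj_shift_block by (metis card_image inj_on_subset subset_UNIV sh_def)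
      moreover have "image_mset (\<lambda>e. card (e \<inter> A)) (mset_set P1) = image_mset (\<lambda>_. K) (mset_set P1)"
      proof (rule image_mset_cong)
        fix e assume "e \<in># mset_set P1"
        then have "e \<in> P1" using c1 by simp
        then show "card (e \<inter> A) = K" using P1A[of e] bp(3)[OF P(1)] by (simp add: Int_absorb2)
      qed
      moreover have "image_mset (\<lambda>e. card (e \<inter> A)) (mset_set (sh ` P2)) = image_mset (\<lambda>_. 0) (mset_set (sh ` P2))"
      proof (rule image_mset_cong)
        fix e assume "e \<in># mset_set (sh ` P2)"
        then have "e \<in> sh ` P2" using c2 by simp
        then have "e \<inter> A = {}" using shA by blast
        then show "card (e \<inter> A) = 0" by simp
      qed
      ultimately have "image_mset (\<lambda>e. card (e \<inter> A)) (mset_set (P1 \<union> sh ` P2)) = replicate_mset X' K + replicate_mset Y' 0"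
        using c1 c2 disj12 by (simp add: mset_set_Union image_mset_const_eq)
      then have "P1 \<union> sh ` P2 \<in> confs K (N1 * r) V (replicate_mset X' K + replicate_mset Y' 0)"
        using sub dis crd unfolding confs_def A_def by blast
      then show "(\<lambda>(P1, P2). P1 \<union> sh ` P2) a \<in> confs K (N1 * r) V (replicate_mset X' K + replicate_mset Y' 0)"
        unfolding a by simp
    qed
  qed
qed

context interaction_model
begin

section \<open>Averaging over types, and gluing two graphs\<close>

lemma K0: "mK M > 0" using K2 by simp

lemma block_partitions_valid: "P \<in> block_partitions (mK M) n r \<Longrightarrow> valid n r P"
  by (auto simp: block_partitions_def partition_on_def valid_def)

lemma EH_eq_avg:
  assumes "mK M dvd n * r"
  shows "EH M n r = avg (block_partitions (mK M) n r) (hbar n r)"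
proof -
  let ?BP = "block_partitions (mK M) n r"
  have fin: "finite (set_pmf (rand_pot P))" if "P \<in> ?BP" for P
    using that by (intro finite_rand_pot block_partitions_card(1)[OF K0])
  have rg: "rand_graph M n r = pmf_of_set ?BP \<bind> (\<lambda>P. map_pmf (\<lambda>th. (P, th)) (rand_pot P))"
    by (simp add: rand_graph_def map_pmf_def)
  have "EH M n r = (\<Sum>P\<in>?BP. measure_pmf.expectation (map_pmf (\<lambda>th. (P, th)) (rand_pot P)) (\<lambda>(P, th). real_of_ereal (HG M n r P th)) /\<^sub>R real (card ?BP))"
    unfolding EH_def rg using fin block_partitions_nonempty[OF K0 assms] finite_block_partitions
    by (intro pmf_expectation_bind_pmf_of_set) auto
  also have "\<dots> = avg ?BP (hbar n r)"
    unfolding avg_def hbar_def hr_def[abs_def] by (simp add: divide_inverse_commute sum_distrib_left)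
  finally show ?thesis .
qed

text \<open>Total expectation without the probabilities of the types: the fibres of the type map on
  full partitions are the sets \<open>confs\<close>, and a common lower bound on the fibre averages
  bounds the overall average.\<close>

lemma EH_ge_typed_mean:
  assumes d: "mK M dvd N1 * r" "mK M dvd N2 * r"
    and m: "\<And>Mu. \<forall>k\<in>#Mu. k \<le> mK M \<Longrightarrow> sum_mset Mu = N1 * r \<Longrightarrow> mK M * size Mu = N1 * r + N2 * r \<Longrightarrow> m \<le> typed_mean N1 N2 r Mu"
  shows "m \<le> EH M (N1 + N2) r"
proof -
  define K where "K = mK M"
  define X where "X = N1 * r"
  define V where "V = {..<N1 * r + N2 * r}"
  let ?BP = "block_partitions K (N1 + N2) r"
  define ty where "ty P = image_mset (\<lambda>e. card (e \<inter> {..<X})) (mset_set P)" for P :: "nat set set"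
  have K: "K > 0" using K0 by (simp add: K_def)
  have Veq: "{..<(N1 + N2) * r} = V" by (simp add: V_def algebra_simps)
  have dv: "K dvd (N1 + N2) * r" using d by (simp add: K_def algebra_simps)
  have ne: "?BP \<noteq> {}" using block_partitions_nonempty[OF K dv] .
  have ge: "m * real (card {P\<in>?BP. ty P = Mu}) \<le> (\<Sum>P\<in>{P\<in>?BP. ty P = Mu}. hbar (N1 + N2) r P)" if Mu: "Mu \<in> ty ` ?BP" for Mu
  proof -
    obtain P where P: "P \<in> ?BP" "Mu = ty P" using Mu by blast
    have Pp: "\<Union>P = V" "disjoint P" "\<forall>e\<in>P. card e = K" using P(1) by (auto simp: block_partitions_def partition_on_def Veq)
    note cP = block_partitions_card[OF K P(1)]
    have Pc: "P \<in> confs K X V Mu" using Pp P(2) unfolding confs_def ty_def by blast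
    have fV: "finite V" by (simp add: V_def)
    have sz: "K * size Mu = N1 * r + N2 * r" using cP P(2) by (simp add: ty_def algebra_simps)
    have "V \<inter> {..<X} = {..<X}" by (auto simp: V_def X_def)
    then have sm: "sum_mset Mu = N1 * r" using confs_cards(2)[OF fV Pc] Pp(1) by (simp add: X_def)
    have bd: "\<forall>k\<in>#Mu. k \<le> K"
    proof
      fix k assume "k \<in># Mu"
      then obtain e where e: "e \<in> P" "k = card (e \<inter> {..<X})" using P(2) cP(1) by (auto simp: ty_def)
      then have "finite e" using Pp(3) K by (metis card.infinite less_numeral_extra(3))
      then have "k \<le> card e" unfolding e(2) by (intro card_mono) auto
      then show "k \<le> K" using Pp(3) e(1) by simp
    qed
    have eq: "{P\<in>?BP. ty P = Mu} = confs K X V Mu"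
    proof (intro equalityI subsetI)
      fix Q assume "Q \<in> {P\<in>?BP. ty P = Mu}"
      then show "Q \<in> confs K X V Mu" unfolding confs_def ty_def block_partitions_def partition_on_def Veq by blast
    next
      fix Q assume Q: "Q \<in> confs K X V Mu"
      have "partition_on V Q" using confs_partition_on[OF fV K Q] sz by (simp add: V_def)
      then show "Q \<in> {P\<in>?BP. ty P = Mu}" using Q unfolding confs_def ty_def block_partitions_def Veq by blast
    qed
    have "m \<le> avg (confs K X V Mu) (hbar (N1 + N2) r)"
      using m[of Mu] bd sm sz unfolding typed_mean_def K_def X_def V_def by blast
    moreover have "card (confs K X V Mu) > 0" using Pc finite_confs[OF fV] by (auto simp: card_gt_0_iff)
    ultimately show ?thesis unfolding eq avg_def by (simp add: le_divide_eq)
  qed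
  have "m * real (card ?BP) = (\<Sum>P\<in>?BP. m)" by simp
  also have "\<dots> = (\<Sum>Mu\<in>ty ` ?BP. \<Sum>P\<in>{P\<in>?BP. ty P = Mu}. m)"
    using finite_block_partitions by (intro sum.image_gen)
  also have "\<dots> \<le> (\<Sum>Mu\<in>ty ` ?BP. \<Sum>P\<in>{P\<in>?BP. ty P = Mu}. hbar (N1 + N2) r P)"
  proof (rule sum_mono)
    fix Mu assume "Mu \<in> ty ` ?BP"
    then show "(\<Sum>P\<in>{P\<in>?BP. ty P = Mu}. m) \<le> (\<Sum>P\<in>{P\<in>?BP. ty P = Mu}. hbar (N1 + N2) r P)"
      using ge[of Mu] by (simp add: mult.commute)
  qed
  also have "\<dots> = (\<Sum>P\<in>?BP. hbar (N1 + N2) r P)"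
    using finite_block_partitions by (intro sum.image_gen[symmetric])
  finally have "m \<le> avg ?BP (hbar (N1 + N2) r)"
    using ne finite_block_partitions unfolding avg_def by (subst le_divide_eq) (auto simp: card_gt_0_iff)
  then show ?thesis using EH_eq_avg dv by (simp add: K_def)
qed

text \<open>Optimal assignments of the two parts are glued along disjoint sets of nodes; for r > 0,
  shifting points by N1 * r shifts their owners by N1. One family \<open>th\<close> drives both
  parts, so both sides live on one probability space.\<close>

lemma hr_superadditive:
  assumes r: "r > 0" and v1: "valid N1 r P1" and v2: "valid N2 r P2"
    and th: "th \<in> potentials (P1 \<union> shift_block (N1 * r) ` P2)"
  shows "hr N1 r P1 th + hr N2 r P2 (th \<circ> shift_block (N1 * r)) \<le> hr (N1 + N2) r (P1 \<union> shift_block (N1 * r) ` P2) th"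
    and "valid (N1 + N2) r (P1 \<union> shift_block (N1 * r) ` P2)" and "P1 \<inter> shift_block (N1 * r) ` P2 = {}"
proof -
  let ?sh = "shift_block (N1 * r)"
  let ?P = "P1 \<union> ?sh ` P2"
  have B2: "B \<subseteq> {..<N2 * r}" "card B = mK M" "finite B" if "B \<in> P2" for B
    using v2 that finite_subset by (auto simp: valid_def)
  have B1: "B \<subseteq> {..<N1 * r}" "card B = mK M" "finite B" if "B \<in> P1" for B
    using v1 that finite_subset by (auto simp: valid_def)
  have shle: "?sh B \<subseteq> {..<(N1 + N2) * r}" if "B \<in> P2" for B
    using B2(1)[OF that] by (auto simp: shift_block_def algebra_simps)
  have le1: "{..<N1 * r} \<subseteq> {..<(N1 + N2) * r}" by (auto simp: algebra_simps)
  show vP: "valid (N1 + N2) r ?P" unfolding valid_def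
  proof (intro conjI)
    show "?P \<subseteq> Pow {..<(N1 + N2) * r}"
    proof (intro Un_least image_subsetI)
      show "P1 \<subseteq> Pow {..<(N1 + N2) * r}" using subset_trans[OF B1(1) le1] by blast
    qed (use shle in blast)
    show "\<forall>B\<in>?P. card B = mK M" using B1(2) B2(2) by auto
  qed
  show dj: "P1 \<inter> ?sh ` P2 = {}"
  proof (rule equals0I)
    fix e assume "e \<in> P1 \<inter> ?sh ` P2"
    then obtain B where B: "B \<in> P2" "e = ?sh B" "e \<in> P1" by blast
    have "B \<noteq> {}" using B2(2)[OF B(1)] K0 by auto
    then obtain p where "p \<in> B" by blast
    then have "p + N1 * r \<in> e" using B(2) by (auto simp: shift_block_def)
    then show False using B1(1)[OF B(3)] by auto
  qed
  have th1: "th \<in> potentials P1" and th2: "th \<circ> ?sh \<in> potentials P2" using th by (auto simp: potentials_def)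
  obtain x1 where x1: "x1 \<in> asg N1" "HG M N1 r P1 th = Hx M N1 r P1 th x1" using HG_attained by blast
  obtain x2 where x2: "x2 \<in> asg N2" "HG M N2 r P2 (th \<circ> ?sh) = Hx M N2 r P2 (th \<circ> ?sh) x2" using HG_attained by blast
  define x where "x i = (if i < N1 then x1 i else if i < N1 + N2 then x2 (i - N1) else undefined)" for i
  have x: "x \<in> asg (N1 + N2)" using x1(1) x2(1) by (auto simp: x_def PiE_def Pi_def extensional_def)
  have nodes: "(\<Sum>i<N1 + N2. hnode M (x i)) = (\<Sum>i<N1. hnode M (x1 i)) + (\<Sum>i<N2. hnode M (x2 i))"
  proof -
    have "(\<Sum>i<N1 + N2. hnode M (x i)) = (\<Sum>i<N1. hnode M (x i)) + (\<Sum>i<N2. hnode M (x (N1 + i)))"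
      by (induction N2) (auto simp: add.assoc)
    also have "(\<Sum>i<N1. hnode M (x i)) = (\<Sum>i<N1. hnode M (x1 i))" by (intro sum.cong) (auto simp: x_def)
    also have "(\<Sum>i<N2. hnode M (x (N1 + i))) = (\<Sum>i<N2. hnode M (x2 i))" by (intro sum.cong) (auto simp: x_def)
    finally show ?thesis .
  qed
  have e1: "(\<Sum>B\<in>P1. th B (map x (block_edge r B))) = (\<Sum>B\<in>P1. th B (map x1 (block_edge r B)))"
  proof (rule sum.cong[OF refl])
    fix B assume "B \<in> P1"
    then have "set (block_edge r B) \<subseteq> {..<N1}" using block_edge_props(3) B1 by blast
    then have "map x (block_edge r B) = map x1 (block_edge r B)" by (intro map_cong) (auto simp: x_def)
    then show "th B (map x (block_edge r B)) = th B (map x1 (block_edge r B))" by (rule arg_cong)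
  qed
  have "(\<Sum>B\<in>?sh ` P2. th B (map x (block_edge r B))) = (\<Sum>B\<in>P2. th (?sh B) (map x (block_edge r (?sh B))))"
    using inj_shift_block by (intro sum.reindex_cong[of ?sh]) (auto intro: inj_on_subset)
  also have "\<dots> = (\<Sum>B\<in>P2. (th \<circ> ?sh) B (map x2 (block_edge r B)))"
  proof (rule sum.cong[OF refl])
    fix B assume B: "B \<in> P2"
    then have s: "set (block_edge r B) \<subseteq> {..<N2}" using block_edge_props(3) B2 by blast
    have "map x (block_edge r (?sh B)) = map (\<lambda>u. x (u + N1)) (block_edge r B)"
      using block_edge_shift[OF B2(3)[OF B] r] by (simp add: comp_def)
    also have "\<dots> = map x2 (block_edge r B)" using s by (intro map_cong) (auto simp: x_def)
    finally show "th (?sh B) (map x (block_edge r (?sh B))) = (th \<circ> ?sh) B (map x2 (block_edge r B))" by (simp only: comp_apply)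
  qed
  finally have e2: "(\<Sum>B\<in>?sh ` P2. th B (map x (block_edge r B))) = (\<Sum>B\<in>P2. (th \<circ> ?sh) B (map x2 (block_edge r B)))" .
  have "Hx M (N1 + N2) r ?P th x = Hx M N1 r P1 th x1 + Hx M N2 r P2 (th \<circ> ?sh) x2"
    unfolding Hx_def nodes using valid_finite[OF v1] valid_finite[OF v2] dj
    by (simp add: sum.union_disjoint e1 e2 ac_simps flip: plus_ereal.simps)
  then have "ereal (hr N1 r P1 th + hr N2 r P2 (th \<circ> ?sh)) = Hx M (N1 + N2) r ?P th x"
    using x1(2) x2(2) ereal_hr[OF v1 th1] ereal_hr[OF v2 th2] by (metis plus_ereal.simps(1))
  also have "\<dots> \<le> HG M (N1 + N2) r ?P th" using HG_le_iff x by blast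
  finally show "hr N1 r P1 th + hr N2 r P2 (th \<circ> ?sh) \<le> hr (N1 + N2) r ?P th"
    using ereal_hr[OF vP th] by simp
qed

lemma hr_cong:
  assumes "\<And>B. B \<in> P \<Longrightarrow> th B = th' B"
  shows "hr n r P th = hr n r P th'"
proof -
  have "Hx M n r P th = Hx M n r P th'" unfolding Hx_def using assms by (auto intro!: ext cong: sum.cong)
  then show ?thesis by (simp add: hr_def HG_def)
qed

text \<open>\<open>hr\<close> ignores the potentials of blocks outside \<open>P\<close>, and these
  are independent of the others, so drawing them as well does not change the mean.\<close>

lemma hbar_subset:
  assumes "finite Q" "P \<subseteq> Q"
  shows "hbar n r P = measure_pmf.expectation (rand_pot Q) (hr n r P)"
proof -
  have "hbar n r P = measure_pmf.expectation (rand_pot Q) (\<lambda>th. hr n r P (\<lambda>B. if B \<in> P then th B else (\<lambda>_. 0)))"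
    unfolding hbar_def by (subst Pi_pmf_subset[OF assms]) simp
  also have "(\<lambda>th. hr n r P (\<lambda>B. if B \<in> P then th B else (\<lambda>_. 0))) = hr n r P"
    by (intro ext hr_cong) auto
  finally show ?thesis .
qed

text \<open>All means are written over the potentials of the union, by restriction for
  \<open>P1\<close> and by relabelling along the injective shift for \<open>P2\<close>; then the
  pointwise inequality is integrated.\<close>

lemma hbar_superadditive:
  assumes r: "r > 0" and v1: "valid N1 r P1" and v2: "valid N2 r P2"
  shows "hbar N1 r P1 + hbar N2 r P2 \<le> hbar (N1 + N2) r (P1 \<union> shift_block (N1 * r) ` P2)"
proof -
  let ?sh = "shift_block (N1 * r)"
  let ?P = "P1 \<union> ?sh ` P2"
  have fP: "finite P1" "finite P2" "finite ?P" using valid_finite v1 v2 by auto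
  let ?Q = "rand_pot ?P"
  note fQ = finite_rand_pot[OF fP(3)]
  have int: "integrable (measure_pmf ?Q) f" for f :: "_ \<Rightarrow> real" using fQ by (rule integrable_measure_pmf_finite)
  have h1: "hbar N1 r P1 = measure_pmf.expectation ?Q (hr N1 r P1)" using fP by (intro hbar_subset) auto
  have "rand_pot P2 = map_pmf (\<lambda>g. g \<circ> ?sh) (rand_pot (?sh ` P2))"
    using fP inj_shift_block[of "N1 * r"]
    by (intro Pi_pmf_bij_betw) (auto simp: bij_betw_def inj_on_def inj_def)
  then have "hbar N2 r P2 = measure_pmf.expectation (rand_pot (?sh ` P2)) (\<lambda>g. hr N2 r P2 (g \<circ> ?sh))"
    unfolding hbar_def by simp
  also have "rand_pot (?sh ` P2) = map_pmf (\<lambda>f x. if x \<in> ?sh ` P2 then f x else (\<lambda>_. 0)) ?Q"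
    using fP(3) by (intro Pi_pmf_subset) auto
  also have "measure_pmf.expectation (map_pmf (\<lambda>f x. if x \<in> ?sh ` P2 then f x else (\<lambda>_. 0)) ?Q) (\<lambda>g. hr N2 r P2 (g \<circ> ?sh))
      = measure_pmf.expectation ?Q (\<lambda>f. hr N2 r P2 ((\<lambda>x. if x \<in> ?sh ` P2 then f x else (\<lambda>_. 0)) \<circ> ?sh))" by simp
  also have "(\<lambda>f. hr N2 r P2 ((\<lambda>x. if x \<in> ?sh ` P2 then f x else (\<lambda>_. 0)) \<circ> ?sh)) = (\<lambda>f. hr N2 r P2 (f \<circ> ?sh))"
    by (intro ext hr_cong) auto
  finally have h2: "hbar N2 r P2 = measure_pmf.expectation ?Q (\<lambda>f. hr N2 r P2 (f \<circ> ?sh))" .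
  have "hbar N1 r P1 + hbar N2 r P2 = measure_pmf.expectation ?Q (\<lambda>th. hr N1 r P1 th + hr N2 r P2 (th \<circ> ?sh))"
    unfolding h1 h2 using int by (intro Bochner_Integration.integral_add[symmetric])
  also have "\<dots> \<le> measure_pmf.expectation ?Q (hr (N1 + N2) r ?P)"
    using hr_superadditive(1)[OF r v1 v2] rand_pot_potentials[OF fP(3)] int
    by (intro integral_mono_AE) (auto simp: AE_measure_pmf_iff)
  finally show ?thesis by (simp add: hbar_def)
qed

lemma typed_mean_pure_ge:
  assumes r: "r > 0" and d: "mK M dvd N1 * r" "mK M dvd N2 * r"
  shows "EH M N1 r + EH M N2 r \<le> typed_mean N1 N2 r (replicate_mset (N1 * r div mK M) (mK M) + replicate_mset (N2 * r div mK M) 0)"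
proof -
  let ?A = "block_partitions (mK M) N1 r" and ?B = "block_partitions (mK M) N2 r"
  let ?u = "\<lambda>(P1, P2). P1 \<union> shift_block (N1 * r) ` P2"
  let ?C = "confs (mK M) (N1 * r) {..<N1 * r + N2 * r} (replicate_mset (N1 * r div mK M) (mK M) + replicate_mset (N2 * r div mK M) 0)"
  have bij: "bij_betw ?u (?A \<times> ?B) ?C" using d by (intro split_confs_bij[OF K0]) auto
  have "EH M N1 r + EH M N2 r = avg (?A \<times> ?B) (\<lambda>(a, b). hbar N1 r a + hbar N2 r b)"
    using EH_eq_avg d block_partitions_nonempty[OF K0] finite_block_partitions by (simp add: avg_product)
  also have "\<dots> \<le> avg (?A \<times> ?B) (\<lambda>s. hbar (N1 + N2) r (?u s))"
    using hbar_superadditive[OF r] block_partitions_valid by (intro avg_mono) auto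
  also have "\<dots> = avg ?C (hbar (N1 + N2) r)"
    unfolding avg_def using bij_betw_same_card[OF bij] sum.reindex_bij_betw[OF bij, of "hbar (N1 + N2) r"] by simp
  finally show ?thesis by (simp add: typed_mean_def)
qed

theorem EH_near_superadditive:
  assumes r: "r > 0"
  shows "\<exists>C::real. \<forall>N1 N2::nat. mK M dvd N1 * r \<longrightarrow> mK M dvd N2 * r \<longrightarrow>
           EH M (N1 + N2) r \<ge> EH M N1 r + EH M N2 r - C * real (N1 + N2) powr (5/6)"
proof -
  define C where "C = 24 * (\<bar>hi\<bar> + cap) * mK M + 2 * (\<bar>hi\<bar> + cap) * ((real (mK M))\<^sup>2 + 1) + 2 * (cap * (real (mK M))\<^sup>2)"
  have "EH M N1 r + EH M N2 r - (C * real r powr (5/6)) * real (N1 + N2) powr (5/6) \<le> EH M (N1 + N2) r"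
    if d: "mK M dvd N1 * r" "mK M dvd N2 * r" for N1 N2
  proof (rule EH_ge_typed_mean[OF d])
    fix Mu :: "nat multiset"
    assume Mu: "\<forall>k\<in>#Mu. k \<le> mK M" "sum_mset Mu = N1 * r" "mK M * size Mu = N1 * r + N2 * r"
    \<comment> \<open>The interpolation counts points and the claim counts nodes; the factor r^(5/6)
      goes into the constant.\<close>
    have "real (N1 * r + N2 * r) powr (5/6) = real r powr (5/6) * real (N1 + N2) powr (5/6)"
      by (subst powr_mult[symmetric]) (auto simp: algebra_simps)
    then show "EH M N1 r + EH M N2 r - (C * real r powr (5/6)) * real (N1 + N2) powr (5/6) \<le> typed_mean N1 N2 r Mu"
      using typed_mean_interpolation[OF d Mu] typed_mean_pure_ge[OF r d] unfolding C_def[symmetric] by (simp add: mult.assoc)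
  qed
  then show ?thesis by blast
qed

end

section \<open>The six models\<close>

text \<open>If a violated block costs exactly \<open>cap\<close>, the old assignment can be
  kept.\<close>

lemma exchange_trivial:
  fixes lo :: ereal
  assumes "lo = ereal (hi - cap)" "0 \<le> cap" "x \<in> A"
  shows "\<exists>x'\<in>A. h x + ereal (hi - cap) \<le> h x' + (if g x' then lo else ereal hi)"
  using assms by (intro bexI[of _ x]) (auto intro!: add_left_mono)

lemma length_2_conv_nth: "length es = 2 \<Longrightarrow> \<exists>u v. es = [u, v]"
  by (auto simp: numeral_2_eq_2 length_Suc_conv)

text \<open>For MAX-CUT, Ising and colouring: a pair is forbidden throughout \<open>Os\<close>
  exactly when its nodes have equal values in every member, which is an equivalence relation. The
  potential is deterministic, so the empty list serves as the only label and c = 1.\<close>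

lemma pairwise_interaction_model:
  assumes "mK M = 2" "0 < mq M" "lo \<le> hi"
    "hedge M = return_pmf (\<lambda>y. if y ! 0 = y ! 1 then ereal lo else ereal hi)"
  shows "interaction_model M hi (hi - lo) (ereal lo) {[]} (\<lambda>_. {y. y ! 0 = y ! 1})"
proof
  show "hedge M = map_pmf (\<lambda>a y. if y \<in> {y. y ! 0 = y ! 1} then ereal lo else ereal hi) (pmf_of_set {[]})"
    using assms by (simp add: pmf_of_set_singleton)
  show "\<exists>z<mq M. \<forall>a\<in>{[]}. ereal lo \<noteq> - \<infinity> \<or> replicate (mK M) z \<notin> {y. y ! 0 = y ! 1}" using assms by auto
next
  fix n r :: nat and P :: "nat set set" and th :: "nat set \<Rightarrow> nat list \<Rightarrow> ereal" and x and a es :: "nat list"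
  assume "x \<in> {..<n} \<rightarrow>\<^sub>E {..<mq M}"
  then show "\<exists>x'\<in>{..<n} \<rightarrow>\<^sub>E {..<mq M}. Hx M n r P th x + ereal (hi - (hi - lo))
            \<le> Hx M n r P th x' + (if map x' es \<in> {y. y ! 0 = y ! 1} then ereal lo else ereal hi)"
    using assms(3) by (intro exchange_trivial) auto
next
  fix n :: nat and Os :: "(nat \<Rightarrow> nat) set"
  assume "Os \<noteq> {}"
  have "avg {[]} (\<lambda>a. of_bool (\<forall>x\<in>Os. map x es \<in> {y. y ! 0 = y ! 1})) =
      1 * of_bool (\<forall>u\<in>set es. \<forall>v\<in>set es. \<forall>x\<in>Os. x u = x v)" if es: "length es = mK M" for es
  proof -
    obtain u v where "es = [u, v]" using es assms(1) length_2_conv_nth by metis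
    then show ?thesis by (auto simp: avg_def; metis)
  qed
  note eq = this
  have sy: "symp (\<lambda>u v. \<forall>x\<in>Os. x u = x v)" and tr: "transp (\<lambda>u v. \<forall>x\<in>Os. x u = x v)"
    by (auto simp: symp_def transp_def)
  show "\<exists>R c. symp R \<and> transp R \<and> 0 \<le> c \<and> c \<le> 1 \<and>
          (\<forall>es. length es = mK M \<longrightarrow> set es \<subseteq> {..<n} \<longrightarrow>
             avg {[]} (\<lambda>a. of_bool (\<forall>x\<in>Os. map x es \<in> {y. y ! 0 = y ! 1})) = c * of_bool (\<forall>u\<in>set es. \<forall>v\<in>set es. R u v))"
    by (intro exI[of _ "\<lambda>u v. \<forall>x\<in>Os. x u = x v"] exI[of _ 1] conjI allI impI) (rule sy, rule tr, simp, simp, erule eq)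
qed (use assms in auto)

text \<open>The relation says that both nodes are 1 throughout \<open>Os\<close>. It need not be
  reflexive, which is why only symmetry and transitivity are asked for. Although a forbidden edge
  costs infinity, \<open>cap\<close> can be 1: taking one endpoint out of the set costs at most
  1.\<close>

lemma indep_set_interaction_model:
  "interaction_model indep_set 0 1 (-\<infinity>) {[]} (\<lambda>_. {y. y ! 0 = 1 \<and> y ! 1 = 1})"
proof
  show "hedge indep_set = map_pmf (\<lambda>a y. if y \<in> {y. y ! 0 = 1 \<and> y ! 1 = 1} then -\<infinity> else ereal 0) (pmf_of_set {[]})"
    unfolding zero_ereal_def[symmetric] by (simp add: pmf_of_set_singleton indep_set_def)
  show "\<exists>z<mq indep_set. \<forall>a\<in>{[]}. (-\<infinity>::ereal) \<noteq> - \<infinity> \<or> replicate (mK indep_set) z \<notin> {y. y ! 0 = 1 \<and> y ! 1 = 1}"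
    by (intro exI[of _ 0]) (auto simp: indep_set_def)
next
  fix n r :: nat and P :: "nat set set" and th :: "nat set \<Rightarrow> nat list \<Rightarrow> ereal" and x and a es :: "nat list"
  assume P: "finite P" "\<forall>B\<in>P. card B = mK indep_set" and th: "\<forall>B\<in>P. th B \<in> set_pmf (hedge indep_set)"
    and x: "x \<in> {..<n} \<rightarrow>\<^sub>E {..<mq indep_set}" and es: "length es = mK indep_set" "set es \<subseteq> {..<n}"
  obtain u v where uv: "es = [u, v]" using es(1) length_2_conv_nth[of es] by (auto simp: indep_set_def)
  \<comment> \<open>Clearing \<open>u\<close> satisfies the new edge, lowers a single node term by
    at most 1, and cannot create an edge with both ends 1, so no old edge gets worse.\<close>
  define x' where "x' = x(u := 0)"
  have u: "u < n" using es(2) uv by simp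
  have x': "x' \<in> {..<n} \<rightarrow>\<^sub>E {..<mq indep_set}" using x u by (auto simp: x'_def PiE_def Pi_def extensional_def indep_set_def)
  have "(\<Sum>i<n. hnode indep_set (x i)) \<le> (\<Sum>i<n. hnode indep_set (x' i) + of_bool (i = u))"
    by (intro sum_mono) (auto simp: indep_set_def x'_def)
  also have "\<dots> = (\<Sum>i<n. hnode indep_set (x' i)) + 1" using u by (simp add: sum.distrib)
  finally have nodes: "(\<Sum>i<n. hnode indep_set (x i)) - 1 \<le> (\<Sum>i<n. hnode indep_set (x' i))" by simp
  have edges: "(\<Sum>B\<in>P. th B (map x (block_edge r B))) \<le> (\<Sum>B\<in>P. th B (map x' (block_edge r B)))"
  proof (rule sum_mono)
    fix B assume B: "B \<in> P"
    have t: "th B = (\<lambda>y. if y ! 0 = 1 \<and> y ! 1 = 1 then -\<infinity> else 0)" using th B by (auto simp: indep_set_def)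
    have "card B = 2" using P(2) B by (simp add: indep_set_def)
    then have "length (block_edge r B) = 2" by (simp add: block_edge_def)
    then obtain p q where "block_edge r B = [p, q]" using length_2_conv_nth by blast
    then show "th B (map x (block_edge r B)) \<le> th B (map x' (block_edge r B))" unfolding t by (auto simp: x'_def)
  qed
  have "ereal (\<Sum>i<n. hnode indep_set (x i)) + (\<Sum>B\<in>P. th B (map x (block_edge r B))) + ereal (0 - 1)
      = ereal ((\<Sum>i<n. hnode indep_set (x i)) - 1) + (\<Sum>B\<in>P. th B (map x (block_edge r B)))"
    by (cases "\<Sum>B\<in>P. th B (map x (block_edge r B))") auto
  also have "\<dots> \<le> ereal (\<Sum>i<n. hnode indep_set (x' i)) + (\<Sum>B\<in>P. th B (map x' (block_edge r B)))"
    using nodes edges by (intro add_mono) auto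
  finally have "Hx indep_set n r P th x + ereal (0 - 1) \<le> Hx indep_set n r P th x'" unfolding Hx_def .
  moreover have nF: "map x' es \<notin> {y. y ! 0 = 1 \<and> y ! 1 = 1}" using uv by (simp add: x'_def)
  ultimately have "Hx indep_set n r P th x + ereal (0 - 1)
            \<le> Hx indep_set n r P th x' + (if map x' es \<in> {y. y ! 0 = 1 \<and> y ! 1 = 1} then -\<infinity> else ereal 0)"
    by (simp only: if_False add_0_right zero_ereal_def[symmetric])
  then show "\<exists>x'\<in>{..<n} \<rightarrow>\<^sub>E {..<mq indep_set}. Hx indep_set n r P th x + ereal (0 - 1)
            \<le> Hx indep_set n r P th x' + (if map x' es \<in> {y. y ! 0 = 1 \<and> y ! 1 = 1} then -\<infinity> else ereal 0)"
    using x' by blast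
next
  fix n :: nat and Os :: "(nat \<Rightarrow> nat) set"
  assume "Os \<noteq> {}"
  define F where "F = {u. \<forall>x\<in>Os. x u = 1}"
  have eq: "avg {[]} (\<lambda>a. of_bool (\<forall>x\<in>Os. map x es \<in> {y. y ! 0 = 1 \<and> y ! 1 = 1})) =
      1 * of_bool (\<forall>u\<in>set es. \<forall>v\<in>set es. u \<in> F \<and> v \<in> F)" if es: "length es = mK indep_set" for es
  proof -
    obtain u v where uv: "es = [u, v]" using es length_2_conv_nth[of es] by (auto simp: indep_set_def)
    have "(\<forall>x\<in>Os. map x es \<in> {y. y ! 0 = 1 \<and> y ! 1 = 1}) \<longleftrightarrow> u \<in> F \<and> v \<in> F"
      unfolding uv F_def by auto
    moreover have "(\<forall>u\<in>set es. \<forall>v\<in>set es. u \<in> F \<and> v \<in> F) \<longleftrightarrow> u \<in> F \<and> v \<in> F" unfolding uv by auto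
    ultimately show ?thesis by (simp only: avg_def) simp
  qed
  have sy: "symp (\<lambda>u v. u \<in> F \<and> v \<in> F)" and tr: "transp (\<lambda>u v. u \<in> F \<and> v \<in> F)"
    by (auto simp: symp_def transp_def)
  show "\<exists>R c. symp R \<and> transp R \<and> 0 \<le> c \<and> c \<le> 1 \<and>
          (\<forall>es. length es = mK indep_set \<longrightarrow> set es \<subseteq> {..<n} \<longrightarrow>
             avg {[]} (\<lambda>a. of_bool (\<forall>x\<in>Os. map x es \<in> {y. y ! 0 = 1 \<and> y ! 1 = 1})) = c * of_bool (\<forall>u\<in>set es. \<forall>v\<in>set es. R u v))"
    by (intro exI[of _ "\<lambda>u v. u \<in> F \<and> v \<in> F"] exI[of _ 1] conjI allI impI) (rule sy, rule tr, simp, simp, erule eq)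
qed (auto simp: indep_set_def)

lemma finite_sign_vectors: "finite (sign_vectors K)"
  using finite_lists_length_eq[of "{0, 1::nat}" K] by (simp add: sign_vectors_def conj_commute)

lemma replicate_sign_vectors: "b \<in> {0, 1} \<Longrightarrow> replicate K b \<in> sign_vectors K"
  by (auto simp: sign_vectors_def set_replicate_conv_if)

lemma map_sign_vectors:
  assumes "x \<in> {..<n} \<rightarrow>\<^sub>E {..<2}" "set es \<subseteq> {..<n}" "length es = K"
  shows "map x es \<in> sign_vectors K"
proof -
  have "x u \<in> {0, 1}" if "u \<in> set es" for u
  proof -
    have "x u < 2" using assms(1,2) that by (auto simp: PiE_def Pi_def)
    then show ?thesis by auto
  qed
  then have "set (map x es) \<subseteq> {0, 1}" unfolding set_map by (rule image_subsetI)
  then show ?thesis using assms(3) unfolding sign_vectors_def by simp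
qed

lemma avg_of_bool:
  "finite S \<Longrightarrow> avg S (\<lambda>a. of_bool (Q a)) = real (card {a\<in>S. Q a}) / real (card S)"
  by (simp add: avg_def of_bool_def sum.If_cases Int_def)

text \<open>A label forbids just itself. So a label can forbid all of \<open>Os\<close> on an edge
  only if the members of \<open>Os\<close> agree there, and then exactly one label does; hence c.
  Related nodes are those whose values are both constant over \<open>Os\<close>.\<close>

lemma ksat_interaction_model:
  assumes K: "2 \<le> K"
  shows "interaction_model (ksat K) 1 1 0 (sign_vectors K) (\<lambda>a. {a})"
proof
  show "hedge (ksat K) = map_pmf (\<lambda>a y. if y \<in> {a} then 0 else ereal 1) (pmf_of_set (sign_vectors K))"
    unfolding one_ereal_def[symmetric] by (simp add: ksat_def)
  show "\<exists>z<mq (ksat K). \<forall>a\<in>sign_vectors K. (0::ereal) \<noteq> - \<infinity> \<or> replicate (mK (ksat K)) z \<notin> {a}"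
    by (intro exI[of _ 0]) (simp add: ksat_def)
next
  fix n r :: nat and P :: "nat set set" and th :: "nat set \<Rightarrow> nat list \<Rightarrow> ereal" and x and a es :: "nat list"
  assume "x \<in> {..<n} \<rightarrow>\<^sub>E {..<mq (ksat K)}"
  then show "\<exists>x'\<in>{..<n} \<rightarrow>\<^sub>E {..<mq (ksat K)}. Hx (ksat K) n r P th x + ereal (1 - 1)
            \<le> Hx (ksat K) n r P th x' + (if map x' es \<in> {a} then 0 else ereal 1)"
    by (intro exchange_trivial) auto
next
  fix n :: nat and Os :: "(nat \<Rightarrow> nat) set"
  assume Os: "Os \<subseteq> {..<n} \<rightarrow>\<^sub>E {..<mq (ksat K)}" "Os \<noteq> {}"
  then obtain x0 where x0: "x0 \<in> Os" by blast
  define F where "F = {u. \<forall>x\<in>Os. x u = x0 u}"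
  let ?c = "1 / real (card (sign_vectors K))"
  have "avg (sign_vectors K) (\<lambda>a. of_bool (\<forall>x\<in>Os. map x es \<in> {a})) = ?c * of_bool (\<forall>u\<in>set es. \<forall>v\<in>set es. u \<in> F \<and> v \<in> F)"
    if es: "length es = mK (ksat K)" "set es \<subseteq> {..<n}" for es
  proof -
    define b where "b = map x0 es"
    define Q where "Q \<longleftrightarrow> (\<forall>x\<in>Os. map x es = b)"
    have fr: "(\<forall>u\<in>set es. \<forall>v\<in>set es. u \<in> F \<and> v \<in> F) \<longleftrightarrow> Q"
      by (auto simp: F_def Q_def b_def)
    have b: "b \<in> sign_vectors K"
      unfolding b_def using es Os x0 by (intro map_sign_vectors[of _ n]) (auto simp: ksat_def)
    have "(\<forall>x\<in>Os. map x es \<in> {a}) \<longleftrightarrow> Q \<and> a = b" for a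
      using x0 unfolding Q_def b_def by (metis singletonD singletonI)
    then have "{a \<in> sign_vectors K. \<forall>x\<in>Os. map x es \<in> {a}} = (if Q then {b} else {})"
      using b by auto
    then show ?thesis unfolding avg_of_bool[OF finite_sign_vectors] fr by simp
  qed
  moreover have "symp (\<lambda>u v. u \<in> F \<and> v \<in> F)" "transp (\<lambda>u v. u \<in> F \<and> v \<in> F)" by (auto simp: symp_def transp_def)
  moreover have "0 \<le> ?c" "?c \<le> 1" by (auto simp: divide_le_eq_1)
  ultimately show "\<exists>R c. symp R \<and> transp R \<and> 0 \<le> c \<and> c \<le> 1 \<and>
          (\<forall>es. length es = mK (ksat K) \<longrightarrow> set es \<subseteq> {..<n} \<longrightarrow>
             avg (sign_vectors K) (\<lambda>a. of_bool (\<forall>x\<in>Os. map x es \<in> {a})) = c * of_bool (\<forall>u\<in>set es. \<forall>v\<in>set es. R u v))"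
    by (intro exI[of _ "\<lambda>u v. u \<in> F \<and> v \<in> F"] exI[of _ ?c]) blast
qed (use K replicate_sign_vectors[of 0 K] in \<open>auto simp: ksat_def finite_sign_vectors\<close>)

text \<open>Flipping all values preserves the constraint, so what freezes is relative: two nodes are
  related if whether they agree is the same throughout \<open>Os\<close>. All of \<open>Os\<close>
  is then forbidden on the block by exactly two labels, a vector and its negation; hence c.\<close>

lemma naeksat_interaction_model:
  assumes K: "2 \<le> K"
  shows "interaction_model (naeksat K) 1 1 0 (sign_vectors K) (\<lambda>a. {a, map (\<lambda>t. 1 - t) a})"
proof
  show "hedge (naeksat K) = map_pmf (\<lambda>a y. if y \<in> {a, map (\<lambda>t. 1 - t) a} then 0 else ereal 1) (pmf_of_set (sign_vectors K))"
    unfolding one_ereal_def[symmetric] by (simp add: naeksat_def)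
  show "\<exists>z<mq (naeksat K). \<forall>a\<in>sign_vectors K. (0::ereal) \<noteq> - \<infinity> \<or> replicate (mK (naeksat K)) z \<notin> {a, map (\<lambda>t. 1 - t) a}"
    by (intro exI[of _ 0]) (simp add: naeksat_def)
next
  fix n r :: nat and P :: "nat set set" and th :: "nat set \<Rightarrow> nat list \<Rightarrow> ereal" and x and a es :: "nat list"
  assume "x \<in> {..<n} \<rightarrow>\<^sub>E {..<mq (naeksat K)}"
  then show "\<exists>x'\<in>{..<n} \<rightarrow>\<^sub>E {..<mq (naeksat K)}. Hx (naeksat K) n r P th x + ereal (1 - 1)
            \<le> Hx (naeksat K) n r P th x' + (if map x' es \<in> {a, map (\<lambda>t. 1 - t) a} then 0 else ereal 1)"
    by (intro exchange_trivial) auto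
next
  fix n :: nat and Os :: "(nat \<Rightarrow> nat) set"
  assume Os: "Os \<subseteq> {..<n} \<rightarrow>\<^sub>E {..<mq (naeksat K)}" "Os \<noteq> {}"
  then obtain x0 where x0: "x0 \<in> Os" by blast
  \<comment> \<open>The bounds u < n and v < n restrict \<open>R\<close> to nodes where assignments
    have only two values; transitivity rests on this.\<close>
  define R where "R u v \<longleftrightarrow> (\<forall>x\<in>Os. (x u = x v) = (x0 u = x0 v)) \<and> u < n \<and> v < n" for u v
  have x01: "x u = 0 \<or> x u = 1" if "x \<in> Os" "u < n" for x u
  proof -
    have "x u < 2" using Os that by (auto simp: naeksat_def PiE_def Pi_def)
    then show ?thesis by auto
  qed
  let ?c = "2 / real (card (sign_vectors K))"
  let ?neg = "\<lambda>a::nat list. map (\<lambda>t. 1 - t) a"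
  have "avg (sign_vectors K) (\<lambda>a. of_bool (\<forall>x\<in>Os. map x es \<in> {a, ?neg a})) = ?c * of_bool (\<forall>u\<in>set es. \<forall>v\<in>set es. R u v)"
    if es: "length es = mK (naeksat K)" "set es \<subseteq> {..<n}" for es
  proof -
    define b where "b = map x0 es"
    have b: "b \<in> sign_vectors K"
      unfolding b_def using es Os x0 by (intro map_sign_vectors[of _ n]) (auto simp: naeksat_def)
    have nb: "?neg b \<in> sign_vectors K" using b by (auto simp: sign_vectors_def)
    \<comment> \<open>Because of natural subtraction, negation is an involution only on vectors with
      entries 0 and 1.\<close>
    have negneg: "?neg (?neg a) = a" if "a \<in> sign_vectors K" for a
      using that by (auto simp: sign_vectors_def intro!: map_idI)
    obtain u0 where u0: "u0 \<in> set es" using es(1) K by (cases es) (auto simp: naeksat_def)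
    \<comment> \<open>Distinctness of the two labels makes the count 2; it holds because the edge is
      nonempty.\<close>
    have "b \<noteq> ?neg b"
    proof
      assume "b = ?neg b"
      then have "x0 u0 = 1 - x0 u0" using u0 unfolding b_def by simp
      then show False by arith
    qed
    have fr: "(\<forall>u\<in>set es. \<forall>v\<in>set es. R u v) \<longleftrightarrow> (\<forall>x\<in>Os. map x es \<in> {b, ?neg b})"
    proof
      assume R: "\<forall>u\<in>set es. \<forall>v\<in>set es. R u v"
      show "\<forall>x\<in>Os. map x es \<in> {b, ?neg b}"
      proof
        fix x assume x: "x \<in> Os"
        show "map x es \<in> {b, ?neg b}"
        proof (cases "x u0 = x0 u0")
          case True
          have "x u = x0 u" if "u \<in> set es" for u
          proof -
            have "(x u = x u0) = (x0 u = x0 u0)" "u < n" "u0 < n" using R that u0 x by (auto simp: R_def)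
            then show ?thesis using True x01[OF x, of u] x01[OF x0, of u] x01[OF x, of u0] by auto
          qed
          then show ?thesis by (simp add: b_def)
        next
          case False
          have "x u = 1 - x0 u" if "u \<in> set es" for u
          proof -
            have "(x u = x u0) = (x0 u = x0 u0)" "u < n" "u0 < n" using R that u0 x by (auto simp: R_def)
            then show ?thesis using False x01[OF x, of u] x01[OF x0, of u] x01[OF x, of u0] x01[OF x0, of u0] by auto
          qed
          then show ?thesis by (simp add: b_def)
        qed
      qed
    next
      assume h: "\<forall>x\<in>Os. map x es \<in> {b, ?neg b}"
      show "\<forall>u\<in>set es. \<forall>v\<in>set es. R u v"
      proof (intro ballI)
        fix u v assume uv: "u \<in> set es" "v \<in> set es"
        have n: "u < n" "v < n" using uv es(2) by auto
        have "(x u = x v) = (x0 u = x0 v)" if x: "x \<in> Os" for x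
        proof -
          have "map x es = map x0 es \<or> map x es = map (\<lambda>u. 1 - x0 u) es" using h x by (auto simp: b_def)
          then have "(x u = x0 u \<and> x v = x0 v) \<or> (x u = 1 - x0 u \<and> x v = 1 - x0 v)" using uv by auto
          then show ?thesis using x01[OF x0 n(1)] x01[OF x0 n(2)] by auto
        qed
        then show "R u v" using n by (simp add: R_def)
      qed
    qed
    have "{a \<in> sign_vectors K. \<forall>x\<in>Os. map x es \<in> {a, ?neg a}} = (if \<forall>x\<in>Os. map x es \<in> {b, ?neg b} then {b, ?neg b} else {})"
    proof -
      have ab: "a = b \<or> a = ?neg b" if "a \<in> sign_vectors K" "\<forall>x\<in>Os. map x es \<in> {a, ?neg a}" for a
      proof -
        have "b = a \<or> b = ?neg a" using that(2) x0 by (auto simp: b_def)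
        then show ?thesis using negneg[OF that(1)] by auto
      qed
      show ?thesis
      proof (cases "\<forall>x\<in>Os. map x es \<in> {b, ?neg b}")
        case True
        then have "\<forall>x\<in>Os. map x es \<in> {?neg b, ?neg (?neg b)}" unfolding negneg[OF b] by blast
        then have "{a \<in> sign_vectors K. \<forall>x\<in>Os. map x es \<in> {a, ?neg a}} = {b, ?neg b}"
          using True b nb ab by blast
        then show ?thesis unfolding if_P[OF True] .
      next
        case False
        have "\<not> (\<forall>x\<in>Os. map x es \<in> {a, ?neg a})" if a: "a \<in> sign_vectors K" for a
        proof
          assume h: "\<forall>x\<in>Os. map x es \<in> {a, ?neg a}"
          then have "{a, ?neg a} = {b, ?neg b}" using ab[OF a h] negneg[OF b] by auto
          then show False using h False by simp
        qed
        then have "{a \<in> sign_vectors K. \<forall>x\<in>Os. map x es \<in> {a, ?neg a}} = {}" by blast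
        then show ?thesis unfolding if_not_P[OF False] .
      qed
    qed
    then show ?thesis unfolding avg_of_bool[OF finite_sign_vectors] fr using \<open>b \<noteq> ?neg b\<close> by simp
  qed
  moreover have "symp R" unfolding symp_def R_def by metis
  moreover have "transp R"
  proof (rule transpI)
    \<comment> \<open>With two values only, whether u and w agree is determined by whether u, v and
      v, w agree.\<close>
    fix u v w assume uv: "R u v" and vw: "R v w"
    have n: "u < n" "v < n" "w < n" using uv vw by (auto simp: R_def)
    have "(x u = x w) = (x0 u = x0 w)" if x: "x \<in> Os" for x
    proof -
      have "(x u = x v) = (x0 u = x0 v)" "(x v = x w) = (x0 v = x0 w)" using uv vw x by (auto simp: R_def)
      then show ?thesis
        using x01[OF x n(1)] x01[OF x n(2)] x01[OF x n(3)] x01[OF x0 n(1)] x01[OF x0 n(2)] x01[OF x0 n(3)] by (elim disjE) simp_all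
    qed
    then show "R u w" using n by (simp add: R_def)
  qed
  \<comment> \<open>The two constant vectors are distinct sign vectors, so the denominator is at
    least 2.\<close>
  moreover have "?c \<le> 1"
  proof -
    have "replicate K 0 \<noteq> replicate K (1::nat)" using K by (cases K) auto
    then have "card {replicate K 0, replicate K (1::nat)} = 2" by simp
    moreover have "card {replicate K 0, replicate K (1::nat)} \<le> card (sign_vectors K)"
      using replicate_sign_vectors finite_sign_vectors by (intro card_mono) auto
    ultimately show ?thesis by simp
  qed
  ultimately show "\<exists>R c. symp R \<and> transp R \<and> 0 \<le> c \<and> c \<le> 1 \<and>
          (\<forall>es. length es = mK (naeksat K) \<longrightarrow> set es \<subseteq> {..<n} \<longrightarrow>
             avg (sign_vectors K) (\<lambda>a. of_bool (\<forall>x\<in>Os. map x es \<in> {a, ?neg a})) = c * of_bool (\<forall>u\<in>set es. \<forall>v\<in>set es. R u v))"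
    by (intro exI[of _ R] exI[of _ ?c] conjI allI impI) auto
qed (use K replicate_sign_vectors[of 0 K] in \<open>auto simp: naeksat_def finite_sign_vectors\<close>)

theorem theorem7:
  fixes M :: model and r :: nat
  assumes "r > 0" and "six_models M"
  shows "\<exists>C::real. \<forall>N1 N2::nat.
           mK M dvd N1 * r \<longrightarrow> mK M dvd N2 * r \<longrightarrow>
           EH M (N1 + N2) r \<ge> EH M N1 r + EH M N2 r - C * real (N1 + N2) powr (5/6)"
proof -
  have "\<exists>hi cap lo Sg Fb. interaction_model M hi cap lo Sg Fb"
    using assms(2) unfolding six_models_def
  proof (elim disjE exE conjE)
    assume "M = indep_set"
    then show ?thesis using indep_set_interaction_model by blast
  next
    assume "M = maxcut"
    then have "interaction_model M 1 (1 - 0) (ereal 0) {[]} (\<lambda>_. {y. y ! 0 = y ! 1})"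
      by (intro pairwise_interaction_model) (auto simp: maxcut_def intro!: ext)
    then show ?thesis by blast
  next
    fix \<beta> Bf :: real assume "\<beta> > 0" "M = afm_ising \<beta> Bf"
    then have "interaction_model M \<beta> (\<beta> - (- \<beta>)) (ereal (- \<beta>)) {[]} (\<lambda>_. {y. y ! 0 = y ! 1})"
      by (intro pairwise_interaction_model) (auto simp: afm_ising_def)
    then show ?thesis by blast
  next
    fix q assume "2 \<le> q" "M = coloring q"
    then have "interaction_model M 1 (1 - 0) (ereal 0) {[]} (\<lambda>_. {y. y ! 0 = y ! 1})"
      by (intro pairwise_interaction_model) (auto simp: coloring_def intro!: ext)
    then show ?thesis by blast
  next
    fix K assume "2 \<le> K" "M = ksat K"
    then show ?thesis using ksat_interaction_model by blast
  next
    fix K assume "2 \<le> K" "M = naeksat K"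
    then show ?thesis using naeksat_interaction_model by blast
  qed
  then show ?thesis using interaction_model.EH_near_superadditive[OF _ assms(1)] by blast
qed

end
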